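(* Let $1\le k<d$ be integers. Let $\mathrm L_{d-k}:\mathcal S'(\mathbb R^{d-k})\to\mathcal S'(\mathbb R^{d-k})$ and $\mathrm L_d:\mathcal S'(\mathbb R^d)\to\mathcal S'(\mathbb R^d)$ be (continuous) isotropic linear shift-invariant operators that share the same radial frequency profile: their frequency responses satisfy $$\hat L_{d-k}(\boldsymbol\omega)=\hat L_{\mathrm{rad}}(\|\boldsymbol\omega\|_2),\ \boldsymbol\omega\in\mathbb R^{d-k},\qquad \hat L_d(\boldsymbol\xi)=\hat L_{\mathrm{rad}}(\|\boldsymbol\xi\|_2),\ \boldsymbol\xi\in\mathbb R^{d},$$ where $\hat L_{\mathrm{rad}}\in\mathcal O_M(\mathbb R)$. Then $$\mathrm L_{d-k}\mathcal R_k=\mathcal R_k\mathrm L_d\quad\text{on }\mathcal S'(\mathbb R^d)$$ and $$\mathcal R_k^*\mathrm L_{d-k}^*=\mathrm L_d^*\mathcal R_k^*\quad\text{on }\mathcal S_k'.$$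
   Context: Notation. $V_{d-k}(\mathbb R^d)=\{\mathbf A\in\mathbb R^{(d-k)\times d}:\mathbf A\mathbf A^{T}=\mathbf I_{d-k}\}$, with invariant (Haar) measure $\sigma$ of total mass $\prod_{n=k+1}^{d}|\mathbb S^{n-1}|$ ($|\mathbb S^m|$ = surface area, $|\mathbb S^0|=2$). $\Xi_k=V_{d-k}(\mathbb R^d)\times\mathbb R^{d-k}$, and $\mathcal S(\Xi_k)$ is the Fréchet space of smooth functions on $\Xi_k$ rapidly decreasing in $\mathbf t$. For $\varphi\in\mathcal S(\mathbb R^d)$, $\mathcal R_k\{\varphi\}(\mathbf A,\mathbf t)=\int_{\{\mathbf A\mathbf x=\mathbf 0\}}\varphi(\mathbf x+\mathbf A^{T}\mathbf t)\,d\mathbf x$; on functions $\mathcal R_k^*\{g\}(\mathbf x)=\int g(\mathbf A,\mathbf A\mathbf x)\,d\sigma(\mathbf A)$. $\mathcal S_k=\mathcal R_k(\mathcal S(\mathbb R^d))\subset\mathcal S(\Xi_k)$ with the inherited topology. $\mathrm K_{d-k}$ is the convolution operator in $\mathbf t$ with frequency response $c_{d,k}\|\boldsymbol\omega\|_2^k$, $c_{d,k}=\frac{1}{(2\pi)^k}\frac{|\mathbb S^{k-1}|}{|\mathbb S^{d-k-1}|}\prod_{n=k}^{d-1}|\mathbb S^{n-1}|^{-1}$; one has $\mathcal R_k^*\mathrm K_{d-k}\mathcal R_k=\mathrm{Id}$ on $\mathcal S(\mathbb R^d)$. The space $\mathrm K_{d-k}\mathcal R_k(\mathcal S(\mathbb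 R^d))$ carries the topology making $\mathcal R_k^*:\mathrm K_{d-k}\mathcal R_k(\mathcal S(\mathbb R^d))\to\mathcal S(\mathbb R^d)$ a homeomorphism. Distributional operators: $\mathcal R_k:\mathcal S'(\mathbb R^d)\to(\mathrm K_{d-k}\mathcal R_k(\mathcal S(\mathbb R^d)))'$ is the dual map of $\mathcal R_k^*:\mathrm K_{d-k}\mathcal R_k(\mathcal S(\mathbb R^d))\to\mathcal S(\mathbb R^d)$; $\mathcal R_k^*:\mathcal S_k'\to\mathcal S'(\mathbb R^d)$ is the dual map of $\mathcal R_k:\mathcal S(\mathbb R^d)\to\mathcal S_k$. A linear shift-invariant operator $\mathrm L$ on $\mathbb R^n$ with frequency response $\hat L$ acts by $\mathrm L\varphi=\mathcal F_n^{-1}\{\hat L\,\hat\varphi\}$, where $\hat\varphi(\boldsymbol\xi)=\int\varphi(\mathbf x)e^{-\mathrm i\boldsymbol\xi^{T}\mathbf x}d\mathbf x$, and $\mathrm L^*$ is its adjoint. $\mathcal O_M(\mathbb R)$ is the space of smooth functions of slow growth (every derivative is bounded by a polynomial). On functions on $\Xi_k$, $\mathrm L_{d-k}$ and $\mathrm L_{d-k}^*$ act in the variable $\mathbf t$. They act on $(\mathrm K_{d-k}\mathcal R_k(\mathcal S(\mathbb R^d)))'$ and on $\mathcal S_k'$ by duality: $\mathrm L_{d-k}$ on $(\mathrm K_{d-k}\mathcal R_k(\mathcal S(\mathbb R^d)))'$ is the dual map of $\mathrm L_{d-k}^*$ on $\mathrm K_{d-k}\mathcal R_k(\mathcal S(\mathbb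 R^d))$, and $\mathrm L_{d-k}^*$ on $\mathcal S_k'$ is the dual map of $\mathrm L_{d-k}$ on $\mathcal S_k$. The first identity is an equality in $(\mathrm K_{d-k}\mathcal R_k(\mathcal S(\mathbb R^d)))'$, the second an equality in $\mathcal S'(\mathbb R^d)$. *)

theory Defs
  imports "HOL-Analysis.Analysis"
begin

section \<open>Schwartz functions and tempered distributions\<close>

definition partial_deriv ::
  "'a::euclidean_space \<Rightarrow> ('a \<Rightarrow> complex) \<Rightarrow> 'a \<Rightarrow> complex" where
  "partial_deriv b f x = vector_derivative (\<lambda>s. f (x + s *\<^sub>R b)) (at 0)"

definition partials ::
  "'a::euclidean_space list \<Rightarrow> ('a \<Rightarrow> complex) \<Rightarrow> 'a \<Rightarrow> complex" where
  "partials bs f = foldr partial_deriv bs f"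

definition smooth :: "('a::euclidean_space \<Rightarrow> complex) \<Rightarrow> bool" where
  "smooth f \<longleftrightarrow> (\<forall>bs\<in>lists Basis. \<forall>x. partials bs f differentiable (at x))"

text \<open>The space \<open>\<O>\<^sub>M\<close> of smooth functions of slow growth.\<close>

definition slow_growth :: "('a::euclidean_space \<Rightarrow> complex) \<Rightarrow> bool" where
  "slow_growth f \<longleftrightarrow> smooth f \<and>
     (\<forall>bs\<in>lists Basis. \<exists>C N. \<forall>x. cmod (partials bs f x) \<le> C * (1 + norm x) ^ N)"

definition schwartz_space :: "('a::euclidean_space \<Rightarrow> complex) set" where
  "schwartz_space = {f. smooth f \<and>
     (\<forall>bs\<in>lists Basis. \<forall>N. bounded (range (\<lambda>x. (1 + norm x) ^ N *\<^sub>R partials bs f x)))}"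

text \<open>The locally convex topology on a space \<open>X\<close> of functions given by the seminorms
  \<open>p i\<close>, \<open>i \<in> I\<close>.\<close>

definition seminorm_topology ::
  "('x \<Rightarrow> complex) set \<Rightarrow> 'i set \<Rightarrow> ('i \<Rightarrow> ('x \<Rightarrow> complex) \<Rightarrow> real) \<Rightarrow> ('x \<Rightarrow> complex) topology"
  where
  "seminorm_topology X I p = topology_generated_by
     {{g \<in> X. p i (\<lambda>x. g x - f x) < e} |i f e. i \<in> I \<and> f \<in> X \<and> e > 0}"

definition schwartz :: "('a::euclidean_space \<Rightarrow> complex) topology" where
  "schwartz = seminorm_topology schwartz_space (UNIV \<times> lists Basis)
     (\<lambda>(N, bs) f. SUP x. (1 + norm x) ^ N * cmod (partials bs f x))"

text \<open>Functionals on a topological function space are made \<open>extensional\<close>, so that two elements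
  of the dual are equal as soon as they agree on the space. All duality pairings are bilinear
  (no complex conjugation).\<close>

definition dual :: "('x \<Rightarrow> complex) topology \<Rightarrow> (('x \<Rightarrow> complex) \<Rightarrow> complex) set" where
  "dual T = {u \<in> extensional (topspace T).
     continuous_map T euclidean u \<and>
     (\<forall>f\<in>topspace T. \<forall>g\<in>topspace T. u (\<lambda>x. f x + g x) = u f + u g) \<and>
     (\<forall>c. \<forall>f\<in>topspace T. u (\<lambda>x. c * f x) = c * u f)}"

definition weak_star ::
  "('x \<Rightarrow> complex) topology \<Rightarrow> (('x \<Rightarrow> complex) \<Rightarrow> complex) topology" where
  "weak_star T = subtopology (product_topology (\<lambda>_. euclidean) (topspace T)) (dual T)"

definition dual_map ::
  "('x \<Rightarrow> complex) topology \<Rightarrow> (('x \<Rightarrow> complex) \<Rightarrow> 'y \<Rightarrow> complex) \<Rightarrow>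
   (('y \<Rightarrow> complex) \<Rightarrow> complex) \<Rightarrow> ('x \<Rightarrow> complex) \<Rightarrow> complex" where
  "dual_map T F u = restrict (\<lambda>\<phi>. u (F \<phi>)) (topspace T)"

definition regular_distr ::
  "('a::euclidean_space \<Rightarrow> complex) \<Rightarrow> ('a \<Rightarrow> complex) \<Rightarrow> complex" where
  "regular_distr g = restrict (\<lambda>\<phi>. \<integral>x. g x * \<phi> x \<partial>lborel) (topspace schwartz)"

section \<open>Linear shift-invariant operators\<close>

definition fourier :: "('a::euclidean_space \<Rightarrow> complex) \<Rightarrow> 'a \<Rightarrow> complex" where
  "fourier f \<xi> = (\<integral>x. f x * exp (- (\<i> * of_real (\<xi> \<bullet> x))) \<partial>lborel)"

definition fourier_inv :: "('a::euclidean_space \<Rightarrow> complex) \<Rightarrow> 'a \<Rightarrow> complex" where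
  "fourier_inv g x =
     (\<integral>\<xi>. g \<xi> * exp (\<i> * of_real (\<xi> \<bullet> x)) \<partial>lborel) / of_real ((2 * pi) ^ DIM('a))"

text \<open>The action on functions of the operator with frequency response \<open>m\<close>.\<close>

definition multiplier ::
  "('a::euclidean_space \<Rightarrow> complex) \<Rightarrow> ('a \<Rightarrow> complex) \<Rightarrow> 'a \<Rightarrow> complex" where
  "multiplier m f = fourier_inv (\<lambda>\<xi>. m \<xi> * fourier f \<xi>)"

text \<open>The adjoint (for the bilinear pairing) of the operator with frequency response \<open>m\<close> has
  frequency response \<open>\<xi> \<mapsto> m (- \<xi>)\<close>; see \<open>multiplier_adjoint\<close> below.\<close>

definition multiplier_adj ::
  "('a::euclidean_space \<Rightarrow> complex) \<Rightarrow> ('a \<Rightarrow> complex) \<Rightarrow> 'a \<Rightarrow> complex" where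
  "multiplier_adj m = multiplier (\<lambda>\<xi>. m (- \<xi>))"

lemma exp_pairing_swap:
  fixes a b :: "'a::euclidean_space \<Rightarrow> complex"
  assumes a: "integrable lborel a" and b: "integrable lborel b"
  shows "(\<integral>x. (\<integral>\<xi>. a \<xi> * exp (\<i> * of_real (\<xi> \<bullet> x)) \<partial>lborel) * b x \<partial>lborel)
       = (\<integral>\<xi>. a \<xi> * fourier b (- \<xi>) \<partial>lborel)"
proof -
  let ?F = "\<lambda>(x::'a, \<xi>). a \<xi> * exp (\<i> * of_real (\<xi> \<bullet> x)) * b x"
  have [measurable]: "a \<in> borel_measurable borel" "b \<in> borel_measurable borel"
    using a b by auto
  have ab: "integrable (lborel \<Otimes>\<^sub>M lborel) (\<lambda>(x, \<xi>). b x * a \<xi>)"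
    by (rule lborel_pair.Fubini_integrable)
       (use a b in \<open>auto simp: norm_mult intro!: integrable_mult_left integrable_norm\<close>)
  have F: "integrable (lborel \<Otimes>\<^sub>M lborel) ?F"
    by (rule Bochner_Integration.integrable_bound[OF ab])
       (auto simp: norm_mult case_prod_beta split_beta')
  have "(\<integral>x. (\<integral>\<xi>. a \<xi> * exp (\<i> * of_real (\<xi> \<bullet> x)) \<partial>lborel) * b x \<partial>lborel)
      = (\<integral>x. (\<integral>\<xi>. ?F (x, \<xi>) \<partial>lborel) \<partial>lborel)"
    by simp
  also have "\<dots> = (\<integral>\<xi>. (\<integral>x. ?F (x, \<xi>) \<partial>lborel) \<partial>lborel)"
    using lborel_pair.Fubini_integral[of "\<lambda>x \<xi>. ?F (x, \<xi>)"] F by simp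
  also have "\<dots> = (\<integral>\<xi>. a \<xi> * fourier b (- \<xi>) \<partial>lborel)"
    by (simp add: fourier_def mult.assoc mult.commute[of "b _"])
  finally show ?thesis .
qed

lemma lborel_integral_uminus:
  fixes h :: "'a::euclidean_space \<Rightarrow> complex"
  shows "(\<integral>x. h (- x) \<partial>lborel) = (\<integral>x. h x \<partial>lborel)"
proof -
  have r: "integral\<^sup>L lborel h = (\<integral>x. h (- x) \<partial>lborel)" if "h \<in> borel_measurable borel"
  proof -
    have "lborel = distr lborel borel (uminus :: 'a \<Rightarrow> 'a)"
      using lborel_affine[of "-1" "0 :: 'a"] by (simp add: density_1)
    then show ?thesis
      using integral_distr[of "uminus :: 'a \<Rightarrow> 'a" lborel borel h] that by simp
  qed
  show ?thesis
  proof (cases "h \<in> borel_measurable borel")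
    case True
    then show ?thesis by (simp add: r)
  next
    case False
    have "(\<lambda>x. h (- x)) \<notin> borel_measurable borel"
    proof
      assume "(\<lambda>x. h (- x)) \<in> borel_measurable borel"
      then have "(\<lambda>x. h (- x)) \<circ> uminus \<in> borel_measurable borel"
        by (rule measurable_comp[rotated]) simp
      with False show False by (simp add: comp_def)
    qed
    with False have "\<not> integrable lborel h" "\<not> integrable lborel (\<lambda>x. h (- x))"
      using borel_measurable_integrable[of lborel h]
        borel_measurable_integrable[of lborel "\<lambda>x. h (- x)"] by auto
    then show ?thesis by (simp add: not_integrable_integral_eq)
  qed
qed

lemma multiplier_adjoint:
  fixes f g m :: "'a::euclidean_space \<Rightarrow> complex"
  assumes "integrable lborel f" "integrable lborel g"
    and "integrable lborel (\<lambda>\<xi>. m \<xi> * fourier f \<xi>)"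
    and "integrable lborel (\<lambda>\<xi>. m (- \<xi>) * fourier g \<xi>)"
  shows "(\<integral>x. multiplier m f x * g x \<partial>lborel) = (\<integral>x. f x * multiplier_adj m g x \<partial>lborel)"
proof -
  let ?c = "of_real ((2 * pi) ^ DIM('a)) :: complex"
  have "(\<integral>x. multiplier m f x * g x \<partial>lborel)
      = (\<integral>\<xi>. m \<xi> * fourier f \<xi> * fourier g (- \<xi>) \<partial>lborel) / ?c"
    unfolding exp_pairing_swap[OF assms(3,2), symmetric]
    by (simp add: multiplier_def fourier_inv_def)
  also have "(\<integral>\<xi>. m \<xi> * fourier f \<xi> * fourier g (- \<xi>) \<partial>lborel)
      = (\<integral>\<xi>. m (- \<xi>) * fourier g \<xi> * fourier f (- \<xi>) \<partial>lborel)"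
    using lborel_integral_uminus[of "\<lambda>\<xi>. m \<xi> * fourier f \<xi> * fourier g (- \<xi>)"]
    by (simp add: mult_ac)
  also have "\<dots> / ?c = (\<integral>x. f x * multiplier_adj m g x \<partial>lborel)"
    unfolding exp_pairing_swap[OF assms(4,1), symmetric]
    by (simp add: multiplier_adj_def multiplier_def fourier_inv_def mult_ac)
  finally show ?thesis .
qed

text \<open>\<open>\<langle>f(\<cdot> - h), \<phi>\<rangle> = \<langle>f, \<phi>(\<cdot> + h)\<rangle>\<close>\<close>

definition shift_distr ::
  "'a::euclidean_space \<Rightarrow> (('a \<Rightarrow> complex) \<Rightarrow> complex) \<Rightarrow> ('a \<Rightarrow> complex) \<Rightarrow> complex" where
  "shift_distr h = dual_map schwartz (\<lambda>\<phi> x. \<phi> (x + h))"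

definition continuous_lsi ::
  "((('a::euclidean_space \<Rightarrow> complex) \<Rightarrow> complex) \<Rightarrow> ('a \<Rightarrow> complex) \<Rightarrow> complex) \<Rightarrow> bool" where
  "continuous_lsi L \<longleftrightarrow>
     continuous_map (weak_star schwartz) (weak_star schwartz) L \<and>
     (\<forall>f\<in>dual schwartz. \<forall>g\<in>dual schwartz. \<forall>c.
        L (\<lambda>\<phi>\<in>topspace schwartz. c * f \<phi> + g \<phi>) =
        (\<lambda>\<phi>\<in>topspace schwartz. c * L f \<phi> + L g \<phi>)) \<and>
     (\<forall>f\<in>dual schwartz. \<forall>h. L (shift_distr h f) = shift_distr h (L f))"

text \<open>By weak-* continuity and density of the Schwartz space in its dual, a continuous operator
  is determined by its values on Schwartz functions.\<close>

definition has_frequency_response ::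
  "((('a::euclidean_space \<Rightarrow> complex) \<Rightarrow> complex) \<Rightarrow> ('a \<Rightarrow> complex) \<Rightarrow> complex) \<Rightarrow>
   ('a \<Rightarrow> complex) \<Rightarrow> bool" where
  "has_frequency_response L m \<longleftrightarrow>
     (\<forall>\<phi>\<in>schwartz_space. L (regular_distr \<phi>) = regular_distr (multiplier m \<phi>))"

section \<open>The Stiefel manifold and Schwartz functions on \<open>\<Xi>\<close>\<close>

text \<open>Throughout, \<open>'d\<close> indexes the coordinates of the full space, \<open>'m\<close> those of the
  transverse space, and \<open>k = CARD('d) - CARD('m)\<close>.\<close>

definition stiefel :: "(real^'d^'m) set" where
  "stiefel = {A. A ** transpose A = mat 1}"

text \<open>The surface area of the unit sphere in dimension \<open>n + 1\<close>, which is \<open>n + 1\<close> times the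
  volume of the unit ball there.\<close>

definition sphere_area :: "nat \<Rightarrow> real" where
  "sphere_area n = real (n + 1) * unit_ball_vol (real (n + 1))"

text \<open>The invariant measure, as a Borel measure on all matrices that is carried by the Stiefel
  manifold, on which the orthogonal group acts transitively from the right.\<close>

definition stiefel_haar :: "nat \<Rightarrow> (real^'d^'m) measure \<Rightarrow> bool" where
  "stiefel_haar k \<sigma> \<longleftrightarrow>
     sets \<sigma> = sets borel \<and>
     emeasure \<sigma> (- stiefel) = 0 \<and>
     emeasure \<sigma> UNIV = ennreal (\<Prod>n=k+1..CARD('d). sphere_area (n - 1)) \<and>
     (\<forall>U. orthogonal_matrix U \<longrightarrow> distr \<sigma> borel (\<lambda>A. A ** U) = \<sigma>)"

text \<open>\<open>plane_rotation i j s = exp (s X)\<close>, where \<open>X\<close> is the skew-symmetric matrix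
  \<open>E\<^sub>i\<^sub>j - E\<^sub>j\<^sub>i\<close>, for which \<open>X\<^sup>3 = - X\<close>.\<close>

definition skew_unit :: "'d \<Rightarrow> 'd \<Rightarrow> real^'d^'d" where
  "skew_unit i j = (\<chi> a b. of_bool (a = i \<and> b = j) - of_bool (a = j \<and> b = i))"

definition plane_rotation :: "'d \<Rightarrow> 'd \<Rightarrow> real \<Rightarrow> real^'d^'d" where
  "plane_rotation i j s =
     mat 1 + sin s *\<^sub>R skew_unit i j + (1 - cos s) *\<^sub>R (skew_unit i j ** skew_unit i j)"

text \<open>Derivatives on \<open>\<Xi>\<close> are taken along the flows of these vector fields: the fields
  \<open>A \<mapsto> A X\<close> with \<open>X = skew_unit i j\<close> span the tangent space of the Stiefel manifold at
  each of its points, and the coordinate fields span the directions of \<open>t\<close>. Hence a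
  function is smooth iff all its iterated derivatives along them exist and are continuous, and
  these derivatives generate the Frechet topology.\<close>

datatype ('d, 'm) frame_field = Rot 'd 'd | Trans 'm

fun flow ::
  "('d, 'm) frame_field \<Rightarrow> real \<Rightarrow> (real^'d^'m) \<times> (real^'m) \<Rightarrow> (real^'d^'m) \<times> (real^'m)" where
  "flow (Rot i j) s (A, t) = (A ** plane_rotation i j s, t)"
| "flow (Trans l) s (A, t) = (A, t + s *\<^sub>R axis l 1)"

definition flow_deriv ::
  "('d, 'm) frame_field \<Rightarrow> ((real^'d^'m) \<times> (real^'m) \<Rightarrow> complex) \<Rightarrow>
   (real^'d^'m) \<times> (real^'m) \<Rightarrow> complex" where
  "flow_deriv v g p = vector_derivative (\<lambda>s. g (flow v s p)) (at 0)"

definition flow_derivs ::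
  "('d, 'm) frame_field list \<Rightarrow> ((real^'d^'m) \<times> (real^'m) \<Rightarrow> complex) \<Rightarrow>
   (real^'d^'m) \<times> (real^'m) \<Rightarrow> complex" where
  "flow_derivs vs g = foldr flow_deriv vs g"

text \<open>A function on \<open>\<Xi> = stiefel \<times> UNIV\<close> is represented by its extension by zero.\<close>

definition schwartz_space_Xi :: "((real^'d^'m) \<times> (real^'m) \<Rightarrow> complex) set" where
  "schwartz_space_Xi = {g.
     (\<forall>A t. A \<notin> stiefel \<longrightarrow> g (A, t) = 0) \<and>
     (\<forall>vs. continuous_on (stiefel \<times> UNIV) (flow_derivs vs g) \<and>
        (\<forall>v. \<forall>p\<in>stiefel \<times> UNIV. (\<lambda>s. flow_derivs vs g (flow v s p)) differentiable (at 0)) \<and>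
        (\<forall>N. bounded ((\<lambda>(A, t). (1 + norm t) ^ N *\<^sub>R flow_derivs vs g (A, t)) `
               (stiefel \<times> UNIV))))}"

definition schwartz_Xi :: "((real^'d^'m) \<times> (real^'m) \<Rightarrow> complex) topology" where
  "schwartz_Xi = seminorm_topology schwartz_space_Xi UNIV
     (\<lambda>(N, vs) g. SUP (A, t)\<in>stiefel \<times> UNIV. (1 + norm t) ^ N * cmod (flow_derivs vs g (A, t)))"

definition on_t ::
  "((real^'m \<Rightarrow> complex) \<Rightarrow> real^'m \<Rightarrow> complex) \<Rightarrow>
   ((real^'d^'m) \<times> (real^'m) \<Rightarrow> complex) \<Rightarrow> (real^'d^'m) \<times> (real^'m) \<Rightarrow> complex" where
  "on_t T g = (\<lambda>(A, t). T (\<lambda>s. g (A, s)) t)"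

section \<open>The \<open>k\<close>-plane transform\<close>

text \<open>Lebesgue measure on a linear subspace, obtained from an orthonormal basis of it in the same
  way as \<open>lborel\<close> is from \<open>Basis\<close>; it does not depend on the choice of that basis.\<close>

definition orthonormal_basis_of :: "'a::euclidean_space set \<Rightarrow> 'a set \<Rightarrow> bool" where
  "orthonormal_basis_of W B \<longleftrightarrow>
     pairwise orthogonal B \<and> (\<forall>b\<in>B. norm b = 1) \<and> span B = W"

definition lborel_subspace :: "'a::euclidean_space set \<Rightarrow> 'a measure" where
  "lborel_subspace W = (let B = (SOME B. orthonormal_basis_of W B) in
     distr (\<Pi>\<^sub>M b\<in>B. lborel) borel (\<lambda>c. \<Sum>b\<in>B. c b *\<^sub>R b))"

definition kplane :: "(real^'d \<Rightarrow> complex) \<Rightarrow> (real^'d^'m) \<times> (real^'m) \<Rightarrow> complex" where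
  "kplane \<phi> = (\<lambda>(A, t). if A \<in> stiefel
     then \<integral>x. \<phi> (x + transpose A *v t) \<partial>lborel_subspace {x. A *v x = 0} else 0)"

definition kplane_dual ::
  "(real^'d^'m) measure \<Rightarrow> ((real^'d^'m) \<times> (real^'m) \<Rightarrow> complex) \<Rightarrow> real^'d \<Rightarrow> complex" where
  "kplane_dual \<sigma> g x = (\<integral>A. g (A, A *v x) \<partial>\<sigma>)"

definition filter_const :: "nat \<Rightarrow> nat \<Rightarrow> real" where
  "filter_const d k = 1 / (2 * pi) ^ k * (sphere_area (k - 1) / sphere_area (d - k - 1)) *
     (\<Prod>n=k..d-1. inverse (sphere_area (n - 1)))"

definition filter_K ::
  "nat \<Rightarrow> ((real^'d^'m) \<times> (real^'m) \<Rightarrow> complex) \<Rightarrow> (real^'d^'m) \<times> (real^'m) \<Rightarrow> complex" where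
  "filter_K k = on_t (multiplier (\<lambda>\<omega>. of_real (filter_const CARD('d) k * norm \<omega> ^ k)))"

text \<open>The space \<open>\<S>\<^sub>k\<close>, and the space \<open>K R (\<S>)\<close> with the topology transported
  from the Schwartz space by \<open>kplane_dual \<sigma>\<close>.\<close>

definition kplane_range :: "((real^'d^'m) \<times> (real^'m) \<Rightarrow> complex) topology" where
  "kplane_range = subtopology schwartz_Xi (kplane ` schwartz_space)"

definition filtered_range ::
  "nat \<Rightarrow> (real^'d^'m) measure \<Rightarrow> ((real^'d^'m) \<times> (real^'m) \<Rightarrow> complex) topology" where
  "filtered_range k \<sigma> =
     pullback_topology ((\<lambda>\<phi>. filter_K k (kplane \<phi>)) ` schwartz_space) (kplane_dual \<sigma>) schwartz"

definition kplane_distr ::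
  "nat \<Rightarrow> (real^'d^'m) measure \<Rightarrow> ((real^'d \<Rightarrow> complex) \<Rightarrow> complex) \<Rightarrow>
   ((real^'d^'m) \<times> (real^'m) \<Rightarrow> complex) \<Rightarrow> complex" where
  "kplane_distr k \<sigma> = dual_map (filtered_range k \<sigma>) (kplane_dual \<sigma>)"

definition kplane_dual_distr ::
  "(((real^'d^'m) \<times> (real^'m) \<Rightarrow> complex) \<Rightarrow> complex) \<Rightarrow> (real^'d \<Rightarrow> complex) \<Rightarrow> complex" where
  "kplane_dual_distr = dual_map schwartz kplane"

end

theory Submission
  imports Defs "HOL-Probability.Probability"
begin

text \<open>By the Fourier slice theorem the Fourier transform of \<open>kplane \<phi> (A, \<cdot>)\<close> is
  \<open>\<omega> \<mapsto> fourier \<phi> (A\<^sup>T \<omega>)\<close>, and \<open>\<parallel>A\<^sup>T \<omega>\<parallel> = \<parallel>\<omega>\<parallel>\<close>. Hence multipliers with the same radial profile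
  are intertwined by \<open>kplane\<close>, and also by \<open>filter_K k \<circ> kplane\<close>, provided that Fourier inversion
  applies; for odd \<open>k\<close> the factor \<open>\<parallel>\<omega>\<parallel>\<^sup>k\<close> is not smooth, and one uses that it is an average of
  Gaussians to see that its product with the Fourier transform of a Schwartz function has an
  integrable inverse transform.

  The profile \<open>L_rad\<close> need not be even, so that \<open>L_rad \<circ> norm\<close> need not be smooth. That the
  multiplier preserves the Schwartz space follows instead from the continuity of \<open>Ld\<close>: a weak-*
  continuous functional on the dual is the evaluation at a point, so \<open>Ld\<close> is a transpose.

  The back-projection \<open>kplane_dual \<sigma> \<circ> filter_K k \<circ> kplane\<close> integrates \<open>fourier \<phi>\<close> against a
  measure that is rotation invariant and homogeneous of degree \<open>d\<close>. By a Fubini argument such a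
  measure is a multiple of Lebesgue measure, so this operator is a multiple of the identity. Each
  identity between distributions is thereby reduced to the one for functions.\<close>

section \<open>Gaussians\<close>

text \<open>The obstacle is that two symbols may fail to be smooth at the origin:
  \<open>L_rad (norm \<omega>)\<close> and, for odd \<open>k\<close>,
  \<open>norm \<omega> ^ k\<close>. The argument therefore stays with absolutely integrable
  transforms; the class \<open>bci\<close> is tailored to pointwise Fourier inversion. Even powers
  of the norm come from the Laplacian, so only a single factor \<open>norm \<omega>\<close> has to
  be written as an average of Gaussians.

  Gaussians also fix constants. Being radial and a product over orthonormal coordinates, they
  normalise translation invariant measures, so that changes of variables are made without
  determinants.

  The unknown factor of the back-projection does no harm because every test function of the first
  identity has the form \<open>filter_K k (kplane \<phi>)\<close>, and the factor then stands on
  both sides.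

  The second identity takes place in the dual of the Schwartz space, which calls for continuity of
  \<open>kplane\<close> into the Frechet space on \<Xi>, hence for control of derivatives in
  \<open>A\<close>. By the slice theorem a rotation of \<open>A\<close> merely rotates the frequency
  \<open>\<omega> v* A\<close>, so these derivatives become angular derivatives of \<phi>.\<close>

lemma
  fixes f :: "'a::euclidean_space \<Rightarrow> real \<Rightarrow> 'b::{real_normed_field,banach,second_countable_topology}"
  assumes "\<And>b. b \<in> Basis \<Longrightarrow> integrable lborel (f b)"
  shows integrable_lborel_prod: "integrable lborel (\<lambda>x::'a. \<Prod>b\<in>Basis. f b (x \<bullet> b))"
    and integral_lborel_prod:
      "integral\<^sup>L lborel (\<lambda>x::'a. \<Prod>b\<in>Basis. f b (x \<bullet> b)) = (\<Prod>b\<in>Basis. (\<integral>s. f b s \<partial>lborel))"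
proof -
  interpret product_sigma_finite "\<lambda>b::'a. lborel :: real measure" ..
  have [measurable]: "b \<in> Basis \<Longrightarrow> f b \<in> borel_measurable borel" for b
    using assms[of b] by (auto dest: borel_measurable_integrable)
  have c: "(\<lambda>c. \<Sum>b\<in>Basis. c b *\<^sub>R b) \<in> (\<Pi>\<^sub>M b\<in>Basis. (lborel::real measure)) \<rightarrow>\<^sub>M (borel::'a measure)"
    by measurable
  have m: "(\<lambda>x::'a. \<Prod>b\<in>Basis. f b (x \<bullet> b)) \<in> borel_measurable borel"
    by measurable
  show "integrable lborel (\<lambda>x::'a. \<Prod>b\<in>Basis. f b (x \<bullet> b))"
    by (subst lborel_eq, subst integrable_distr_eq[OF c m])
       (use product_integrable_prod[OF finite_Basis, of f] assms in simp)
  show "integral\<^sup>L lborel (\<lambda>x::'a. \<Prod>b\<in>Basis. f b (x \<bullet> b)) = (\<Prod>b\<in>Basis. (\<integral>s. f b s \<partial>lborel))"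
    by (subst lborel_eq, subst integral_distr[OF c m])
       (use product_integral_prod[OF finite_Basis, of f] assms in simp)
qed

definition gauss :: "'a::euclidean_space \<Rightarrow> real" where
  "gauss x = exp (- (norm x)\<^sup>2 / 2)"

lemma norm_sq_Basis: "(norm x)\<^sup>2 = (\<Sum>b\<in>Basis. (x \<bullet> b)\<^sup>2)" for x :: "'a::euclidean_space"
  unfolding power2_norm_eq_inner by (subst euclidean_inner) (simp add: power2_eq_square)

lemma gauss_prod: "gauss x = (\<Prod>b\<in>Basis. exp (- (x \<bullet> b)\<^sup>2 / 2))"
  by (simp add: gauss_def norm_sq_Basis exp_sum[symmetric] sum_negf sum_divide_distrib)

lemma gauss_pos [simp]: "gauss x > 0" and gauss_nonneg [simp]: "gauss x \<ge> 0"
  by (simp_all add: gauss_def)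

lemma gauss_uminus [simp]: "gauss (- x) = gauss x"
  by (simp add: gauss_def)

lemma continuous_on_gauss [continuous_intros]:
  "continuous_on S f \<Longrightarrow> continuous_on S (\<lambda>x. gauss (f x))"
  unfolding gauss_def by (intro continuous_intros) auto

lemma borel_measurable_gauss [measurable]: "gauss \<in> borel_measurable borel"
  by (intro borel_measurable_continuous_onI continuous_intros)

lemma gauss_1: "has_bochner_integral lborel (\<lambda>x. exp (- x\<^sup>2 / 2)) (sqrt (2 * pi))"
  using has_bochner_integral_mult_right[OF std_normal_moment_even[of 0], of "sqrt (2*pi)"]
  by (simp add: std_normal_density_def)

lemma gauss_integrable [simp]: "integrable lborel (gauss :: 'a::euclidean_space \<Rightarrow> real)"
  unfolding gauss_prod
  by (rule integrable_lborel_prod) (use gauss_1 in \<open>simp add: has_bochner_integral_iff\<close>)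

lemma gauss_integral: "integral\<^sup>L lborel (gauss :: 'a::euclidean_space \<Rightarrow> real) = sqrt (2 * pi) ^ DIM('a)"
  unfolding gauss_prod
  by (subst integral_lborel_prod) (use gauss_1 in \<open>simp_all add: has_bochner_integral_iff\<close>)

text \<open>Up to the factor \<open>sqrt (2 * pi)\<close> this is the characteristic function of the
  standard normal law, taken at \<open>- t\<close> because the kernel carries a minus sign.\<close>

lemma exp_gauss_1:
  "has_bochner_integral lborel (\<lambda>x. complex_of_real (exp (- x\<^sup>2 / 2)) * exp (- (\<i> * of_real (t * x))))
     (of_real (sqrt (2 * pi) * exp (- t\<^sup>2 / 2)))"
proof -
  have "char std_normal_distribution (-t) = of_real (exp (- t\<^sup>2 / 2))"
    by (simp add: char_std_normal_distribution)
  then have e: "(\<integral>x. std_normal_density x *\<^sub>R exp (\<i> * of_real (- t * x)) \<partial>lborel) = of_real (exp (- t\<^sup>2 / 2))"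
    unfolding char_def by (subst (asm) integral_density) (auto simp: normal_density_nonneg)
  have i: "integrable lborel (\<lambda>x. std_normal_density x *\<^sub>R exp (\<i> * of_real (- t * x)))"
    by (rule Bochner_Integration.integrable_bound[of _ std_normal_density])
       (auto simp: integrable_normal_density)
  have "has_bochner_integral lborel (\<lambda>x. of_real (sqrt (2*pi)) * (std_normal_density x *\<^sub>R exp (\<i> * of_real (- t * x))))
     (of_real (sqrt (2 * pi)) * of_real (exp (- t\<^sup>2 / 2)))"
    by (rule has_bochner_integral_mult_right) (use i e in \<open>simp add: has_bochner_integral_iff\<close>)
  then show ?thesis
    by (simp add: std_normal_density_def scaleR_conv_of_real)
qed

text \<open>Gaussian and exponential both factor over \<open>Basis\<close>, which leaves the
  one-dimensional case. Width one makes the Gaussian its own transform up to a constant.\<close>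

lemma fourier_gauss:
  "fourier (\<lambda>x::'a::euclidean_space. of_real (gauss x)) \<xi> = of_real (sqrt (2 * pi) ^ DIM('a) * gauss \<xi>)"
proof -
  let ?f = "\<lambda>b x. complex_of_real (exp (- x\<^sup>2 / 2)) * exp (- (\<i> * of_real ((\<xi> \<bullet> b) * x)))"
  have "of_real (gauss x) * exp (- (\<i> * of_real (\<xi> \<bullet> x))) = (\<Prod>b\<in>Basis. ?f b (x \<bullet> b))" for x
    unfolding euclidean_inner[of \<xi> x]
    by (simp add: prod.distrib gauss_prod exp_sum[symmetric] sum_negf sum_distrib_left del: of_real_prod)
       (simp add: exp_sum sum_negf[symmetric])
  then have "fourier (\<lambda>x::'a::euclidean_space. of_real (gauss x)) \<xi> = (\<Prod>b\<in>Basis. (\<integral>s. ?f b s \<partial>lborel))"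
    unfolding fourier_def
    using integral_lborel_prod[where f="?f"] exp_gauss_1 unfolding has_bochner_integral_iff by presburger
  also have "\<dots> = (\<Prod>b\<in>Basis. of_real (sqrt (2 * pi) * exp (- (\<xi> \<bullet> b)\<^sup>2 / 2)))"
    using exp_gauss_1 by (simp add: has_bochner_integral_iff)
  finally show ?thesis
    by (simp add: gauss_prod prod.distrib)
qed

section \<open>Lebesgue measure\<close>

lemma nn_integral_lborel_translate:
  fixes f :: "'a::euclidean_space \<Rightarrow> ennreal"
  assumes [measurable]: "f \<in> borel_measurable borel"
  shows "(\<integral>\<^sup>+x. f (x + a) \<partial>lborel) = (\<integral>\<^sup>+x. f x \<partial>lborel)"
  by (subst (2) lborel_distr_plus[of a, symmetric]) (simp add: nn_integral_distr add.commute)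

lemma nn_integral_lborel_reflect:
  fixes f :: "'a::euclidean_space \<Rightarrow> ennreal"
  assumes [measurable]: "f \<in> borel_measurable borel"
  shows "(\<integral>\<^sup>+x. f (a - x) \<partial>lborel) = (\<integral>\<^sup>+x. f x \<partial>lborel)"
  by (subst (2) lborel_affine[of "-1" a]) (simp_all add: density_1 nn_integral_distr)

lemma nn_integral_lborel_scale:
  fixes f :: "'a::euclidean_space \<Rightarrow> ennreal"
  assumes [measurable]: "f \<in> borel_measurable borel" and "c > 0"
  shows "(\<integral>\<^sup>+x. f x \<partial>lborel) = ennreal (c ^ DIM('a)) * (\<integral>\<^sup>+x. f (c *\<^sub>R x) \<partial>lborel)"
  using \<open>c > 0\<close> by (subst lborel_affine[of c 0]) (simp_all add: nn_integral_density nn_integral_distr nn_integral_cmult)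

text \<open>Up to the normalization by a Gaussian, Lebesgue measure \<open>\<lambda>\<close> is the only translation invariant
  measure \<open>\<nu>\<close>, because \<open>\<lambda>(f) \<nu>(g) = \<nu>(f) \<lambda>(g)\<close> by Fubini.\<close>

lemma translation_invariant_eq_lborel:
  fixes T :: "'z \<Rightarrow> 'a::euclidean_space"
  assumes "sigma_finite_measure Z" and T [measurable]: "T \<in> Z \<rightarrow>\<^sub>M borel"
    and inv: "\<And>(H :: 'a \<Rightarrow> ennreal) x. H \<in> borel_measurable borel \<Longrightarrow>
       (\<integral>\<^sup>+z. H (T z + x) \<partial>Z) = (\<integral>\<^sup>+z. H (T z) \<partial>Z)"
    and g: "(\<integral>\<^sup>+z. ennreal (gauss (T z)) \<partial>Z) = integral\<^sup>N lborel (\<lambda>x::'a. ennreal (gauss x))"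
  shows "distr Z borel T = lborel"
proof (rule measure_eqI)
  interpret Z: sigma_finite_measure Z by fact
  interpret pair_sigma_finite lborel Z ..
  fix A assume "A \<in> sets (distr Z borel T)"
  then have A [measurable]: "A \<in> sets borel" by simp
  define f :: "'a \<Rightarrow> ennreal" where "f = indicator A"
  define h :: "'a \<Rightarrow> ennreal" where "h = (\<lambda>x. ennreal (gauss x))"
  have [measurable]: "f \<in> borel_measurable borel" "h \<in> borel_measurable borel"
    by (auto simp: f_def h_def)
  have "(\<integral>\<^sup>+x. f x \<partial>lborel) * (\<integral>\<^sup>+z. h (T z) \<partial>Z) = (\<integral>\<^sup>+z. (\<integral>\<^sup>+x. f x \<partial>lborel) * h (T z) \<partial>Z)"
    by (simp add: nn_integral_cmult)
  also have "\<dots> = (\<integral>\<^sup>+z. (\<integral>\<^sup>+x. f (x + T z) * h (T z) \<partial>lborel) \<partial>Z)"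
    by (simp add: nn_integral_multc nn_integral_lborel_translate)
  also have "\<dots> = (\<integral>\<^sup>+x. (\<integral>\<^sup>+z. f (x + T z) * h (T z) \<partial>Z) \<partial>lborel)"
    by (rule Fubini') measurable
  \<comment> \<open>Invariance under translation by \<open>x\<close>, applied for fixed
    \<open>x\<close> to the product, moves the shift from \<open>f\<close> to \<open>h\<close>; the
    two measures have then exchanged their roles.\<close>
  also have "\<dots> = (\<integral>\<^sup>+x. (\<integral>\<^sup>+z. f (T z) * h (T z - x) \<partial>Z) \<partial>lborel)"
  proof (rule nn_integral_cong)
    fix x
    show "(\<integral>\<^sup>+z. f (x + T z) * h (T z) \<partial>Z) = (\<integral>\<^sup>+z. f (T z) * h (T z - x) \<partial>Z)"
      using inv[of "\<lambda>y. f y * h (y - x)" x] by (simp add: add.commute)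
  qed
  also have "\<dots> = (\<integral>\<^sup>+z. (\<integral>\<^sup>+x. f (T z) * h (T z - x) \<partial>lborel) \<partial>Z)"
    by (rule Fubini'[symmetric]) measurable
  also have "\<dots> = (\<integral>\<^sup>+z. f (T z) \<partial>Z) * (\<integral>\<^sup>+x. h x \<partial>lborel)"
    by (simp add: nn_integral_cmult nn_integral_multc nn_integral_lborel_reflect)
  finally have eq: "(\<integral>\<^sup>+x. f x \<partial>lborel) * (\<integral>\<^sup>+x. h x \<partial>lborel) = (\<integral>\<^sup>+z. f (T z) \<partial>Z) * (\<integral>\<^sup>+x. h x \<partial>lborel)"
    using g by (simp add: h_def)
  have h: "(\<integral>\<^sup>+x. h x \<partial>lborel) = ennreal (sqrt (2 * pi) ^ DIM('a))"
    unfolding h_def by (subst nn_integral_eq_integral) (simp_all add: gauss_integral)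
  \<comment> \<open>Cancellation in \<open>ennreal\<close> asks for a factor that is neither 0 nor
    infinite; the Gaussian mass is a positive real.\<close>
  have pos: "\<not> sqrt (2 * pi) ^ DIM('a) \<le> 0"
    by (simp add: not_le)
  have "(\<integral>\<^sup>+x. f x \<partial>lborel) = (\<integral>\<^sup>+z. f (T z) \<partial>Z)"
    using eq pos unfolding h mult_right_ennreal_cancel by blast
  then show "emeasure (distr Z borel T) A = emeasure lborel A"
    unfolding f_def
    by (simp add: nn_integral_distr[symmetric, of T Z borel "indicator A"])
qed simp

lemma orthogonal_transformation_measurable:
  fixes U :: "'a::euclidean_space \<Rightarrow> 'a"
  assumes "orthogonal_transformation U"
  shows "U \<in> borel_measurable borel"
  using assms unfolding orthogonal_transformation_def
  by (simp add: borel_measurable_continuous_onI linear_continuous_on linear_conv_bounded_linear[symmetric])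

text \<open>No determinant is computed: a translation by \<open>U a\<close> after \<open>U\<close>
  is a translation by \<open>a\<close> before it, and the radial Gaussian fixes the constant to
  1.\<close>

lemma lborel_distr_orthogonal:
  fixes U :: "'a::euclidean_space \<Rightarrow> 'a"
  assumes U: "orthogonal_transformation U"
  shows "distr lborel borel U = lborel"
proof (rule translation_invariant_eq_lborel)
  have lin: "linear U" using U by (simp add: orthogonal_transformation_def)
  show [measurable]: "U \<in> lborel \<rightarrow>\<^sub>M borel"
    using orthogonal_transformation_measurable[OF U] by simp
  show "sigma_finite_measure (lborel :: 'a measure)" ..
  show "(\<integral>\<^sup>+z. ennreal (gauss (U z)) \<partial>lborel) = integral\<^sup>N lborel (\<lambda>x::'a. ennreal (gauss x))"
    using U by (simp add: gauss_def orthogonal_transformation_norm)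
  fix H :: "'a \<Rightarrow> ennreal" and x assume [measurable]: "H \<in> borel_measurable borel"
  obtain a where "x = U a"
    using orthogonal_transformation_surj[OF U] by (metis surjD)
  then have "H (U z + x) = H (U (z + a))" for z
    by (simp add: linear_add[OF lin])
  then show "(\<integral>\<^sup>+z. H (U z + x) \<partial>lborel) = (\<integral>\<^sup>+z. H (U z) \<partial>lborel)"
    using nn_integral_lborel_translate[of "\<lambda>z. H (U z)" a] by simp
qed

section \<open>Integrals depending on a parameter\<close>

lemma continuous_on_integral_param:
  fixes F :: "'a::metric_space \<Rightarrow> 'z \<Rightarrow> complex"
  assumes F [measurable]: "\<And>a. a \<in> S \<Longrightarrow> F a \<in> borel_measurable M"
    and cont: "\<And>z. z \<in> space M \<Longrightarrow> continuous_on S (\<lambda>a. F a z)"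
    and bound: "\<And>a z. a \<in> S \<Longrightarrow> z \<in> space M \<Longrightarrow> norm (F a z) \<le> w z"
    and w: "integrable M w"
  shows "continuous_on S (\<lambda>a. \<integral>z. F a z \<partial>M)"
  unfolding continuous_on_sequentially comp_def
proof (intro allI ballI impI)
  fix X :: "nat \<Rightarrow> 'a" and a assume a: "a \<in> S" and X: "(\<forall>n. X n \<in> S) \<and> X \<longlonglongrightarrow> a"
  show "(\<lambda>n. \<integral>z. F (X n) z \<partial>M) \<longlonglongrightarrow> (\<integral>z. F a z \<partial>M)"
  proof (rule integral_dominated_convergence)
    show "AE z in M. (\<lambda>n. F (X n) z) \<longlonglongrightarrow> F a z"
      using cont a X unfolding continuous_on_sequentially comp_def by (intro AE_I2) blast
  qed (use a X F bound w in auto)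
qed

lemma has_vector_derivative_iff_quotient:
  fixes f :: "real \<Rightarrow> 'a::real_normed_vector"
  shows "(f has_vector_derivative f') (at x) \<longleftrightarrow> ((\<lambda>y. (f y - f x) /\<^sub>R (y - x)) \<longlongrightarrow> f') (at x)"
proof -
  have "(f has_vector_derivative f') (at x) \<longleftrightarrow>
      ((\<lambda>y. norm ((f y - f x - (y - x) *\<^sub>R f') /\<^sub>R norm (y - x))) \<longlongrightarrow> 0) (at x)"
    unfolding has_vector_derivative_def has_derivative_within tendsto_norm_zero_iff
    by (simp add: bounded_linear_scaleR_left diff_diff_eq inverse_eq_divide)
  also have "\<dots> \<longleftrightarrow> ((\<lambda>y. norm ((f y - f x) /\<^sub>R (y - x) - f')) \<longlongrightarrow> 0) (at x)"
  proof (rule filterlim_cong[OF refl refl])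
    show "\<forall>\<^sub>F y in at x. norm ((f y - f x - (y - x) *\<^sub>R f') /\<^sub>R norm (y - x)) =
        norm ((f y - f x) /\<^sub>R (y - x) - f')"
      unfolding eventually_at_filter
    proof (intro always_eventually allI impI)
      fix y assume "y \<noteq> x"
      then have "(f y - f x) /\<^sub>R (y - x) - f' = (f y - f x - (y - x) *\<^sub>R f') /\<^sub>R (y - x)"
        by (simp add: scaleR_right_diff_distrib)
      then show "norm ((f y - f x - (y - x) *\<^sub>R f') /\<^sub>R norm (y - x)) = norm ((f y - f x) /\<^sub>R (y - x) - f')"
        by simp
    qed
  qed
  finally show ?thesis
    unfolding tendsto_norm_zero_iff LIM_zero_iff .
qed

text \<open>The derivative in \<open>s\<close> is taken at 0 only. An increment estimate near 0
  dominates the difference quotients, so dominated convergence applies; rotations reach other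
  parameters later through their group law.\<close>

lemma has_vector_derivative_integral_param:
  fixes F :: "real \<Rightarrow> 'z \<Rightarrow> complex"
  assumes F: "\<And>s. integrable M (F s)" and F' [measurable]: "F' \<in> borel_measurable M"
    and der: "\<And>z. z \<in> space M \<Longrightarrow> ((\<lambda>s. F s z) has_vector_derivative F' z) (at 0)"
    and bound: "\<And>s z. \<bar>s\<bar> \<le> 1 \<Longrightarrow> z \<in> space M \<Longrightarrow> norm (F s z - F 0 z) \<le> \<bar>s\<bar> * w z"
    and w: "integrable M w"
  shows "((\<lambda>s. \<integral>z. F s z \<partial>M) has_vector_derivative (\<integral>z. F' z \<partial>M)) (at 0)"
  unfolding has_vector_derivative_iff_quotient tendsto_at_iff_sequentially comp_def
proof (intro allI impI)
  fix X0 :: "nat \<Rightarrow> real" assume X0: "\<forall>i. X0 i \<in> UNIV - {0}" and lim0: "X0 \<longlonglongrightarrow> 0"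
  \<comment> \<open>The increment estimate holds for parameters of absolute value at most 1, so
    finitely many terms of the sequence are dropped.\<close>
  obtain k where k: "\<And>n. n \<ge> k \<Longrightarrow> \<bar>X0 n\<bar> \<le> 1"
    using LIMSEQ_D[OF lim0, of 1] by force
  define X where "X n = X0 (n + k)" for n
  have X: "\<forall>i. X i \<in> UNIV - {0}" and lim: "X \<longlonglongrightarrow> 0" and X1: "\<bar>X n\<bar> \<le> 1" for n
    using X0 k lim0 by (auto simp: X_def[abs_def] LIMSEQ_ignore_initial_segment)
  have [measurable]: "F s \<in> borel_measurable M" for s
    using F by auto
  have "(\<lambda>n. \<integral>z. (F (X n) z - F 0 z) /\<^sub>R (X n - 0) \<partial>M) \<longlonglongrightarrow> (\<integral>z. F' z \<partial>M)"
  proof (rule integral_dominated_convergence[where w=w])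
    show "AE z in M. (\<lambda>n. (F (X n) z - F 0 z) /\<^sub>R (X n - 0)) \<longlonglongrightarrow> F' z"
      using der X lim unfolding has_vector_derivative_iff_quotient tendsto_at_iff_sequentially comp_def
      by (intro AE_I2) blast
    show "AE z in M. norm ((F (X n) z - F 0 z) /\<^sub>R (X n - 0)) \<le> w z" for n
    proof (rule AE_I2)
      fix z assume "z \<in> space M"
      from bound[OF X1 this, of n] show "norm ((F (X n) z - F 0 z) /\<^sub>R (X n - 0)) \<le> w z"
        using X by (simp add: divide_simps mult.commute)
    qed
  qed (use w in auto)
  then have "(\<lambda>n. ((\<integral>z. F (X n) z \<partial>M) - (\<integral>z. F 0 z \<partial>M)) /\<^sub>R (X n - 0)) \<longlonglongrightarrow> (\<integral>z. F' z \<partial>M)"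
    using F by simp
  then show "(\<lambda>n. ((\<integral>z. F (X0 n) z \<partial>M) - (\<integral>z. F 0 z \<partial>M)) /\<^sub>R (X0 n - 0)) \<longlonglongrightarrow> (\<integral>z. F' z \<partial>M)"
    unfolding X_def by (rule LIMSEQ_offset)
qed

section \<open>The Fourier transform on \<open>L\<^sup>1\<close>\<close>

lemma norm_fourier_kernel [simp]:
  "norm (f x * exp (- (\<i> * complex_of_real r))) = norm (f x)"
  "norm (f x * exp (\<i> * complex_of_real r)) = norm (f x)"
  by (simp_all add: norm_mult)

lemma integrable_fourier_kernel:
  fixes f :: "'a::euclidean_space \<Rightarrow> complex"
  assumes "integrable lborel f"
  shows "integrable lborel (\<lambda>x. f x * exp (- (\<i> * of_real (\<xi> \<bullet> x))))"
    "integrable lborel (\<lambda>x. f x * exp (\<i> * of_real (\<xi> \<bullet> x)))"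
    "integrable lborel (\<lambda>x. f x * exp (\<i> * of_real (x \<bullet> \<xi>)))"
  by (rule Bochner_Integration.integrable_bound[OF assms];
      use borel_measurable_integrable[OF assms] in \<open>simp; measurable\<close>)+

lemma norm_fourier_le: "norm (fourier f \<xi>) \<le> (\<integral>x. norm (f x) \<partial>lborel)"
  unfolding fourier_def
  using integral_norm_bound[of lborel "\<lambda>x. f x * exp (- (\<i> * of_real (\<xi> \<bullet> x)))"] by simp

lemma continuous_on_fourier:
  fixes f :: "'a::euclidean_space \<Rightarrow> complex"
  assumes "integrable lborel f"
  shows "continuous_on S (fourier f)"
  unfolding fourier_def[abs_def]
  by (rule continuous_on_integral_param[where w="\<lambda>x. norm (f x)"])
     (use integrable_fourier_kernel[OF assms] borel_measurable_integrable assms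
       in \<open>auto intro!: continuous_intros\<close>)

lemma fourier_inv_eq:
  "fourier_inv g x = fourier g (- x) / of_real ((2 * pi) ^ DIM('a))" for g :: "'a::euclidean_space \<Rightarrow> complex"
  by (simp add: fourier_inv_def fourier_def inner_commute)

lemma fourier_add:
  "integrable lborel f \<Longrightarrow> integrable lborel g \<Longrightarrow>
    fourier (\<lambda>x. f x + g x) \<xi> = fourier f \<xi> + fourier g \<xi>"
  unfolding fourier_def
  using integrable_fourier_kernel(1)[of f \<xi>] integrable_fourier_kernel(1)[of g \<xi>]
  by (simp add: distrib_right)

lemma fourier_cmult: "fourier (\<lambda>x. c * f x) \<xi> = c * fourier f \<xi>"
  unfolding fourier_def by (simp add: mult.assoc)

lemma fourier_zero [simp]: "fourier (\<lambda>x. 0) \<xi> = 0"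
  by (simp add: fourier_def)

lemma lborel_integral_affine:
  fixes f :: "'a::euclidean_space \<Rightarrow> complex"
  assumes [measurable]: "f \<in> borel_measurable borel" and "c \<noteq> 0"
  shows "(\<integral>x. f x \<partial>lborel) = of_real (\<bar>c\<bar> ^ DIM('a)) * (\<integral>x. f (t + c *\<^sub>R x) \<partial>lborel)"
  using \<open>c \<noteq> 0\<close>
  by (subst lborel_affine[of c t]) (simp_all add: integral_density integral_distr scaleR_conv_of_real)

lemma integrable_lborel_affine:
  fixes f :: "'a::euclidean_space \<Rightarrow> complex"
  assumes f: "integrable lborel f" and c: "c \<noteq> 0"
  shows "integrable lborel (\<lambda>x. f (t + c *\<^sub>R x))"
proof -
  have [measurable]: "f \<in> borel_measurable borel"
    using f by (simp add: borel_measurable_integrable)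
  have "integrable (density (distr lborel borel (\<lambda>x. t + c *\<^sub>R x)) (\<lambda>_. ennreal (\<bar>c\<bar> ^ DIM('a)))) f"
    using f c by (subst lborel_affine[of c t, symmetric]) simp_all
  then have "integrable lborel (\<lambda>x. (\<bar>c\<bar> ^ DIM('a)) *\<^sub>R f (t + c *\<^sub>R x))"
    by (simp add: integrable_density integrable_distr_eq)
  from integrable_scaleR_right[OF this, of "inverse (\<bar>c\<bar> ^ DIM('a))"] show ?thesis
    using c by simp
qed

lemma fourier_affine:
  fixes f :: "'a::euclidean_space \<Rightarrow> complex"
  assumes [measurable]: "f \<in> borel_measurable borel" and "c > 0"
  shows "fourier (\<lambda>x. f (c *\<^sub>R x)) \<xi> = fourier f (\<xi> /\<^sub>R c) / of_real (c ^ DIM('a))"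
proof -
  have "(\<xi> /\<^sub>R c) \<bullet> (c *\<^sub>R x) = \<xi> \<bullet> x" for x
    using \<open>c > 0\<close> by simp
  then show ?thesis
    unfolding fourier_def using \<open>c > 0\<close>
    by (subst (2) lborel_integral_affine[where c=c and t=0])
       (simp_all del: inner_scaleR_left inner_scaleR_right)
qed

lemma fourier_translate:
  fixes f :: "'a::euclidean_space \<Rightarrow> complex"
  assumes [measurable]: "f \<in> borel_measurable borel"
  shows "fourier (\<lambda>x. f (x + a)) \<xi> = fourier f \<xi> * exp (\<i> * of_real (\<xi> \<bullet> a))"
proof -
  have "fourier f \<xi> = (\<integral>x. f (a + x) * exp (- (\<i> * of_real (\<xi> \<bullet> (a + x)))) \<partial>lborel)"
    unfolding fourier_def by (subst lborel_integral_affine[where c=1 and t=a]) simp_all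
  also have "\<dots> = exp (- (\<i> * of_real (\<xi> \<bullet> a))) * fourier (\<lambda>x. f (x + a)) \<xi>"
    unfolding fourier_def
    by (subst integral_mult_right_zero[symmetric])
       (simp add: inner_add_right distrib_left exp_add[symmetric] mult_ac add.commute)
  finally show ?thesis
    by (simp add: exp_minus field_simps)
qed

lemma fourier_orthogonal:
  fixes f :: "'a::euclidean_space \<Rightarrow> complex" and U :: "'a \<Rightarrow> 'a"
  assumes [measurable]: "f \<in> borel_measurable borel" and U: "orthogonal_transformation U"
  shows "fourier (\<lambda>x. f (U x)) \<xi> = fourier f (U \<xi>)"
proof -
  note [measurable] = orthogonal_transformation_measurable[OF U]
  have "fourier f (U \<xi>) = (\<integral>x. f (U x) * exp (- (\<i> * of_real (U \<xi> \<bullet> U x))) \<partial>lborel)"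
    unfolding fourier_def by (subst lborel_distr_orthogonal[OF U, symmetric]) (simp add: integral_distr)
  then show ?thesis
    using U by (simp add: fourier_def orthogonal_transformation_def)
qed

text \<open>Bounded, continuous and integrable: Fourier inversion applies pointwise.\<close>

definition bci :: "('a::euclidean_space \<Rightarrow> complex) \<Rightarrow> bool" where
  "bci u \<longleftrightarrow> integrable lborel u \<and> continuous_on UNIV u \<and> bounded (range u)"

lemma bciD:
  assumes "bci u"
  shows "integrable lborel u" "continuous_on UNIV u" "bounded (range u)" "u \<in> borel_measurable borel"
  using assms borel_measurable_continuous_onI by (auto simp: bci_def)

text \<open>Averages of \<open>u\<close> over Gaussians of width \<open>inverse (Suc n)\<close>
  about \<open>x\<close>. The Gaussian is left unnormalised, so its mass appears in the limit. The
  same limit yields Fourier inversion and the separation of functions by Schwartz functions.\<close>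

lemma approx_identity:
  fixes u :: "'a::euclidean_space \<Rightarrow> complex"
  assumes "continuous_on UNIV u" "bounded (range u)"
  shows "(\<lambda>n. \<integral>y. of_real (gauss y) * u (x + inverse (real (Suc n)) *\<^sub>R y) \<partial>lborel)
           \<longlonglongrightarrow> of_real (sqrt (2 * pi) ^ DIM('a)) * u x"
proof -
  obtain B where B: "\<And>x. norm (u x) \<le> B"
    using assms(2) by (auto simp: bounded_iff)
  have [measurable]: "u \<in> borel_measurable borel"
    using assms(1) by (rule borel_measurable_continuous_onI)
  have "(\<lambda>n. \<integral>y. of_real (gauss y) * u (x + inverse (real (Suc n)) *\<^sub>R y) \<partial>lborel)
           \<longlonglongrightarrow> (\<integral>y. of_real (gauss (y::'a)) * u x \<partial>lborel)"
  proof (rule integral_dominated_convergence[where w="\<lambda>y. gauss y * B"])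
    have "(\<lambda>n. u (x + inverse (real (Suc n)) *\<^sub>R y)) \<longlonglongrightarrow> u x" for y
    proof -
      have "(\<lambda>n. x + inverse (real (Suc n)) *\<^sub>R y) \<longlonglongrightarrow> x + 0 *\<^sub>R y"
        by (intro tendsto_intros LIMSEQ_inverse_real_of_nat)
      then show ?thesis
        using assms(1) continuous_on_tendsto_compose[of UNIV u _ x] by (simp add: comp_def)
    qed
    then show "AE y in lborel. (\<lambda>n. of_real (gauss y) * u (x + inverse (real (Suc n)) *\<^sub>R y)) \<longlonglongrightarrow> of_real (gauss y) * u x"
      by (intro AE_I2 tendsto_intros)
  qed (auto simp: norm_mult B mult_left_mono)
  also have "(\<integral>y. of_real (gauss (y::'a)) * u x \<partial>lborel) = of_real (sqrt (2 * pi) ^ DIM('a)) * u x"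
    using gauss_integral[where ?'a='a] by (simp flip: of_real_power)
  finally show ?thesis .
qed

text \<open>The transform is damped by \<open>gauss (e *\<^sub>R \<xi>)\<close>. Fubini moves the
  transform onto the Gaussian, where it is explicit, and leaves an average of \<open>u\<close> at
  scale \<open>e\<close>. As \<open>e\<close> tends to 0, one side tends to the inversion integral
  by dominated convergence, the other to the value at \<open>x\<close>.\<close>

lemma fourier_inversion:
  fixes u :: "'a::euclidean_space \<Rightarrow> complex"
  assumes u: "bci u" and i: "integrable lborel (fourier u)"
  shows "fourier_inv (fourier u) = u"
proof
  fix x
  note [measurable] = bciD(4)[OF u] borel_measurable_integrable[OF i, simplified]
  let ?c = "complex_of_real (sqrt (2 * pi) ^ DIM('a))"
  let ?e = "\<lambda>n. inverse (real (Suc n))"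
  have "(\<integral>\<xi>. fourier u \<xi> * exp (\<i> * of_real (\<xi> \<bullet> x)) * of_real (gauss (e *\<^sub>R \<xi>)) \<partial>lborel)
      = ?c * (\<integral>y. of_real (gauss y) * u (x + e *\<^sub>R y) \<partial>lborel)" if e: "e > 0" for e :: real
  proof -
    let ?a = "\<lambda>\<xi>. of_real (gauss (e *\<^sub>R \<xi>)) * exp (- (\<i> * of_real (\<xi> \<bullet> x))) :: complex"
    let ?g = "\<lambda>\<xi>::'a. complex_of_real (gauss (e *\<^sub>R \<xi>))"
    have g: "integrable lborel ?g"
      using integrable_lborel_affine[of "\<lambda>x. complex_of_real (gauss x)" e 0] e by simp
    then have a: "integrable lborel ?a"
      by (rule integrable_fourier_kernel(1)[where \<xi>=x, unfolded inner_commute[of x]])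
    have inner: "(\<integral>\<xi>. ?a \<xi> * exp (\<i> * of_real (\<xi> \<bullet> y)) \<partial>lborel)
        = ?c * of_real (gauss ((x - y) /\<^sub>R e)) / of_real (e ^ DIM('a))" for y
    proof -
      have "(\<integral>\<xi>. ?a \<xi> * exp (\<i> * of_real (\<xi> \<bullet> y)) \<partial>lborel) = fourier ?g (x - y)"
        unfolding fourier_def
        by (rule Bochner_Integration.integral_cong)
           (auto simp: mult.assoc exp_add[symmetric] inner_diff_left inner_commute algebra_simps)
      also have "\<dots> = ?c * of_real (gauss ((x - y) /\<^sub>R e)) / of_real (e ^ DIM('a))"
        using fourier_affine[of "\<lambda>x. complex_of_real (gauss x)" e "x - y"] e
        by (simp add: fourier_gauss)
      finally show ?thesis .
    qed
    have "(\<integral>\<xi>. fourier u \<xi> * exp (\<i> * of_real (\<xi> \<bullet> x)) * ?g \<xi> \<partial>lborel)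
        = (\<integral>\<xi>. ?a \<xi> * fourier u (- \<xi>) \<partial>lborel)"
      using lborel_integral_uminus[of "\<lambda>\<xi>. ?a \<xi> * fourier u (- \<xi>)"] by (simp add: mult_ac)
    also have "\<dots> = (\<integral>y. (\<integral>\<xi>. ?a \<xi> * exp (\<i> * of_real (\<xi> \<bullet> y)) \<partial>lborel) * u y \<partial>lborel)"
      by (rule exp_pairing_swap[OF a bciD(1)[OF u], symmetric])
    also have "\<dots> = (\<integral>y. ?c * of_real (gauss ((x - y) /\<^sub>R e)) / of_real (e ^ DIM('a)) * u y \<partial>lborel)"
      unfolding inner ..
    also have "\<dots> = of_real (e ^ DIM('a)) * (\<integral>y. inverse (of_real (e ^ DIM('a))) *
        (?c * (of_real (gauss y) * u (x + e *\<^sub>R y))) \<partial>lborel)"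
      by (subst lborel_integral_affine[where c=e and t=x])
         (use e in \<open>simp_all del: integral_mult_right_zero add: divide_inverse mult_ac\<close>)
    finally show ?thesis
      using e by simp
  qed
  from this[of "?e n" for n] have
    "(\<lambda>n. \<integral>\<xi>. fourier u \<xi> * exp (\<i> * of_real (\<xi> \<bullet> x)) * of_real (gauss (?e n *\<^sub>R \<xi>)) \<partial>lborel)
       \<longlonglongrightarrow> ?c * (?c * u x)"
    using approx_identity[OF bciD(2,3)[OF u], of x] by (simp add: tendsto_mult_left)
  moreover have
    "(\<lambda>n. \<integral>\<xi>. fourier u \<xi> * exp (\<i> * of_real (\<xi> \<bullet> x)) * of_real (gauss (?e n *\<^sub>R \<xi>)) \<partial>lborel)
       \<longlonglongrightarrow> (\<integral>\<xi>. fourier u \<xi> * exp (\<i> * of_real (\<xi> \<bullet> x)) \<partial>lborel)"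
  proof (rule integral_dominated_convergence[where w="\<lambda>\<xi>. norm (fourier u \<xi>)"])
    have "(\<lambda>n. gauss (?e n *\<^sub>R \<xi>)) \<longlonglongrightarrow> exp (- (norm (0 *\<^sub>R \<xi>))\<^sup>2 / 2)" for \<xi> :: 'a
      unfolding gauss_def by (intro tendsto_intros LIMSEQ_inverse_real_of_nat) auto
    then have "(\<lambda>n. gauss (?e n *\<^sub>R \<xi>)) \<longlonglongrightarrow> 1" for \<xi> :: 'a
      by simp
    from tendsto_mult_left[OF tendsto_of_real[OF this]]
    show "AE \<xi> in lborel. (\<lambda>n. fourier u \<xi> * exp (\<i> * of_real (\<xi> \<bullet> x)) * of_real (gauss (?e n *\<^sub>R \<xi>)))
        \<longlonglongrightarrow> fourier u \<xi> * exp (\<i> * of_real (\<xi> \<bullet> x))"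
      by (intro AE_I2) fastforce
    have "gauss y \<le> 1" for y :: 'a
      by (simp add: gauss_def)
    then show "AE \<xi> in lborel. norm (fourier u \<xi> * exp (\<i> * of_real (\<xi> \<bullet> x)) * of_real (gauss (?e n *\<^sub>R \<xi>)))
        \<le> norm (fourier u \<xi>)" for n
      by (intro AE_I2) (simp add: norm_mult mult_left_le)
  qed (use i integrable_norm[OF i] in simp_all)
  ultimately have "(\<integral>\<xi>. fourier u \<xi> * exp (\<i> * of_real (\<xi> \<bullet> x)) \<partial>lborel) = ?c * (?c * u x)"
    using LIMSEQ_unique by blast
  \<comment> \<open>One factor \<open>sqrt (2 * pi) ^ DIM('a)\<close> stems from the transform of
    the Gaussian, the other from its mass; together they are the normalisation in
    \<open>fourier_inv\<close>.\<close>
  also have "?c * (?c * u x) = of_real ((2 * pi) ^ DIM('a)) * u x"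
    unfolding mult.assoc[symmetric] of_real_mult[symmetric] power_mult_distrib[symmetric] by simp
  finally show "fourier_inv (fourier u) x = u x"
    by (simp add: fourier_inv_def)
qed

text \<open>\<open>fourier g\<close> is a reflected multiple of \<open>fourier_inv g\<close>, so
  integrability of the latter admits inversion for \<open>g\<close>; reflecting the integration
  variable then exchanges the two transforms.\<close>

lemma fourier_fourier_inv:
  fixes g :: "'a::euclidean_space \<Rightarrow> complex"
  assumes g: "bci g" and i: "integrable lborel (fourier_inv g)"
  shows "fourier (fourier_inv g) = g"
proof
  fix \<xi>
  let ?c = "complex_of_real ((2 * pi) ^ DIM('a))"
  have "fourier g x = ?c * fourier_inv g (- x)" for x
    by (simp add: fourier_inv_eq)
  moreover have "integrable lborel (\<lambda>x. ?c * fourier_inv g (- x))"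
    using integrable_lborel_affine[OF i, of "-1" 0] by simp
  ultimately have "integrable lborel (fourier g)"
    by presburger
  then have "g \<xi> = fourier_inv (fourier g) \<xi>"
    by (simp add: fourier_inversion[OF g])
  also have "\<dots> = (\<integral>x. fourier g (- x) * exp (\<i> * of_real (- x \<bullet> \<xi>)) \<partial>lborel) / ?c"
    unfolding fourier_inv_def
    by (subst lborel_integral_uminus[symmetric, of "\<lambda>x. fourier g x * _ x"]) simp
  also have "\<dots> = fourier (fourier_inv g) \<xi>"
    unfolding fourier_inv_eq[of g, abs_def] using fourier_cmult[of "1 / ?c" "\<lambda>x. fourier g (- x)" \<xi>]
    by (simp add: fourier_def[of "\<lambda>x. fourier g (- x)"] inner_commute)
  finally show "fourier (fourier_inv g) \<xi> = g \<xi>" ..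
qed

section \<open>Fourier transforms of integrable functions, multiplied by powers of the norm\<close>

text \<open>This is convolution with the image of \<open>M\<close> under \<open>\<tau>\<close>, so
  the transform gets multiplied by that of the image. Keeping \<open>M\<close> and
  \<open>\<tau>\<close> apart avoids forming the image measure.\<close>

lemma bci_average_translates:
  fixes u :: "'a::euclidean_space \<Rightarrow> complex" and \<tau> :: "'z \<Rightarrow> 'a"
  assumes "finite_measure M" and [measurable]: "\<tau> \<in> M \<rightarrow>\<^sub>M borel" and u: "bci u"
  shows "bci (\<lambda>t. \<integral>z. u (t - \<tau> z) \<partial>M)"
    and "fourier (\<lambda>t. \<integral>z. u (t - \<tau> z) \<partial>M) \<omega> =
         fourier u \<omega> * (\<integral>z. exp (- (\<i> * of_real (\<omega> \<bullet> \<tau> z))) \<partial>M)"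
proof -
  interpret M: finite_measure M by fact
  interpret pair_sigma_finite lborel M ..
  note [measurable] = bciD(4)[OF u]
  obtain B where B: "\<And>x. norm (u x) \<le> B"
    using bciD(3)[OF u] by (auto simp: bounded_iff)
  let ?v = "\<lambda>t. \<integral>z. u (t - \<tau> z) \<partial>M"
  have transl: "integrable lborel (\<lambda>t. u (t - a))" for a
    using integrable_lborel_affine[OF bciD(1)[OF u], of 1 "- a"] by simp
  have "integrable (M \<Otimes>\<^sub>M lborel) (\<lambda>(z, t). u (t - \<tau> z))"
  proof (rule pair_sigma_finite.Fubini_integrable)
    show "pair_sigma_finite M (lborel :: 'a measure)" ..
    have "complex_of_real (\<integral>t. norm (u (t - \<tau> z)) \<partial>lborel) = of_real (\<integral>t. norm (u t) \<partial>lborel)" for z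
      using lborel_integral_affine[of "\<lambda>t. complex_of_real (norm (u t))" 1 "- \<tau> z"] by simp
    then have "(\<integral>t. norm (u (t - \<tau> z)) \<partial>lborel) = (\<integral>t. norm (u t) \<partial>lborel)" for z
      by (simp only: of_real_eq_iff)
    then show "integrable M (\<lambda>z. \<integral>t. norm (case (z, t) of (z, t) \<Rightarrow> u (t - \<tau> z)) \<partial>lborel)"
      by simp
  qed (use transl in simp_all)
  then have i: "integrable (lborel \<Otimes>\<^sub>M M) (\<lambda>(t, z). u (t - \<tau> z))"
    using integrable_product_swap_iff[of "\<lambda>(t, z). u (t - \<tau> z)"] by simp
  have "integrable lborel ?v"
    using integrable_fst'[OF i] by simp
  moreover have "continuous_on UNIV ?v"
    by (rule continuous_on_integral_param[where w="\<lambda>_. B"])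
       (use B in \<open>auto intro!: continuous_intros continuous_on_compose2[OF bciD(2)[OF u]]\<close>)
  moreover have "bounded (range ?v)"
    unfolding bounded_iff
  proof (intro exI ballI)
    fix y assume "y \<in> range ?v"
    then obtain t where "y = ?v t" by auto
    have "integrable M (\<lambda>z. u (t - \<tau> z))"
      by (rule M.integrable_const_bound[where B=B]) (use B in auto)
    then have "(\<integral>z. norm (u (t - \<tau> z)) \<partial>M) \<le> (\<integral>z. B \<partial>M)"
      by (intro integral_mono) (use B in auto)
    with integral_norm_bound[of M "\<lambda>z. u (t - \<tau> z)"] \<open>y = ?v t\<close>
    show "norm y \<le> (\<integral>z. B \<partial>M)"
      by (simp only:)
  qed
  ultimately show "bci ?v" by (simp add: bci_def)
  have j: "integrable (lborel \<Otimes>\<^sub>M M) (\<lambda>(t, z). u (t - \<tau> z) * exp (- (\<i> * of_real (\<omega> \<bullet> t))))"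
    by (rule Bochner_Integration.integrable_bound[OF i]) (auto simp: case_prod_beta)
  have "fourier ?v \<omega> = (\<integral>t. (\<integral>z. u (t - \<tau> z) * exp (- (\<i> * of_real (\<omega> \<bullet> t))) \<partial>M) \<partial>lborel)"
    by (simp add: fourier_def)
  also have "\<dots> = (\<integral>z. (\<integral>t. u (t - \<tau> z) * exp (- (\<i> * of_real (\<omega> \<bullet> t))) \<partial>lborel) \<partial>M)"
    using Fubini_integral[OF j] by simp
  also have "\<dots> = (\<integral>z. fourier u \<omega> * exp (- (\<i> * of_real (\<omega> \<bullet> \<tau> z))) \<partial>M)"
  proof (rule Bochner_Integration.integral_cong[OF refl])
    show "(\<integral>t. u (t - \<tau> z) * exp (- (\<i> * of_real (\<omega> \<bullet> t))) \<partial>lborel)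
        = fourier u \<omega> * exp (- (\<i> * of_real (\<omega> \<bullet> \<tau> z)))" for z
      using fourier_translate[of u "- \<tau> z" \<omega>] by (simp add: fourier_def)
  qed
  finally show "fourier ?v \<omega> = fourier u \<omega> * (\<integral>z. exp (- (\<i> * of_real (\<omega> \<bullet> \<tau> z))) \<partial>M)"
    by simp
qed

lemma bci_lincomb:
  assumes "bci u" "bci v"
  shows "bci (\<lambda>x. a * u x + b * v x)"
    "fourier (\<lambda>x. a * u x + b * v x) \<omega> = a * fourier u \<omega> + b * fourier v \<omega>"
proof -
  show "fourier (\<lambda>x. a * u x + b * v x) \<omega> = a * fourier u \<omega> + b * fourier v \<omega>"
    using assms by (simp add: bci_def fourier_add fourier_cmult)
  obtain B C where "\<And>x. norm (u x) \<le> B" "\<And>x. norm (v x) \<le> C"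
    using assms by (auto simp: bci_def bounded_iff)
  then have "norm (a * u x + b * v x) \<le> norm a * B + norm b * C" for x
    by (intro order_trans[OF norm_triangle_ineq] add_mono) (auto simp: norm_mult mult_left_mono)
  then have "bounded (range (\<lambda>x. a * u x + b * v x))"
    by (auto simp: bounded_iff)
  then show "bci (\<lambda>x. a * u x + b * v x)"
    using assms by (auto simp: bci_def intro!: continuous_intros)
qed

text \<open>\<open>gauss (x *\<^sub>R \<omega>)\<close> is the characteristic function of
  \<open>x *\<^sub>R y\<close> with \<open>y\<close> normally distributed. Hence the multiplier is
  realised by averaging translates over \<open>M\<close> times a Gaussian measure; treating the
  dilation as a random translation covers \<open>x = 0\<close> as well.\<close>

lemma bci_gauss_average:
  fixes u :: "'a::euclidean_space \<Rightarrow> complex" and M :: "real measure"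
  assumes M: "finite_measure M" and [measurable_cong]: "sets M = sets borel" and u: "bci u"
  shows "\<exists>v. bci v \<and> (\<forall>\<omega>. fourier v \<omega> = of_real (\<integral>x. gauss (x *\<^sub>R \<omega>) \<partial>M) * fourier u \<omega>)"
proof -
  interpret M: finite_measure M by fact
  define G where "G = density lborel (\<lambda>y::'a. ennreal (gauss y))"
  have [measurable_cong]: "sets G = sets borel"
    by (simp add: G_def)
  interpret G: finite_measure G
    by standard (simp add: G_def emeasure_density nn_integral_eq_integral)
  interpret pair_sigma_finite M G ..
  have "finite_measure (M \<Otimes>\<^sub>M G)"
    by standard (simp add: space_pair_measure G.emeasure_pair_measure_Times ennreal_mult_eq_top_iff)
  note P = bci_average_translates[OF this _ u, of "\<lambda>(x, y). x *\<^sub>R y"]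
  interpret P: finite_measure "M \<Otimes>\<^sub>M G" by fact
  let ?c = "complex_of_real (sqrt (2 * pi) ^ DIM('a))"
  let ?v = "\<lambda>t. \<integral>z. u (t - (case z of (x, y) \<Rightarrow> x *\<^sub>R y)) \<partial>(M \<Otimes>\<^sub>M G)"
  have i: "integrable (M \<Otimes>\<^sub>M G) (\<lambda>z. exp (- (\<i> * of_real (\<omega> \<bullet> (case z of (x, y) \<Rightarrow> x *\<^sub>R y)))))" for \<omega>
    by (rule P.integrable_const_bound[of _ 1]) (auto simp: case_prod_beta)
  have e: "(\<integral>z. exp (- (\<i> * of_real (\<omega> \<bullet> (case z of (x, y) \<Rightarrow> x *\<^sub>R y)))) \<partial>(M \<Otimes>\<^sub>M G))
       = ?c * of_real (\<integral>x. gauss (x *\<^sub>R \<omega>) \<partial>M)" for \<omega>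
  proof -
    have "(\<integral>z. exp (- (\<i> * of_real (\<omega> \<bullet> (case z of (x, y) \<Rightarrow> x *\<^sub>R y)))) \<partial>(M \<Otimes>\<^sub>M G))
       = (\<integral>x. (\<integral>y. exp (- (\<i> * of_real (\<omega> \<bullet> (x *\<^sub>R y)))) \<partial>G) \<partial>M)"
      using integral_fst'[OF i[of \<omega>]] by simp
    also have "\<dots> = (\<integral>x. fourier (\<lambda>y::'a. of_real (gauss y)) (x *\<^sub>R \<omega>) \<partial>M)"
      by (simp add: G_def integral_density fourier_def scaleR_conv_of_real)
    finally show ?thesis
      by (simp add: fourier_gauss)
  qed
  \<comment> \<open>The factor \<open>inverse ?c\<close> removes the mass of the Gaussian measure;
    the term with coefficient 0 brings the scalar multiple into the shape of
    \<open>bci_lincomb\<close>.\<close>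
  have "bci (\<lambda>x. inverse ?c * ?v x + 0 * ?v x)"
    "fourier (\<lambda>x. inverse ?c * ?v x + 0 * ?v x) \<omega> = of_real (\<integral>x. gauss (x *\<^sub>R \<omega>) \<partial>M) * fourier u \<omega>" for \<omega>
    using bci_lincomb[OF P(1) P(1), where a="inverse ?c" and b=0] by (simp_all add: P(2) e)
  then show ?thesis
    by blast
qed

lemma has_bochner_integral_inverse_square: "has_bochner_integral lborel (\<lambda>x. indicator {1..} x / x\<^sup>2 :: real) 1"
proof -
  have "(\<integral>\<^sup>+x. ennreal (1 / x\<^sup>2) * indicator {1..} x \<partial>lborel) = ennreal (0 - (- (1 / 1)))"
  proof (rule nn_integral_FTC_atLeast[where F="\<lambda>x. - (1 / x)"])
    show "((\<lambda>x::real. - (1 / x)) \<longlongrightarrow> 0) at_top"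
      by real_asymp
  qed (auto intro!: derivative_eq_intros simp: power2_eq_square)
  moreover have "ennreal (indicator {1..} x / x\<^sup>2) = ennreal (1 / x\<^sup>2) * indicator {1..} x" for x :: real
    by (simp split: split_indicator)
  ultimately show ?thesis
    by (intro has_bochner_integral_nn_integral) simp_all
qed

text \<open>Integrate \<open>\<parallel>\<omega>\<parallel>\<^sup>2 exp (- x\<^sup>2 \<parallel>\<omega>\<parallel>\<^sup>2 / 2)\<close> over \<open>x \<ge> 0\<close>, by parts for \<open>x \<ge> 1\<close>: the two
  densities that appear are integrable, so that multiplication by \<open>\<parallel>\<omega>\<parallel>\<close> reduces to averages of
  dilated Gaussians.\<close>

lemma norm_as_gauss_average:
  fixes \<omega> :: "'a::euclidean_space"
  shows "sqrt (pi / 2) * norm \<omega> =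
    (norm \<omega>)\<^sup>2 * (\<integral>x. indicator {0..1} x * gauss (x *\<^sub>R \<omega>) \<partial>lborel) + gauss \<omega>
      - (\<integral>x. indicator {1..} x / x\<^sup>2 * gauss (x *\<^sub>R \<omega>) \<partial>lborel)"
proof -
  let ?r = "norm \<omega>"
  let ?g = "\<lambda>x. exp (- (x\<^sup>2 * ?r\<^sup>2 / 2))"
  have g: "gauss (x *\<^sub>R \<omega>) = ?g x" for x
    by (simp add: gauss_def power_mult_distrib)
  note inv = has_bochner_integral_inverse_square
  have i1: "integrable lborel (\<lambda>x. indicator {1..} x / x\<^sup>2 * ?g x)"
  proof (rule Bochner_Integration.integrable_bound)
    show "integrable lborel (\<lambda>x. indicator {1..} x / x\<^sup>2 :: real)"
      using inv by (simp add: has_bochner_integral_iff)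
    have "\<bar>y * ?g x\<bar> \<le> \<bar>y\<bar>" for x y
      by (simp add: abs_mult mult_left_le)
    then show "AE x in lborel. norm (indicator {1..} x / x\<^sup>2 * ?g x) \<le> norm (indicator {1..} x / x\<^sup>2 :: real)"
      by (simp only: real_norm_def) simp
  qed simp
  have i2: "integrable lborel (\<lambda>x. indicator {0..1} x * (?r\<^sup>2 * ?g x))"
  proof (rule Bochner_Integration.integrable_bound)
    show "integrable lborel (\<lambda>x::real. indicator {0..1} x * ?r\<^sup>2)"
      by (intro integrable_mult_left integrable_real_indicator) simp_all
  qed (auto simp: abs_mult mult_left_le split: split_indicator)
  \<comment> \<open>The half-line Gaussian integral after substituting \<open>c * x\<close> with
    \<open>c = ?r / sqrt 2\<close>. It is inversely proportional to the norm, so the factor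
    \<open>?r\<^sup>2\<close> leaves exactly one power of it.\<close>
  have i3: "has_bochner_integral lborel (\<lambda>x. indicator {0..} x * (?r\<^sup>2 * ?g x)) (sqrt (pi / 2) * ?r)"
  proof (cases "?r = 0")
    case False
    define c where "c = ?r / sqrt 2"
    have c: "c > 0" "c\<^sup>2 = ?r\<^sup>2 / 2"
      using False by (auto simp: c_def power_divide)
    have "has_bochner_integral lborel
        (\<lambda>x. indicator {0..} (0 + c * x) *\<^sub>R exp (- (0 + c * x)\<^sup>2)) (sqrt pi / 2 /\<^sub>R \<bar>c\<bar>)"
      using gaussian_moment_0 c by (subst lborel_has_bochner_integral_real_affine_iff[symmetric]) auto
    from has_bochner_integral_mult_right[OF this, of "?r\<^sup>2"]
    have "has_bochner_integral lborel
        (\<lambda>x. ?r\<^sup>2 * (indicator {0..} (0 + c * x) *\<^sub>R exp (- (0 + c * x)\<^sup>2))) (?r\<^sup>2 * (sqrt pi / 2 /\<^sub>R \<bar>c\<bar>))"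
      by simp
    also have "?r\<^sup>2 * (sqrt pi / 2 /\<^sub>R \<bar>c\<bar>) = sqrt (pi / 2) * ?r"
      using False by (simp add: c_def real_sqrt_divide power2_eq_square field_simps)
    also have "(\<lambda>x. ?r\<^sup>2 * (indicator {0..} (0 + c * x) *\<^sub>R exp (- (0 + c * x)\<^sup>2)))
        = (\<lambda>x. indicator {0..} x * (?r\<^sup>2 * ?g x))"
      using c by (auto simp: fun_eq_iff indicator_def power_mult_distrib zero_le_mult_iff mult_ac)
    finally show ?thesis .
  qed (simp add: has_bochner_integral_zero)
  \<comment> \<open>Integration by parts from 1 onwards, as one application of the fundamental
    theorem: the derivative of \<open>- (?g x / x)\<close> contains both densities, and the boundary
    value at 1 is \<open>gauss \<omega>\<close>.\<close>
  have i4: "has_bochner_integral lborel (\<lambda>x. indicator {1..} x * (?r\<^sup>2 * ?g x + ?g x / x\<^sup>2)) (gauss \<omega>)"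
  proof -
    have "(\<integral>\<^sup>+x. ennreal (?r\<^sup>2 * ?g x + ?g x / x\<^sup>2) * indicator {1..} x \<partial>lborel)
        = ennreal (0 - (- (?g 1 / 1)))"
    proof (rule nn_integral_FTC_atLeast[where F="\<lambda>x. - (?g x / x)"])
      show "((\<lambda>x::real. - (?g x / x)) \<longlongrightarrow> 0) at_top"
      proof (rule Lim_null_comparison)
        show "\<forall>\<^sub>F x in at_top. norm (- (?g x / x)) \<le> 1 / x"
          using eventually_gt_at_top[of 0] by eventually_elim (simp add: divide_right_mono)
        show "((\<lambda>x::real. 1 / x) \<longlongrightarrow> 0) at_top"
          by real_asymp
      qed
      fix x :: real assume x: "1 \<le> x"
      have d: "(?g has_real_derivative - (x * ?r\<^sup>2) * ?g x) (at x)"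
        by (auto intro!: derivative_eq_intros)
      have "(- (x * ?r\<^sup>2) * E * x - E * 1) / (x * x) = - (?r\<^sup>2 * E + E / x\<^sup>2)" for E
        using x by (simp add: field_simps power2_eq_square)
      with x show "((\<lambda>x. - (?g x / x)) has_real_derivative ?r\<^sup>2 * ?g x + ?g x / x\<^sup>2) (at x)"
        using DERIV_minus[OF DERIV_divide[OF d DERIV_ident]] by (simp add: add.commute)
    qed simp_all
    moreover have "ennreal (indicator {1..} x * (?r\<^sup>2 * ?g x + ?g x / x\<^sup>2))
        = ennreal (?r\<^sup>2 * ?g x + ?g x / x\<^sup>2) * indicator {1..} x" for x
      by (simp split: split_indicator)
    ultimately show ?thesis
      by (intro has_bochner_integral_nn_integral) (simp_all add: gauss_def)
  qed
  have "integrable lborel (\<lambda>x. indicator {1..} x * (?r\<^sup>2 * ?g x + ?g x / x\<^sup>2) - indicator {1..} x / x\<^sup>2 * ?g x)"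
    using i4 i1 by (intro Bochner_Integration.integrable_diff) (auto simp: has_bochner_integral_iff)
  then have i5: "integrable lborel (\<lambda>x. indicator {1..} x * (?r\<^sup>2 * ?g x))"
    by (simp add: algebra_simps)
  have "sqrt (pi / 2) * ?r = (\<integral>x. indicator {0..} x * (?r\<^sup>2 * ?g x) \<partial>lborel)"
    using i3 by (simp add: has_bochner_integral_iff)
  also have "\<dots> = (\<integral>x. indicator {0..1} x * (?r\<^sup>2 * ?g x) + indicator {1..} x * (?r\<^sup>2 * ?g x) \<partial>lborel)"
  proof (rule integral_cong_AE)
    show "AE x in lborel. indicator {0..} x * (?r\<^sup>2 * ?g x)
        = indicator {0..1} x * (?r\<^sup>2 * ?g x) + indicator {1..} x * (?r\<^sup>2 * ?g x)"
      using AE_lborel_singleton[of "1::real"] by eventually_elim (auto simp: indicator_def)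
  qed auto
  also have "\<dots> = ?r\<^sup>2 * (\<integral>x. indicator {0..1} x * ?g x \<partial>lborel) + (\<integral>x. indicator {1..} x * (?r\<^sup>2 * ?g x) \<partial>lborel)"
    using i2 i5 by (simp add: mult.left_commute[of "indicator _ _"])
  also have "(\<integral>x. indicator {1..} x * (?r\<^sup>2 * ?g x) \<partial>lborel) = gauss \<omega> - (\<integral>x. indicator {1..} x / x\<^sup>2 * ?g x \<partial>lborel)"
  proof -
    have "gauss \<omega> = (\<integral>x. indicator {1..} x * (?r\<^sup>2 * ?g x) + indicator {1..} x / x\<^sup>2 * ?g x \<partial>lborel)"
      using i4 by (simp add: has_bochner_integral_iff distrib_left)
    then show ?thesis
      using i1 i5 by simp
  qed
  finally show ?thesis
    by (simp add: g)
qed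

text \<open>Each term of \<open>norm_as_gauss_average\<close> is a Gaussian average against a finite
  measure: Lebesgue measure on the unit interval, a point mass at 1, and the density
  \<open>1 / x\<^sup>2\<close> beyond 1. The first one carries the factor
  \<open>(norm \<omega>)\<^sup>2\<close>, which is why \<open>w\<close> is supplied besides
  \<open>u\<close>.\<close>

lemma bci_mult_norm:
  fixes h :: "'a::euclidean_space \<Rightarrow> complex"
  assumes u: "bci u" "\<And>\<omega>. fourier u \<omega> = h \<omega>"
    and w: "bci w" "\<And>\<omega>. fourier w \<omega> = of_real ((norm \<omega>)\<^sup>2) * h \<omega>"
  shows "\<exists>v. bci v \<and> (\<forall>\<omega>. fourier v \<omega> = of_real (norm \<omega>) * h \<omega>)"
proof -
  have dens: "\<exists>v. bci v \<and> (\<forall>\<omega>. fourier v \<omega> = of_real (\<integral>x. f x * gauss (x *\<^sub>R \<omega>) \<partial>lborel) * fourier u \<omega>)"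
    if f: "integrable lborel f" "\<And>x. f x \<ge> 0" and u: "bci u" for f and u :: "'a \<Rightarrow> complex"
  proof -
    have [measurable]: "f \<in> borel_measurable borel"
      using f by auto
    have "finite_measure (density lborel (\<lambda>x. ennreal (f x)))"
      by standard (use f in \<open>simp add: emeasure_density nn_integral_eq_integral\<close>)
    from bci_gauss_average[OF this _ u] f show ?thesis
      by (simp add: integral_density)
  qed
  have "finite_measure (return borel (1::real))"
    by (intro prob_space.finite_measure prob_space_return) simp
  from bci_gauss_average[OF this _ u(1)] obtain v1 where v1: "bci v1"
    "\<And>\<omega>. fourier v1 \<omega> = of_real (gauss \<omega>) * h \<omega>"
    by (auto simp: u(2) integral_return)
  obtain v2 where v2: "bci v2"
    "\<And>\<omega>. fourier v2 \<omega> = of_real (\<integral>x. indicator {0..1} x * gauss (x *\<^sub>R \<omega>) \<partial>lborel) * (of_real ((norm \<omega>)\<^sup>2) * h \<omega>)"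
    using dens[of "indicator {0..1}", OF _ _ w(1)] unfolding w(2) by auto
  have "integrable lborel (\<lambda>x. indicator {1..} x / x\<^sup>2 :: real)"
    using has_bochner_integral_inverse_square by (simp add: has_bochner_integral_iff)
  then obtain v3 where v3: "bci v3"
    "\<And>\<omega>. fourier v3 \<omega> = of_real (\<integral>x. indicator {1..} x / x\<^sup>2 * gauss (x *\<^sub>R \<omega>) \<partial>lborel) * h \<omega>"
    using dens[of "\<lambda>x. indicator {1..} x / x\<^sup>2", OF _ _ u(1)] unfolding u(2) by auto
  define v where "v = (\<lambda>x. of_real (1 / sqrt (pi / 2)) * (1 * (1 * v1 x + 1 * v2 x) + (-1) * v3 x) + 0 * v1 x)"
  have "bci v"
    unfolding v_def by (intro bci_lincomb v1 v2 v3)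
  moreover have "fourier v \<omega> = of_real (norm \<omega>) * h \<omega>" for \<omega>
  proof -
    have "fourier v \<omega> = of_real (1 / sqrt (pi / 2)) *
        (1 * (1 * fourier v1 \<omega> + 1 * fourier v2 \<omega>) + (-1) * fourier v3 \<omega>) + 0 * fourier v1 \<omega>"
      unfolding v_def by (subst bci_lincomb(2), (intro bci_lincomb v1 v2 v3)+)+ (rule refl)
    also have "\<dots> = of_real (1 / sqrt (pi / 2) * (gauss \<omega> + (\<integral>x. indicator {0..1} x * gauss (x *\<^sub>R \<omega>) \<partial>lborel) * (norm \<omega>)\<^sup>2
        - (\<integral>x. indicator {1..} x / x\<^sup>2 * gauss (x *\<^sub>R \<omega>) \<partial>lborel))) * h \<omega>"
      by (simp add: v1 v2 v3 algebra_simps)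
    also have "gauss \<omega> + (\<integral>x. indicator {0..1} x * gauss (x *\<^sub>R \<omega>) \<partial>lborel) * (norm \<omega>)\<^sup>2
        - (\<integral>x. indicator {1..} x / x\<^sup>2 * gauss (x *\<^sub>R \<omega>) \<partial>lborel) = sqrt (pi / 2) * norm \<omega>"
      unfolding norm_as_gauss_average by simp
    finally show ?thesis
      by simp
  qed
  ultimately show ?thesis
    by blast
qed

text \<open>An odd power is one norm times an even power, and multiplying by one norm consumes two
  consecutive even powers.\<close>

lemma bci_mult_norm_power:
  fixes h :: "'a::euclidean_space \<Rightarrow> complex"
  assumes "\<And>j. \<exists>u. bci u \<and> (\<forall>\<omega>. fourier u \<omega> = of_real ((norm \<omega>) ^ (2 * j)) * h \<omega>)"
  shows "\<exists>v. bci v \<and> (\<forall>\<omega>. fourier v \<omega> = of_real (norm \<omega> ^ k) * h \<omega>)"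
proof (cases "even k")
  case True
  then show ?thesis
    using assms[of "k div 2"] by simp
next
  case False
  then obtain j where k: "k = Suc (2 * j)"
    by (auto elim: oddE)
  obtain u w where "bci u" "\<And>\<omega>. fourier u \<omega> = of_real ((norm \<omega>) ^ (2 * j)) * h \<omega>"
    "bci w" "\<And>\<omega>. fourier w \<omega> = of_real ((norm \<omega>)\<^sup>2) * (of_real ((norm \<omega>) ^ (2 * j)) * h \<omega>)"
    using assms[of j] assms[of "Suc j"] by (auto simp: mult.assoc power2_eq_square)
  from bci_mult_norm[OF this] show ?thesis
    by (simp add: k mult.assoc)
qed

section \<open>Slices of the Fourier transform\<close>

lemma stiefel_mult:
  assumes "A \<in> stiefel"
  shows "A *v (t v* A) = t"
  using assms by (simp add: stiefel_def matrix_vector_mul_assoc flip: transpose_matrix_vector)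

lemma stiefel_inner:
  assumes "A \<in> stiefel"
  shows "(s v* A) \<bullet> (t v* A) = s \<bullet> t"
  using assms by (simp add: dot_lmul_matrix stiefel_mult)

lemma stiefel_norm [simp]: "A \<in> stiefel \<Longrightarrow> norm (t v* A) = norm t"
  by (simp add: norm_eq_sqrt_inner stiefel_inner)

lemma linear_vector_matrix: "linear (\<lambda>t. t v* (A :: real^'d^'m))"
  using matrix_vector_mul_linear[of "transpose A"] by simp

lemma continuous_on_vector_matrix [continuous_intros]:
  fixes f :: "'z::topological_space \<Rightarrow> real^'m" and g :: "'z \<Rightarrow> real^'d^'m"
  assumes "continuous_on S f" "continuous_on S g"
  shows "continuous_on S (\<lambda>x. f x v* g x)"
  unfolding vector_matrix_mult_def by (intro continuous_intros assms)

text \<open>The kernel is the orthogonal complement of the range of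
  \<open>\<lambda>t. t v* A\<close>, and that map is injective because \<open>A\<close> is a left
  inverse of it.\<close>

lemma dim_stiefel_kernel:
  fixes A :: "real^'d^'m"
  assumes A: "A \<in> stiefel"
  shows "dim {x. A *v x = 0} + CARD('m) = CARD('d)"
proof -
  let ?R = "range (\<lambda>t. t v* A)"
  have "{x. A *v x = 0} = {y \<in> UNIV. \<forall>x\<in>?R. orthogonal x y}"
    by (auto simp: orthogonal_def dot_lmul_matrix) (metis inner_eq_zero_iff)
  moreover have "dim ?R = CARD('m)"
  proof -
    have "inj (\<lambda>t. t v* A)"
      by (metis stiefel_mult[OF A] injI)
    then show ?thesis
      using dim_image_eq[OF linear_vector_matrix, of A UNIV] by (simp add: dim_UNIV)
  qed
  moreover have "dim {y \<in> (UNIV :: (real^'d) set). \<forall>x\<in>?R. orthogonal x y} + dim ?R = dim (UNIV :: (real^'d) set)"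
    by (rule dim_subspace_orthogonal_to_vectors) (auto intro!: linear_subspace_image linear_vector_matrix)
  ultimately show ?thesis
    by simp
qed

text \<open>The same choice term as in \<open>lborel_subspace\<close>, so that unfolding
  \<open>kplane\<close> produces literally this basis.\<close>

definition kernel_basis :: "real^'d^'m \<Rightarrow> (real^'d) set" where
  "kernel_basis A = (SOME B. orthonormal_basis_of {x. A *v x = 0} B)"

lemma kernel_basis:
  fixes A :: "real^'d^'m"
  shows "pairwise orthogonal (kernel_basis A)" "b \<in> kernel_basis A \<Longrightarrow> norm b = 1"
    "span (kernel_basis A) = {x. A *v x = 0}" "finite (kernel_basis A)"
    "A \<in> stiefel \<Longrightarrow> card (kernel_basis A) + CARD('m) = CARD('d)"
proof -
  let ?W = "{x. A *v x = 0}" and ?B = "kernel_basis A"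
  have "subspace ?W"
    by (simp add: subspace_def matrix_vector_right_distrib vector_scalar_commute)
       (metis matrix_vector_mult_scaleR scaleR_zero_right)
  then obtain B where "pairwise orthogonal B" "\<And>x. x \<in> B \<Longrightarrow> norm x = 1" "span B = ?W"
    using orthonormal_basis_subspace by metis
  then have "orthonormal_basis_of ?W B"
    by (auto simp: orthonormal_basis_of_def)
  then have "orthonormal_basis_of ?W ?B"
    unfolding kernel_basis_def by (rule someI)
  then show *: "pairwise orthogonal ?B" "\<And>b. b \<in> ?B \<Longrightarrow> norm b = 1" "span ?B = ?W"
    by (auto simp: orthonormal_basis_of_def)
  have "independent ?B"
    by (rule pairwise_orthogonal_independent) (use * in force)+
  then show "finite ?B" "A \<in> stiefel \<Longrightarrow> card ?B + CARD('m) = CARD('d)"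
    using dim_stiefel_kernel[of A] dim_eq_card[of ?B ?W] independent_imp_finite *(3)
      span_eq_iff[THEN iffD2, OF \<open>subspace ?W\<close>] by auto
qed

lemma kernel_basis_orthogonal:
  "b \<in> kernel_basis A \<Longrightarrow> A *v b = 0"
  "b \<in> kernel_basis A \<Longrightarrow> (t v* A) \<bullet> b = 0"
  using kernel_basis(3)[of A] span_base[of b "kernel_basis A"] by (auto simp: dot_lmul_matrix)

text \<open>Orthonormal coordinates of the whole space adapted to \<open>A\<close>: \<open>c\<close>
  runs along the kernel, \<open>t\<close> across it.\<close>

definition plane_point :: "real^'d^'m \<Rightarrow> (real^'d \<Rightarrow> real) \<Rightarrow> real^'m \<Rightarrow> real^'d" where
  "plane_point A c t = (\<Sum>b\<in>kernel_basis A. c b *\<^sub>R b) + t v* A"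

abbreviation kernel_coords :: "real^'d^'m \<Rightarrow> (real^'d \<Rightarrow> real) measure" where
  "kernel_coords A \<equiv> \<Pi>\<^sub>M b\<in>kernel_basis A. lborel"

lemma plane_point_mult:
  assumes "A \<in> stiefel"
  shows "A *v plane_point A c t = t"
proof -
  have "A *v (\<Sum>b\<in>kernel_basis A. c b *\<^sub>R b) = (\<Sum>b\<in>kernel_basis A. A *v (c b *\<^sub>R b))"
    by (rule linear_sum[OF matrix_vector_mul_linear])
  then show ?thesis
    using assms by (simp add: plane_point_def matrix_vector_right_distrib stiefel_mult
        matrix_vector_mult_scaleR kernel_basis_orthogonal)
qed

lemma plane_point_norm:
  assumes "A \<in> stiefel"
  shows "(norm (plane_point A c t))\<^sup>2 = (\<Sum>b\<in>kernel_basis A. (c b)\<^sup>2) + (norm t)\<^sup>2"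
proof -
  let ?e = "\<Sum>b\<in>kernel_basis A. c b *\<^sub>R b"
  have "orthogonal ?e (t v* A)"
    by (auto simp: orthogonal_def inner_sum_right kernel_basis_orthogonal inner_commute[of _ "t v* A"])
  then have "(norm (plane_point A c t))\<^sup>2 = (norm ?e)\<^sup>2 + (norm t)\<^sup>2"
    using assms by (simp add: plane_point_def norm_add_Pythagorean)
  also have "(norm ?e)\<^sup>2 = (\<Sum>b\<in>kernel_basis A. (norm (c b *\<^sub>R b))\<^sup>2)"
    using kernel_basis(1,4)[of A]
    by (intro norm_sum_Pythagorean) (auto simp: pairwise_def orthogonal_clauses)
  finally show ?thesis
    by (simp add: kernel_basis(2))
qed

lemma measurable_plane_point [measurable]:
  "(\<lambda>(c, t). plane_point A c t) \<in> kernel_coords A \<Otimes>\<^sub>M lborel \<rightarrow>\<^sub>M borel"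
  "(\<lambda>c. plane_point A c t) \<in> kernel_coords A \<rightarrow>\<^sub>M borel"
proof -
  have [measurable]: "(\<lambda>t. t v* A) \<in> borel_measurable borel"
    by (intro borel_measurable_continuous_onI continuous_intros)
  show "(\<lambda>(c, t). plane_point A c t) \<in> kernel_coords A \<Otimes>\<^sub>M lborel \<rightarrow>\<^sub>M borel"
    "(\<lambda>c. plane_point A c t) \<in> kernel_coords A \<rightarrow>\<^sub>M borel"
    unfolding plane_point_def by measurable
qed

lemma kplane_eq:
  assumes "A \<in> stiefel" "\<phi> \<in> borel_measurable borel"
  shows "kplane \<phi> (A, t) = (\<integral>c. \<phi> (plane_point A c t) \<partial>kernel_coords A)"
  using assms unfolding kplane_def lborel_subspace_def Let_def kernel_basis_def[symmetric] plane_point_def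
  by (simp add: integral_distr)

lemma plane_point_expand:
  assumes A: "A \<in> stiefel"
  shows "x = plane_point A (\<lambda>b. x \<bullet> b) (A *v x)"
proof -
  have "x - (A *v x) v* A \<in> span (kernel_basis A)"
    using A by (simp add: kernel_basis matrix_vector_mult_diff_distrib stiefel_mult)
  from orthonormal_basis_expand[OF kernel_basis(1)[of A] _ this kernel_basis(4)]
  show ?thesis
    by (simp add: kernel_basis(2) plane_point_def inner_diff_left kernel_basis_orthogonal)
qed

text \<open>Points of the product space are extensional, hence the restriction in the shifted
  argument. Invariance is checked on boxes, factor by factor.\<close>

lemma nn_integral_PiM_translate:
  fixes B :: "'b set" and f :: "('b \<Rightarrow> real) \<Rightarrow> ennreal"
  assumes B: "finite B" and [measurable]: "f \<in> borel_measurable (\<Pi>\<^sub>M b\<in>B. lborel)"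
  shows "(\<integral>\<^sup>+c. f (\<lambda>b\<in>B. c b + a b) \<partial>(\<Pi>\<^sub>M b\<in>B. lborel)) = (\<integral>\<^sup>+c. f c \<partial>(\<Pi>\<^sub>M b\<in>B. lborel))"
proof -
  interpret product_sigma_finite "\<lambda>b::'b. lborel :: real measure" ..
  interpret finite_product_sigma_finite "\<lambda>b::'b. lborel :: real measure" B
    by standard fact
  let ?P = "\<Pi>\<^sub>M b\<in>B. lborel :: real measure" and ?S = "\<lambda>c. \<lambda>b\<in>B. c b + a b"
  have [measurable]: "?S \<in> ?P \<rightarrow>\<^sub>M ?P"
    by measurable
  have "distr ?P ?P ?S = ?P"
  proof (rule PiM_eqI)
    fix X assume X: "\<And>b. b \<in> B \<Longrightarrow> X b \<in> sets (lborel :: real measure)"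
    have [measurable]: "Pi\<^sub>E B X \<in> sets ?P" "b \<in> B \<Longrightarrow> X b \<in> sets borel" for b
      using X B by (auto intro!: sets_PiM_I_finite)
    have "emeasure (distr ?P ?P ?S) (Pi\<^sub>E B X) = emeasure ?P (Pi\<^sub>E B (\<lambda>b. (\<lambda>s. s + a b) -` X b))"
      by (subst emeasure_distr) (auto simp: space_PiM PiE_iff intro!: arg_cong[where f="emeasure ?P"])
    also have "\<dots> = (\<Prod>b\<in>B. emeasure lborel ((\<lambda>s. s + a b) -` X b))"
    proof (rule measure_times)
      fix b assume "b \<in> B"
      then show "(\<lambda>s. s + a b) -` X b \<in> sets lborel"
        using measurable_sets_borel[of "\<lambda>s. s + a b" borel "X b"] X by simp
    qed
    also have "\<dots> = (\<Prod>b\<in>B. emeasure lborel (X b))"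
    proof (rule prod.cong[OF refl])
      fix b assume b: "b \<in> B"
      have "emeasure lborel (X b) = emeasure (distr lborel borel ((+) (a b))) (X b)"
        by (simp add: lborel_distr_plus)
      also have "\<dots> = emeasure lborel ((\<lambda>s. s + a b) -` X b)"
        using X[OF b] by (subst emeasure_distr) (simp_all add: add.commute vimage_def)
      finally show "emeasure lborel ((\<lambda>s. s + a b) -` X b) = emeasure lborel (X b)" ..
    qed
    finally show "emeasure (distr ?P ?P ?S) (Pi\<^sub>E B X) = (\<Prod>b\<in>B. emeasure lborel (X b))" .
  qed (use B in simp_all)
  then show ?thesis
    using nn_integral_distr[of ?S ?P ?P f] by simp
qed

text \<open>A translation by \<open>x\<close> shifts the coordinates separately, by
  \<open>plane_point_expand\<close>, and by Pythagoras the Gaussian splits into a product over the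
  coordinates. So the characterisation of Lebesgue measure by invariance and Gaussian mass
  applies.\<close>

lemma lborel_distr_plane_point:
  fixes A :: "real^'d^'m"
  assumes A: "A \<in> stiefel"
  shows "distr (kernel_coords A \<Otimes>\<^sub>M lborel) borel (\<lambda>(c, t). plane_point A c t) = lborel"
proof (rule translation_invariant_eq_lborel)
  let ?P = "kernel_coords A" and ?B = "kernel_basis A"
  interpret product_sigma_finite "\<lambda>b::real^'d. lborel :: real measure" ..
  interpret P: finite_product_sigma_finite "\<lambda>b::real^'d. lborel :: real measure" ?B
    by standard (rule kernel_basis)
  interpret pair_sigma_finite ?P "lborel :: (real^'m) measure" ..
  show "sigma_finite_measure (?P \<Otimes>\<^sub>M (lborel :: (real^'m) measure))" ..
  show "(\<lambda>(c, t). plane_point A c t) \<in> borel_measurable (?P \<Otimes>\<^sub>M lborel)"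
    by measurable
  have "(\<integral>\<^sup>+z. ennreal (gauss (case z of (c, t) \<Rightarrow> plane_point A c t)) \<partial>(?P \<Otimes>\<^sub>M lborel))
      = (\<integral>\<^sup>+z. (case z of (c, t) \<Rightarrow> ennreal ((\<Prod>b\<in>?B. exp (- (c b)\<^sup>2 / 2)) * gauss (t::real^'m))) \<partial>(?P \<Otimes>\<^sub>M lborel))"
  proof -
    have "gauss (plane_point A c t) = (\<Prod>b\<in>?B. exp (- (c b)\<^sup>2 / 2)) * gauss t" for c t
      unfolding gauss_def plane_point_norm[OF A] exp_sum[symmetric, OF kernel_basis(4)] exp_add[symmetric]
      by (simp add: sum_negf sum_divide_distrib[symmetric] add_divide_distrib)
    then show ?thesis
      by (simp add: case_prod_beta)
  qed
  also have "\<dots> = (\<integral>\<^sup>+c. (\<integral>\<^sup>+t. ennreal ((\<Prod>b\<in>?B. exp (- (c b)\<^sup>2 / 2)) * gauss (t::real^'m)) \<partial>lborel) \<partial>?P)"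
    by (subst lborel.nn_integral_fst[symmetric]) (auto simp: case_prod_beta)
  also have "\<dots> = (\<integral>\<^sup>+c. (\<Prod>b\<in>?B. ennreal (exp (- (c b)\<^sup>2 / 2))) \<partial>?P) * (\<integral>\<^sup>+t. ennreal (gauss (t::real^'m)) \<partial>lborel)"
    by (simp add: ennreal_mult prod_nonneg nn_integral_cmult nn_integral_multc prod_ennreal)
  also have "(\<integral>\<^sup>+c. (\<Prod>b\<in>?B. ennreal (exp (- (c b)\<^sup>2 / 2))) \<partial>?P) = (\<Prod>b\<in>?B. (\<integral>\<^sup>+s. ennreal (exp (- s\<^sup>2 / 2)) \<partial>lborel))"
    by (rule product_nn_integral_prod) (auto simp: kernel_basis)
  also have "\<dots> = ennreal (sqrt (2 * pi) ^ card ?B)"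
    using gauss_1 by (simp add: nn_integral_eq_integral has_bochner_integral_iff ennreal_power)
  also have "(\<integral>\<^sup>+t. ennreal (gauss (t::real^'m)) \<partial>lborel) = ennreal (sqrt (2 * pi) ^ CARD('m))"
    by (simp add: nn_integral_eq_integral gauss_integral)
  also have "ennreal (sqrt (2 * pi) ^ card ?B) * ennreal (sqrt (2 * pi) ^ CARD('m)) = ennreal (sqrt (2 * pi) ^ CARD('d))"
    using kernel_basis(5)[OF A] by (simp add: ennreal_mult[symmetric] power_add[symmetric])
  also have "\<dots> = integral\<^sup>N lborel (\<lambda>x::real^'d. ennreal (gauss x))"
    by (simp add: nn_integral_eq_integral gauss_integral)
  finally show "(\<integral>\<^sup>+z. ennreal (gauss (case z of (c, t) \<Rightarrow> plane_point A c t)) \<partial>(?P \<Otimes>\<^sub>M lborel))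
      = integral\<^sup>N lborel (\<lambda>x::real^'d. ennreal (gauss x))" .
  fix H :: "real^'d \<Rightarrow> ennreal" and x :: "real^'d"
  assume [measurable]: "H \<in> borel_measurable borel"
  have shift: "plane_point A c t + x = plane_point A (\<lambda>b\<in>?B. c b + x \<bullet> b) (t + A *v x)" for c t
    by (subst plane_point_expand[OF A, of x])
       (simp add: plane_point_def scaleR_add_left sum.distrib linear_add[OF linear_vector_matrix] add_ac)
  have "(\<integral>\<^sup>+z. H ((case z of (c, t) \<Rightarrow> plane_point A c t) + x) \<partial>(?P \<Otimes>\<^sub>M lborel))
      = (\<integral>\<^sup>+c. (\<integral>\<^sup>+t. H (plane_point A (\<lambda>b\<in>?B. c b + x \<bullet> b) (t + A *v x)) \<partial>lborel) \<partial>?P)"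
    by (subst lborel.nn_integral_fst[symmetric]) (auto simp: case_prod_beta shift)
  also have "\<dots> = (\<integral>\<^sup>+c. (\<integral>\<^sup>+t. H (plane_point A (\<lambda>b\<in>?B. c b + x \<bullet> b) t) \<partial>lborel) \<partial>?P)"
  proof (rule nn_integral_cong)
    fix c assume "c \<in> space ?P"
    have [measurable]: "(\<lambda>t. plane_point A c t) \<in> borel_measurable borel" for c
      unfolding plane_point_def by (intro borel_measurable_continuous_onI continuous_intros)
    show "(\<integral>\<^sup>+t. H (plane_point A (\<lambda>b\<in>?B. c b + x \<bullet> b) (t + A *v x)) \<partial>lborel)
        = (\<integral>\<^sup>+t. H (plane_point A (\<lambda>b\<in>?B. c b + x \<bullet> b) t) \<partial>lborel)"
      by (rule nn_integral_lborel_translate) measurable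
  qed
  also have "\<dots> = (\<integral>\<^sup>+c. (\<integral>\<^sup>+t. H (plane_point A c t) \<partial>lborel) \<partial>?P)"
    using nn_integral_PiM_translate[OF kernel_basis(4), of "\<lambda>c. (\<integral>\<^sup>+t. H (plane_point A c t) \<partial>lborel)" A "\<lambda>b. x \<bullet> b"]
    by simp
  also have "\<dots> = (\<integral>\<^sup>+z. H (case z of (c, t) \<Rightarrow> plane_point A c t) \<partial>(?P \<Otimes>\<^sub>M lborel))"
    by (subst lborel.nn_integral_fst[symmetric]) (auto simp: case_prod_beta)
  finally show "(\<integral>\<^sup>+z. H ((case z of (c, t) \<Rightarrow> plane_point A c t) + x) \<partial>(?P \<Otimes>\<^sub>M lborel))
      = (\<integral>\<^sup>+z. H (case z of (c, t) \<Rightarrow> plane_point A c t) \<partial>(?P \<Otimes>\<^sub>M lborel))" .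
qed

text \<open>The slice theorem is Fubini in the coordinates of \<open>plane_point\<close>: as
  \<open>A\<close> maps a point to its coordinate \<open>t\<close>, the phase of
  \<open>\<omega>\<close> at \<open>t\<close> is that of \<open>\<omega> v* A\<close> at the
  point.\<close>

lemma fourier_kplane:
  fixes A :: "real^'d^'m"
  assumes A: "A \<in> stiefel" and \<phi>: "integrable lborel \<phi>"
  shows "integrable lborel (\<lambda>t. kplane \<phi> (A, t))"
    and "fourier (\<lambda>t. kplane \<phi> (A, t)) \<omega> = fourier \<phi> (\<omega> v* A)"
proof -
  let ?P = "kernel_coords A" and ?T = "\<lambda>(c, t). plane_point A c t"
  interpret product_sigma_finite "\<lambda>b::real^'d. lborel :: real measure" ..
  interpret P: finite_product_sigma_finite "\<lambda>b::real^'d. lborel :: real measure" "kernel_basis A"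
    by standard (rule kernel_basis)
  interpret pair_sigma_finite ?P "lborel :: (real^'m) measure" ..
  interpret Q: pair_sigma_finite "lborel :: (real^'m) measure" ?P ..
  have [measurable]: "\<phi> \<in> borel_measurable borel"
    using \<phi> by (simp add: borel_measurable_integrable)
  have push: "integrable (?P \<Otimes>\<^sub>M lborel) (\<lambda>z. f (?T z))"
    "(\<integral>z. f (?T z) \<partial>(?P \<Otimes>\<^sub>M lborel)) = (\<integral>x. f x \<partial>lborel)"
    if f: "integrable lborel f" for f :: "real^'d \<Rightarrow> complex"
  proof -
    have [measurable]: "f \<in> borel_measurable borel"
      using f by (simp add: borel_measurable_integrable)
    have "integrable (distr (?P \<Otimes>\<^sub>M lborel) borel ?T) f"
      using f by (simp add: lborel_distr_plane_point[OF A])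
    then show "integrable (?P \<Otimes>\<^sub>M lborel) (\<lambda>z. f (?T z))"
      by (subst (asm) integrable_distr_eq) measurable
    show "(\<integral>z. f (?T z) \<partial>(?P \<Otimes>\<^sub>M lborel)) = (\<integral>x. f x \<partial>lborel)"
      by (subst lborel_distr_plane_point[OF A, symmetric], subst integral_distr) measurable
  qed
  have i: "integrable (lborel \<Otimes>\<^sub>M ?P) (\<lambda>(t, c). \<phi> (plane_point A c t))"
    using push(1)[OF \<phi>] integrable_product_swap_iff[of "\<lambda>z. \<phi> (?T z)"]
    by (simp add: case_prod_beta)
  show "integrable lborel (\<lambda>t. kplane \<phi> (A, t))"
    using Q.integrable_fst'[OF i] by (simp add: kplane_eq[OF A])
  have j: "integrable (?P \<Otimes>\<^sub>M lborel) (\<lambda>(c, t). \<phi> (plane_point A c t) * exp (- (\<i> * of_real (\<omega> \<bullet> t))))"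
    using push(1)[OF integrable_fourier_kernel(1)[OF \<phi>, of "\<omega> v* A"]]
    by (simp add: split_beta' dot_lmul_matrix plane_point_mult[OF A])
  have "fourier (\<lambda>t. kplane \<phi> (A, t)) \<omega>
      = (\<integral>t. (\<integral>c. \<phi> (plane_point A c t) * exp (- (\<i> * of_real (\<omega> \<bullet> t))) \<partial>?P) \<partial>lborel)"
    by (simp add: fourier_def kplane_eq[OF A])
  also have "\<dots> = (\<integral>z. \<phi> (?T z) * exp (- (\<i> * of_real (\<omega> \<bullet> snd z))) \<partial>(?P \<Otimes>\<^sub>M lborel))"
    using integral_snd[OF j] by (simp add: split_beta')
  also have "\<dots> = fourier \<phi> (\<omega> v* A)"
    using push(2)[OF integrable_fourier_kernel(1)[OF \<phi>, of "\<omega> v* A"]]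
    by (simp add: fourier_def case_prod_beta dot_lmul_matrix plane_point_mult[OF A])
  finally show "fourier (\<lambda>t. kplane \<phi> (A, t)) \<omega> = fourier \<phi> (\<omega> v* A)" .
qed

section \<open>Rapidly decreasing functions\<close>

text \<open>Decay without smoothness, since a symbol that is singular at 0 may destroy derivatives.
  The weight \<open>1 + (norm x)\<^sup>2\<close> compares directly with products over orthonormal
  coordinates.\<close>

definition rapid :: "('a::euclidean_space \<Rightarrow> complex) \<Rightarrow> bool" where
  "rapid f \<longleftrightarrow> continuous_on UNIV f \<and> (\<forall>N. \<exists>C. \<forall>x. norm (f x) * (1 + (norm x)\<^sup>2) ^ N \<le> C)"

lemma rapidD:
  assumes "rapid f"
  shows "continuous_on UNIV f" "f \<in> borel_measurable borel"
    "\<exists>C. \<forall>x. norm (f x) * (1 + (norm x)\<^sup>2) ^ N \<le> C"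
  using assms borel_measurable_continuous_onI by (auto simp: rapid_def)

lemma cauchy_density:
  "integrable lborel (\<lambda>s::real. 1 / (1 + s\<^sup>2))" "(\<integral>s. 1 / (1 + s\<^sup>2) \<partial>lborel) = pi"
  using integrable_inverse_1_plus_square LBINT_inverse_1_plus_square
  by (simp_all add: set_integrable_def interval_lebesgue_integral_def set_lebesgue_integral_def inverse_eq_divide)

text \<open>Each coordinate satisfies \<open>\<bar>x \<bullet> b\<bar> \<le> norm x\<close>, so a
  product of one-dimensional Cauchy densities dominates.\<close>

lemma integrable_inverse_weight:
  "integrable lborel (\<lambda>x::'a::euclidean_space. 1 / (1 + (norm x)\<^sup>2) ^ DIM('a))"
proof (rule Bochner_Integration.integrable_bound)
  show "integrable lborel (\<lambda>x::'a. \<Prod>b\<in>Basis. 1 / (1 + (x \<bullet> b)\<^sup>2))"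
    by (rule integrable_lborel_prod) (rule cauchy_density)
  have "norm (1 / (1 + (norm x)\<^sup>2) ^ DIM('a)) \<le> norm (\<Prod>b\<in>Basis. 1 / (1 + (x \<bullet> b)\<^sup>2))" for x :: 'a
  proof -
    have "(\<Prod>b\<in>Basis. 1 + (x \<bullet> b)\<^sup>2) \<le> (\<Prod>b\<in>(Basis::'a set). 1 + (norm x)\<^sup>2)"
      by (intro prod_mono) (auto simp: abs_le_square_iff[symmetric] Basis_le_norm)
    moreover have "(\<Prod>b\<in>Basis. 1 + (x \<bullet> b)\<^sup>2) > 0"
      by (intro prod_pos) (auto intro: add_pos_nonneg)
    ultimately show ?thesis
      by (simp add: prod_dividef frac_le prod_nonneg)
  qed
  then show "AE x in lborel. norm (1 / (1 + (norm (x::'a))\<^sup>2) ^ DIM('a)) \<le> norm (\<Prod>b\<in>Basis. 1 / (1 + (x \<bullet> b)\<^sup>2))"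
    by simp
qed measurable

lemma rapid_integrable_weighted:
  fixes f :: "'a::euclidean_space \<Rightarrow> complex"
  assumes "rapid f"
  shows "integrable lborel (\<lambda>x. norm (f x) * (1 + (norm x)\<^sup>2) ^ N)"
proof -
  note [measurable] = rapidD(2)[OF assms]
  obtain C where C: "\<And>x. norm (f x) * (1 + (norm x)\<^sup>2) ^ (N + DIM('a)) \<le> C"
    using rapidD(3)[OF assms] by blast
  show ?thesis
  proof (rule Bochner_Integration.integrable_bound)
    show "integrable lborel (\<lambda>x::'a. C * (1 / (1 + (norm x)\<^sup>2) ^ DIM('a)))"
      by (intro integrable_mult_right integrable_inverse_weight)
    have "norm (norm (f x) * (1 + (norm x)\<^sup>2) ^ N) \<le> norm (C * (1 / (1 + (norm x)\<^sup>2) ^ DIM('a)))" for x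
    proof -
      have p: "(1 + (norm x)\<^sup>2) ^ DIM('a) > 0"
        by (intro zero_less_power add_pos_nonneg) auto
      have "norm (f x) * (1 + (norm x)\<^sup>2) ^ N \<le> C / (1 + (norm x)\<^sup>2) ^ DIM('a)"
        using C[of x] p by (simp add: pos_le_divide_eq power_add mult.assoc)
      also have "\<dots> \<le> \<bar>C\<bar> / (1 + (norm x)\<^sup>2) ^ DIM('a)"
        using p by (intro divide_right_mono) auto
      finally show ?thesis
        by (simp add: abs_mult)
    qed
    then show "AE x in lborel. norm (norm (f x) * (1 + (norm x)\<^sup>2) ^ N) \<le> norm (C * (1 / (1 + (norm x)\<^sup>2) ^ DIM('a)))"
      by simp
  qed measurable
qed

lemma rapid_integrable:
  fixes f :: "'a::euclidean_space \<Rightarrow> complex"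
  assumes "rapid f"
  shows "integrable lborel f"
  using rapid_integrable_weighted[OF assms, of 0] rapidD(2)[OF assms]
  by (simp add: integrable_norm_iff)

lemma one_plus_norm_power_le:
  fixes x :: "'a::real_normed_vector"
  shows "(1 + norm x) ^ N \<le> 2 ^ N * (1 + (norm x)\<^sup>2) ^ N"
proof -
  have "2 * norm x \<le> 1 + (norm x)\<^sup>2"
    using zero_le_power2[of "1 - norm x"] unfolding power2_diff by simp
  then have "1 + norm x \<le> 2 * (1 + (norm x)\<^sup>2)"
    using zero_le_power2[of "norm x"] by argo
  then have "(1 + norm x) ^ N \<le> (2 * (1 + (norm x)\<^sup>2)) ^ N"
    by (intro power_mono) auto
  then show ?thesis
    by (simp only: power_mult_distrib)
qed

lemma rapid_bci: "rapid f \<Longrightarrow> bci f"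
  using rapidD(1)[of f] rapidD(3)[of f 0] rapid_integrable by (auto simp: bci_def bounded_iff)

text \<open>Of the \<open>N + CARD('d)\<close> powers, \<open>N\<close> pay for the weight in
  \<open>t\<close> and \<open>CARD('d)\<close> for the Cauchy product over the kernel basis, which
  has at most that many factors.\<close>

lemma kplane_dominated:
  fixes A :: "real^'d^'m"
  assumes A: "A \<in> stiefel" and C: "\<And>x. norm (\<phi> x) * (1 + (norm x)\<^sup>2) ^ (N + CARD('d)) \<le> C"
  shows "norm (\<phi> (plane_point A c t)) * (1 + (norm t)\<^sup>2) ^ N \<le> C * (\<Prod>b\<in>kernel_basis A. 1 / (1 + (c b)\<^sup>2))"
proof -
  let ?B = "kernel_basis A" and ?y = "plane_point A c t"
  have n: "(norm ?y)\<^sup>2 = (\<Sum>b\<in>?B. (c b)\<^sup>2) + (norm t)\<^sup>2"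
    by (rule plane_point_norm[OF A])
  have "(1 + (norm t)\<^sup>2) ^ N \<le> (1 + (norm ?y)\<^sup>2) ^ N"
    by (intro power_mono) (auto simp: n sum_nonneg)
  moreover have "(\<Prod>b\<in>?B. 1 + (c b)\<^sup>2) \<le> (1 + (norm ?y)\<^sup>2) ^ CARD('d)"
  proof -
    have "(\<Prod>b\<in>?B. 1 + (c b)\<^sup>2) \<le> (\<Prod>b\<in>?B. 1 + (norm ?y)\<^sup>2)"
    proof (intro prod_mono conjI)
      fix b assume "b \<in> ?B"
      then have "(c b)\<^sup>2 \<le> (\<Sum>b\<in>?B. (c b)\<^sup>2)"
        using kernel_basis(4) by (intro member_le_sum) auto
      then show "1 + (c b)\<^sup>2 \<le> 1 + (norm ?y)\<^sup>2"
        by (simp add: n add_increasing2)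
    qed simp
    also have "\<dots> \<le> (1 + (norm ?y)\<^sup>2) ^ CARD('d)"
      using kernel_basis(5)[OF A] by (simp add: power_increasing)
    finally show ?thesis .
  qed
  ultimately have "(1 + (norm t)\<^sup>2) ^ N * (\<Prod>b\<in>?B. 1 + (c b)\<^sup>2) \<le> (1 + (norm ?y)\<^sup>2) ^ (N + CARD('d))"
    unfolding power_add by (intro mult_mono) (auto intro!: prod_nonneg)
  from mult_left_mono[OF this, of "norm (\<phi> ?y)"]
  have "norm (\<phi> ?y) * (1 + (norm t)\<^sup>2) ^ N * (\<Prod>b\<in>?B. 1 + (c b)\<^sup>2) \<le> C"
    using C[of ?y] by (simp add: mult.assoc)
  moreover have "(\<Prod>b\<in>?B. 1 + (c b)\<^sup>2) > 0"
    by (intro prod_pos) (auto intro: add_pos_nonneg)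
  ultimately show ?thesis
    by (simp add: prod_dividef pos_le_divide_eq)
qed

lemma kernel_coords_cauchy:
  "integrable (kernel_coords A) (\<lambda>c. \<Prod>b\<in>kernel_basis A. 1 / (1 + (c b)\<^sup>2))"
  "(\<integral>c. (\<Prod>b\<in>kernel_basis A. 1 / (1 + (c b)\<^sup>2)) \<partial>kernel_coords A) = pi ^ card (kernel_basis A)"
proof -
  interpret product_sigma_finite "\<lambda>b. lborel :: real measure" ..
  show "integrable (kernel_coords A) (\<lambda>c. \<Prod>b\<in>kernel_basis A. 1 / (1 + (c b)\<^sup>2))"
    by (rule product_integrable_prod) (auto intro: kernel_basis cauchy_density)
  show "(\<integral>c. (\<Prod>b\<in>kernel_basis A. 1 / (1 + (c b)\<^sup>2)) \<partial>kernel_coords A) = pi ^ card (kernel_basis A)"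
    by (subst product_integral_prod) (auto intro: kernel_basis simp: cauchy_density)
qed

text \<open>The power of \<open>pi\<close> is the integral of the Cauchy product, with one factor
  for each basis vector of the kernel. The bound is uniform in \<open>A\<close>.\<close>

lemma kplane_weighted_bound:
  fixes A :: "real^'d^'m"
  assumes A: "A \<in> stiefel" and [measurable]: "\<phi> \<in> borel_measurable borel"
    and C: "\<And>x. norm (\<phi> x) * (1 + (norm x)\<^sup>2) ^ (N + CARD('d)) \<le> C"
  shows "norm (kplane \<phi> (A, t)) * (1 + (norm t)\<^sup>2) ^ N \<le> C * pi ^ (CARD('d) - CARD('m))"
proof -
  let ?P = "kernel_coords A" and ?w = "(1 + (norm t)\<^sup>2) ^ N"
  have "norm (\<phi> 0) * (1 + (norm (0::real^'d))\<^sup>2) ^ (N + CARD('d)) \<le> C"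
    by (rule C)
  then have "C \<ge> 0"
    by (simp add: order_trans[OF norm_ge_zero])
  have "norm (kplane \<phi> (A, t)) * ?w \<le> (\<integral>c. norm (\<phi> (plane_point A c t)) \<partial>?P) * ?w"
    using A by (intro mult_right_mono) (simp_all add: kplane_eq)
  also have "\<dots> = (\<integral>c. norm (\<phi> (plane_point A c t)) * ?w \<partial>?P)"
    by simp
  also have "\<dots> \<le> (\<integral>c. C * (\<Prod>b\<in>kernel_basis A. 1 / (1 + (c b)\<^sup>2)) \<partial>?P)"
    by (rule integral_mono')
       (auto intro!: integrable_mult_right kernel_coords_cauchy kplane_dominated[OF A C] mult_nonneg_nonneg prod_nonneg \<open>C \<ge> 0\<close>)
  also have "\<dots> = C * pi ^ card (kernel_basis A)"
    by (simp add: kernel_coords_cauchy)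
  also have "card (kernel_basis A) = CARD('d) - CARD('m)"
    using kernel_basis(5)[OF A] by simp
  finally show ?thesis .
qed

lemma kplane_integrable:
  fixes A :: "real^'d^'m"
  assumes A: "A \<in> stiefel" and \<phi>: "rapid \<phi>"
  shows "integrable (kernel_coords A) (\<lambda>c. \<phi> (plane_point A c t))"
proof -
  note [measurable] = rapidD(2)[OF \<phi>]
  obtain C where C: "\<And>x. norm (\<phi> x) * (1 + (norm x)\<^sup>2) ^ (0 + CARD('d)) \<le> C"
    using rapidD(3)[OF \<phi>] by blast
  have "norm (\<phi> (plane_point A c t)) \<le> norm (C * (\<Prod>b\<in>kernel_basis A. 1 / (1 + (c b)\<^sup>2)))" for c
    using kplane_dominated[OF A C, of c t] by simp
  then show ?thesis
    by (intro Bochner_Integration.integrable_bound[OF integrable_mult_right[OF kernel_coords_cauchy(1)[of A], of C]]) auto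
qed

lemma kplane_add:
  assumes "rapid \<phi>" "rapid \<psi>"
  shows "kplane (\<lambda>x. \<phi> x + \<psi> x) p = kplane \<phi> p + kplane \<psi> p"
proof -
  note [measurable] = assms[THEN rapidD(2)]
  show ?thesis
  proof (cases p)
    case (Pair A t)
    show ?thesis
    proof (cases "A \<in> stiefel")
      case True
      then show ?thesis
        using assms by (simp add: Pair kplane_eq kplane_integrable)
    qed (simp add: Pair kplane_def)
  qed
qed

lemma kplane_cmult: "kplane (\<lambda>x. c * \<phi> x) p = c * kplane \<phi> p"
  by (cases p) (simp add: kplane_def)

lemma bci_kplane:
  fixes A :: "real^'d^'m"
  assumes A: "A \<in> stiefel" and \<phi>: "rapid \<phi>"
  shows "bci (\<lambda>t. kplane \<phi> (A, t))"
proof -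
  note [measurable] = rapidD(2)[OF \<phi>]
  obtain C where C: "\<And>x. norm (\<phi> x) * (1 + (norm x)\<^sup>2) ^ (0 + CARD('d)) \<le> C"
    using rapidD(3)[OF \<phi>] by blast
  have "continuous_on UNIV (\<lambda>t. \<integral>c. \<phi> (plane_point A c t) \<partial>kernel_coords A)"
  proof (rule continuous_on_integral_param)
    show "norm (\<phi> (plane_point A c t)) \<le> C * (\<Prod>b\<in>kernel_basis A. 1 / (1 + (c b)\<^sup>2))" for c t
      using kplane_dominated[OF A C, of c t] by simp
    show "continuous_on UNIV (\<lambda>t. \<phi> (plane_point A c t))" for c
      unfolding plane_point_def
      by (intro continuous_on_compose2[OF rapidD(1)[OF \<phi>]] continuous_intros) auto
  qed (auto intro!: kernel_coords_cauchy)
  then have "continuous_on UNIV (\<lambda>t. kplane \<phi> (A, t))"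
    by (simp add: kplane_eq[OF A])
  moreover have "bounded (range (\<lambda>t. kplane \<phi> (A, t)))"
    using kplane_weighted_bound[OF A _ C] by (auto simp: bounded_iff)
  ultimately show ?thesis
    using fourier_kplane(1)[OF A rapid_integrable[OF \<phi>]] by (simp add: bci_def)
qed

section \<open>Schwartz functions\<close>

lemma partials_Nil [simp]: "partials [] f = f"
  and partials_Cons: "partials (b # bs) f = partial_deriv b (partials bs f)"
  and partials_snoc: "partials (bs @ [b]) f = partials bs (partial_deriv b f)"
  by (simp_all add: partials_def)

lemma schwartzD:
  assumes "f \<in> schwartz_space" "bs \<in> lists Basis"
  shows "partials bs f differentiable (at x)"
    "bounded (range (\<lambda>x. (1 + norm x) ^ N *\<^sub>R partials bs f x))"
  using assms by (auto simp: schwartz_space_def smooth_def)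

lemma has_partial_deriv:
  assumes "f differentiable (at x)"
  shows "((\<lambda>s. f (x + s *\<^sub>R b)) has_vector_derivative partial_deriv b f x) (at 0)"
proof -
  from assms obtain D where D: "(f has_derivative D) (at (x + 0 *\<^sub>R b))"
    by (auto simp: differentiable_def)
  have "((\<lambda>s. x + s *\<^sub>R b) has_derivative (\<lambda>s. s *\<^sub>R b)) (at 0)"
    by (auto intro!: derivative_eq_intros)
  from has_derivative_compose[OF this D]
  have "(\<lambda>s. f (x + s *\<^sub>R b)) differentiable (at (0::real))"
    by (auto simp: differentiable_def)
  then show ?thesis
    unfolding partial_deriv_def by (simp add: vector_derivative_works)
qed

lemma has_partial_deriv_at:
  assumes "f differentiable (at (x + s *\<^sub>R b))"
  shows "((\<lambda>s. f (x + s *\<^sub>R b)) has_vector_derivative partial_deriv b f (x + s *\<^sub>R b)) (at s)"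
proof -
  have "((\<lambda>r. f ((x + s *\<^sub>R b) + r *\<^sub>R b)) \<circ> (\<lambda>r. r - s) has_vector_derivative
      1 *\<^sub>R partial_deriv b f (x + s *\<^sub>R b)) (at s)"
    by (rule vector_diff_chain_at) (auto intro!: derivative_eq_intros has_partial_deriv assms)
  then show ?thesis
    by (simp add: comp_def scaleR_left_diff_distrib)
qed

lemma partial_deriv_eqI:
  "((\<lambda>s. f (x + s *\<^sub>R b)) has_vector_derivative f') (at 0) \<Longrightarrow> partial_deriv b f x = f'"
  unfolding partial_deriv_def by (rule vector_derivative_at)

lemma has_derivative_partials:
  assumes "f differentiable (at x)"
  shows "(f has_derivative (\<lambda>h. \<Sum>b\<in>Basis. (h \<bullet> b) *\<^sub>R partial_deriv b f x)) (at x)"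
proof -
  from assms obtain D where D: "(f has_derivative D) (at x)"
    by (auto simp: differentiable_def)
  then have lin: "linear D"
    by (rule has_derivative_linear)
  have Db: "D b = partial_deriv b f x" for b
  proof (rule partial_deriv_eqI[symmetric])
    have 1: "((\<lambda>s. x + s *\<^sub>R b) has_derivative (\<lambda>s. s *\<^sub>R b)) (at 0)"
      by (auto intro!: derivative_eq_intros)
    have 2: "(f has_derivative D) (at (x + 0 *\<^sub>R b))"
      using D by simp
    show "((\<lambda>s. f (x + s *\<^sub>R b)) has_vector_derivative D b) (at 0)"
      using has_derivative_compose[OF 1 2]
      by (simp add: has_vector_derivative_def linear_scale[OF lin])
  qed
  have "D h = (\<Sum>b\<in>Basis. (h \<bullet> b) *\<^sub>R D b)" for h
    by (subst (1) euclidean_representation[symmetric, of h])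
       (simp add: linear_sum[OF lin] linear_scale[OF lin])
  then have "D = (\<lambda>h. \<Sum>b\<in>Basis. (h \<bullet> b) *\<^sub>R partial_deriv b f x)"
    unfolding Db by (rule ext)
  with D show ?thesis by simp
qed

definition seminorm :: "nat \<Rightarrow> 'a::euclidean_space list \<Rightarrow> ('a \<Rightarrow> complex) \<Rightarrow> real" where
  "seminorm N bs f = (SUP x. (1 + norm x) ^ N * cmod (partials bs f x))"

lemma seminorm_bdd:
  assumes "f \<in> schwartz_space" "bs \<in> lists Basis"
  shows "bdd_above (range (\<lambda>x. (1 + norm x) ^ N * cmod (partials bs f x)))"
proof -
  obtain B where "\<And>x. norm ((1 + norm x) ^ N *\<^sub>R partials bs f x) \<le> B"
    using schwartzD(2)[OF assms, of N] by (auto simp: bounded_iff)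
  then show ?thesis
    by (intro bdd_aboveI2[of _ _ B]) (simp add: abs_mult)
qed

lemma le_seminorm:
  assumes "f \<in> schwartz_space" "bs \<in> lists Basis"
  shows "(1 + norm x) ^ N * cmod (partials bs f x) \<le> seminorm N bs f"
  unfolding seminorm_def by (rule cSUP_upper[OF UNIV_I seminorm_bdd[OF assms]])

lemma seminorm_le:
  assumes "\<And>x. (1 + norm x) ^ N * cmod (partials bs f x) \<le> B"
  shows "seminorm N bs f \<le> B"
  unfolding seminorm_def by (rule cSUP_least) (use assms in auto)

lemma seminorm_nonneg:
  assumes "f \<in> schwartz_space" "bs \<in> lists Basis"
  shows "seminorm N bs f \<ge> 0"
  by (rule order_trans[OF _ le_seminorm[OF assms, of 0]]) simp

lemma schwartzI:
  assumes "\<And>bs x. bs \<in> lists Basis \<Longrightarrow> partials bs f differentiable (at x)"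
    and "\<And>bs N. bs \<in> lists Basis \<Longrightarrow> \<exists>B. \<forall>x. (1 + norm x) ^ N * cmod (partials bs f x) \<le> B"
  shows "f \<in> schwartz_space"
  using assms unfolding schwartz_space_def smooth_def bounded_iff by (fastforce simp: abs_mult)

lemma schwartz_partial_deriv:
  assumes "f \<in> schwartz_space" "b \<in> Basis"
  shows "partial_deriv b f \<in> schwartz_space"
proof (rule schwartzI)
  fix bs :: "'a list" assume "bs \<in> lists Basis"
  then have bs: "bs @ [b] \<in> lists Basis" using assms by auto
  show "partials bs (partial_deriv b f) differentiable (at x)" for x
    using schwartzD(1)[OF assms(1) bs] by (simp add: partials_snoc)
  show "\<exists>B. \<forall>x. (1 + norm x) ^ N * cmod (partials bs (partial_deriv b f) x) \<le> B" for N
    using le_seminorm[OF assms(1) bs] by (auto simp: partials_snoc)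
qed

lemma schwartz_differentiable: "f \<in> schwartz_space \<Longrightarrow> f differentiable (at x)"
  using schwartzD(1)[of f "[]"] by simp

lemma schwartz_continuous:
  assumes "f \<in> schwartz_space"
  shows "continuous_on UNIV f"
  using schwartz_differentiable[OF assms]
  by (auto intro!: differentiable_imp_continuous_on simp: differentiable_on_def)

lemma schwartz_norm_le:
  assumes "f \<in> schwartz_space"
  shows "norm (f x) * (1 + (norm x)\<^sup>2) ^ N \<le> seminorm (2 * N) [] f"
proof -
  have "(1 + (norm x)\<^sup>2) ^ N \<le> ((1 + norm x)\<^sup>2) ^ N"
    by (intro power_mono) (auto simp: power2_eq_square algebra_simps)
  then have "norm (f x) * (1 + (norm x)\<^sup>2) ^ N \<le> norm (f x) * (1 + norm x) ^ (2 * N)"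
    by (intro mult_left_mono) (auto simp: power_mult)
  also have "\<dots> \<le> seminorm (2 * N) [] f"
    using le_seminorm[OF assms, of "[]" x "2 * N"] by (simp add: mult.commute)
  finally show ?thesis .
qed

lemma schwartz_rapid: "f \<in> schwartz_space \<Longrightarrow> rapid f"
  using schwartz_norm_le schwartz_continuous unfolding rapid_def by blast

lemma partials_lincomb:
  assumes f: "f \<in> schwartz_space" and g: "g \<in> schwartz_space" and "bs \<in> lists Basis"
  shows "partials bs (\<lambda>x. a * f x + c * g x) = (\<lambda>x. a * partials bs f x + c * partials bs g x)"
  using \<open>bs \<in> lists Basis\<close>
proof (induction bs)
  case (Cons b bs)
  then have "bs \<in> lists Basis" by auto
  have "partials (b # bs) (\<lambda>x. a * f x + c * g x) x = a * partials (b # bs) f x + c * partials (b # bs) g x" for x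
    unfolding partials_Cons Cons.IH
    by (rule partial_deriv_eqI)
       (intro has_vector_derivative_add has_vector_derivative_mult_right has_partial_deriv
          schwartzD(1)[OF f \<open>bs \<in> lists Basis\<close>] schwartzD(1)[OF g \<open>bs \<in> lists Basis\<close>])
  then show ?case by (rule ext)
qed simp

lemma schwartz_lincomb_bound:
  assumes "f \<in> schwartz_space" "g \<in> schwartz_space" "bs \<in> lists Basis"
  shows "(1 + norm x) ^ N * cmod (partials bs (\<lambda>x. a * f x + c * g x) x)
    \<le> norm a * seminorm N bs f + norm c * seminorm N bs g"
proof -
  have "(1 + norm x) ^ N * cmod (a * partials bs f x + c * partials bs g x)
      \<le> (1 + norm x) ^ N * (norm a * cmod (partials bs f x) + norm c * cmod (partials bs g x))"
    by (intro mult_left_mono order_trans[OF norm_triangle_ineq]) (auto simp: norm_mult)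
  also have "\<dots> = norm a * ((1 + norm x) ^ N * cmod (partials bs f x)) + norm c * ((1 + norm x) ^ N * cmod (partials bs g x))"
    by (simp add: algebra_simps)
  also have "\<dots> \<le> norm a * seminorm N bs f + norm c * seminorm N bs g"
    using assms by (intro add_mono mult_left_mono le_seminorm) auto
  finally show ?thesis
    using assms by (simp add: partials_lincomb)
qed

lemma schwartz_lincomb:
  assumes "f \<in> schwartz_space" "g \<in> schwartz_space"
  shows "(\<lambda>x. a * f x + c * g x) \<in> schwartz_space"
proof (rule schwartzI)
  fix bs :: "'a list" assume "bs \<in> lists Basis"
  then show "partials bs (\<lambda>x. a * f x + c * g x) differentiable (at x)" for x
    using assms by (simp add: partials_lincomb schwartzD(1))
  show "\<exists>B. \<forall>x. (1 + norm x) ^ N * cmod (partials bs (\<lambda>x. a * f x + c * g x) x) \<le> B" for N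
    using schwartz_lincomb_bound[OF assms \<open>bs \<in> lists Basis\<close>] by blast
qed

lemma seminorm_lincomb:
  assumes "f \<in> schwartz_space" "g \<in> schwartz_space" "bs \<in> lists Basis"
  shows "seminorm N bs (\<lambda>x. a * f x + c * g x) \<le> norm a * seminorm N bs f + norm c * seminorm N bs g"
  by (rule seminorm_le) (rule schwartz_lincomb_bound[OF assms])

lemma schwartz_zero: "(\<lambda>x. 0) \<in> schwartz_space"
proof -
  have "partials bs (\<lambda>x::'a. 0) = (\<lambda>x. 0)" if "bs \<in> lists Basis" for bs
    using that by (induction bs) (auto simp: partials_Cons partial_deriv_def fun_eq_iff)
  then show ?thesis
    by (intro schwartzI) auto
qed

lemma schwartz_add: "f \<in> schwartz_space \<Longrightarrow> g \<in> schwartz_space \<Longrightarrow> (\<lambda>x. f x + g x) \<in> schwartz_space"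
  and schwartz_diff: "f \<in> schwartz_space \<Longrightarrow> g \<in> schwartz_space \<Longrightarrow> (\<lambda>x. f x - g x) \<in> schwartz_space"
  and schwartz_cmult: "f \<in> schwartz_space \<Longrightarrow> (\<lambda>x. c * f x) \<in> schwartz_space"
  using schwartz_lincomb[of f g 1 1] schwartz_lincomb[of f g 1 "-1"] schwartz_lincomb[of f f c 0]
  by simp_all

lemma schwartz_sum:
  "(\<And>i. i \<in> I \<Longrightarrow> f i \<in> schwartz_space) \<Longrightarrow> (\<lambda>x. \<Sum>i\<in>I. f i x) \<in> schwartz_space"
  by (induction I rule: infinite_finite_induct) (auto intro: schwartz_zero schwartz_add)

subsection \<open>Continuity of operators, in terms of seminorms\<close>

text \<open>The usual criterion for continuity at 0, stated for any real-valued \<open>p\<close> so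
  that estimates can be combined before a topology is involved. The sign condition on
  \<open>C\<close> allows the index set to be enlarged.\<close>

definition dominated :: "(('a::euclidean_space \<Rightarrow> complex) \<Rightarrow> real) \<Rightarrow> bool" where
  "dominated p \<longleftrightarrow> (\<exists>C F. C \<ge> 0 \<and> finite F \<and> F \<subseteq> UNIV \<times> lists Basis \<and>
     (\<forall>f\<in>schwartz_space. p f \<le> C * (\<Sum>(N, bs)\<in>F. seminorm N bs f)))"

lemma dominated_seminorm:
  "bs \<in> lists Basis \<Longrightarrow> dominated (seminorm N bs)"
  unfolding dominated_def by (rule exI[of _ 1], rule exI[of _ "{(N, bs)}"]) auto

lemma dominated_mono:
  assumes "dominated q" "\<And>f. f \<in> schwartz_space \<Longrightarrow> p f \<le> q f"
  shows "dominated p"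
  using assms unfolding dominated_def by (meson order_trans)

lemma dominated_add:
  assumes "dominated p" "dominated q"
  shows "dominated (\<lambda>f. p f + q f)"
proof -
  obtain C F D G where F: "C \<ge> 0" "finite F" "F \<subseteq> UNIV \<times> lists Basis"
      "\<And>f. f \<in> schwartz_space \<Longrightarrow> p f \<le> C * (\<Sum>(N, bs)\<in>F. seminorm N bs f)"
    and G: "D \<ge> 0" "finite G" "G \<subseteq> UNIV \<times> lists Basis"
      "\<And>f. f \<in> schwartz_space \<Longrightarrow> q f \<le> D * (\<Sum>(N, bs)\<in>G. seminorm N bs f)"
    using assms unfolding dominated_def by metis
  show ?thesis
    unfolding dominated_def
  proof (intro exI[of _ "C + D"] exI[of _ "F \<union> G"] conjI ballI)
    fix f :: "'a \<Rightarrow> complex" assume f: "f \<in> schwartz_space"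
    let ?s = "\<lambda>F. \<Sum>(N, bs)\<in>F. seminorm N bs f"
    have nn: "0 \<le> (case i of (N, bs) \<Rightarrow> seminorm N bs f)" if "i \<in> UNIV \<times> lists Basis" for i
      using that f by (auto intro: seminorm_nonneg)
    have "finite (F \<union> G)" "F \<union> G \<subseteq> UNIV \<times> lists Basis"
      using F(2,3) G(2,3) by auto
    then have "?s F \<le> ?s (F \<union> G)" "?s G \<le> ?s (F \<union> G)"
      by (intro sum_mono2 nn; blast)+
    then have "C * ?s F + D * ?s G \<le> C * ?s (F \<union> G) + D * ?s (F \<union> G)"
      using F G by (intro add_mono mult_left_mono)
    then show "p f + q f \<le> (C + D) * ?s (F \<union> G)"
      using F(4)[OF f] G(4)[OF f] unfolding distrib_right by linarith
  next
    show "0 \<le> C + D" "finite (F \<union> G)" "F \<union> G \<subseteq> UNIV \<times> lists Basis"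
      using F(1,2,3) G(1,2,3) by auto
  qed
qed

lemma dominated_scale:
  assumes "dominated p" "c \<ge> 0"
  shows "dominated (\<lambda>f. c * p f)"
proof -
  obtain C F where F: "C \<ge> 0" "finite F" "F \<subseteq> UNIV \<times> lists Basis"
      "\<And>f. f \<in> schwartz_space \<Longrightarrow> p f \<le> C * (\<Sum>(N, bs)\<in>F. seminorm N bs f)"
    using assms unfolding dominated_def by metis
  then have "c * p f \<le> (c * C) * (\<Sum>(N, bs)\<in>F. seminorm N bs f)" if "f \<in> schwartz_space" for f
    using mult_left_mono[OF F(4)[OF that] \<open>c \<ge> 0\<close>] by (simp only: mult.assoc)
  then show ?thesis
    unfolding dominated_def using \<open>c \<ge> 0\<close> F(1-3)
    by (intro exI[of _ "c * C"] exI[of _ F]) simp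
qed

lemma dominated_zero: "dominated (\<lambda>f. 0)"
  unfolding dominated_def by (rule exI[of _ 0], rule exI[of _ "{}"]) auto

lemma dominated_sum:
  "(\<And>i. i \<in> I \<Longrightarrow> dominated (p i)) \<Longrightarrow> dominated (\<lambda>f. \<Sum>i\<in>I. p i f)"
  by (induction I rule: infinite_finite_induct) (auto intro: dominated_zero dominated_add)

definition schwartz_op :: "(('a::euclidean_space \<Rightarrow> complex) \<Rightarrow> 'a \<Rightarrow> complex) \<Rightarrow> bool" where
  "schwartz_op T \<longleftrightarrow> (\<forall>f\<in>schwartz_space. T f \<in> schwartz_space) \<and>
     (\<forall>N. \<forall>bs\<in>lists Basis. dominated (\<lambda>f. seminorm N bs (T f)))"

lemma dominated_comp:
  assumes p: "dominated p" and T: "schwartz_op T"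
  shows "dominated (\<lambda>f. p (T f))"
proof -
  obtain C F where F: "C \<ge> 0" "finite F" "F \<subseteq> UNIV \<times> lists Basis"
      "\<And>f. f \<in> schwartz_space \<Longrightarrow> p f \<le> C * (\<Sum>(N, bs)\<in>F. seminorm N bs f)"
    using p unfolding dominated_def by metis
  have "dominated (\<lambda>f. C * (\<Sum>i\<in>F. (case i of (N, bs) \<Rightarrow> seminorm N bs (T f))))"
  proof (intro dominated_scale dominated_sum)
    fix i assume "i \<in> F"
    then obtain N bs where "i = (N, bs)" "bs \<in> lists Basis"
      using F(3) by blast
    then show "dominated (\<lambda>f. case i of (N, bs) \<Rightarrow> seminorm N bs (T f))"
      using T by (simp add: schwartz_op_def)
  qed (rule F)
  then show ?thesis
    by (rule dominated_mono) (use F T in \<open>auto simp: schwartz_op_def\<close>)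
qed

lemma schwartz_opD: "schwartz_op T \<Longrightarrow> f \<in> schwartz_space \<Longrightarrow> T f \<in> schwartz_space"
  by (simp add: schwartz_op_def)

lemma schwartz_op_id: "schwartz_op (\<lambda>f. f)"
  by (simp add: schwartz_op_def dominated_seminorm)

lemma schwartz_op_comp: "schwartz_op S \<Longrightarrow> schwartz_op T \<Longrightarrow> schwartz_op (\<lambda>f. S (T f))"
  unfolding schwartz_op_def[of "\<lambda>f. S (T f)"]
  by (auto intro: schwartz_opD dominated_comp[of "\<lambda>f. seminorm _ _ (S f)" T] simp: schwartz_op_def[of S])

lemma schwartz_op_lincomb:
  assumes S: "schwartz_op S" and T: "schwartz_op T"
  shows "schwartz_op (\<lambda>f x. a * S f x + c * T f x)"
  unfolding schwartz_op_def
proof (intro conjI ballI allI)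
  fix N and bs :: "'a list" assume bs: "bs \<in> lists Basis"
  have "dominated (\<lambda>f. norm a * seminorm N bs (S f) + norm c * seminorm N bs (T f))"
    using S T bs by (intro dominated_add dominated_scale) (auto simp: schwartz_op_def)
  then show "dominated (\<lambda>f. seminorm N bs (\<lambda>x. a * S f x + c * T f x))"
    by (rule dominated_mono) (rule seminorm_lincomb[OF schwartz_opD[OF S] schwartz_opD[OF T] bs])
qed (rule schwartz_lincomb[OF schwartz_opD[OF S] schwartz_opD[OF T]])

lemma schwartz_op_partial_deriv:
  assumes "b \<in> Basis"
  shows "schwartz_op (partial_deriv b)"
  unfolding schwartz_op_def
proof (intro conjI ballI allI)
  fix N and bs :: "'a list" assume "bs \<in> lists Basis"
  then have "dominated (seminorm N (bs @ [b]))"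
    using assms by (intro dominated_seminorm) auto
  then show "dominated (\<lambda>f. seminorm N bs (partial_deriv b f))"
    by (simp add: seminorm_def[abs_def] partials_snoc)
qed (intro schwartz_partial_deriv assms)

text \<open>The list \<open>L\<close> collects the lower order terms of the Leibniz rule.\<close>

lemma partials_mult_coordinate:
  fixes a :: "'a::euclidean_space"
  assumes a: "a \<in> Basis" and "bs \<in> lists Basis"
  shows "\<exists>L. set L \<subseteq> lists Basis \<and> (\<forall>f\<in>schwartz_space.
    partials bs (\<lambda>x. of_real (x \<bullet> a) * f x) =
      (\<lambda>x. of_real (x \<bullet> a) * partials bs f x + (\<Sum>cs\<leftarrow>L. partials cs f x)))"
  using \<open>bs \<in> lists Basis\<close>
proof (induction bs)
  case Nil
  show ?case by (rule exI[of _ "[]"]) simp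
next
  case (Cons b bs)
  then have b: "b \<in> Basis" and bs: "bs \<in> lists Basis" by auto
  then obtain L where L: "set L \<subseteq> lists Basis" "\<And>f. f \<in> schwartz_space \<Longrightarrow>
    partials bs (\<lambda>x. of_real (x \<bullet> a) * f x) =
      (\<lambda>x. of_real (x \<bullet> a) * partials bs f x + (\<Sum>cs\<leftarrow>L. partials cs f x))"
    using Cons.IH by blast
  let ?L = "map ((#) b) L @ (if b = a then [bs] else [])"
  show ?case
  proof (intro exI conjI ballI ext)
    show "set ?L \<subseteq> lists Basis"
      using L(1) b bs by (fastforce dest: subsetD)
    fix f :: "'a \<Rightarrow> complex" and x assume f: "f \<in> schwartz_space"
    have lin: "((\<lambda>s. complex_of_real ((x + s *\<^sub>R b) \<bullet> a)) has_vector_derivative of_bool (b = a)) (at 0)"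
      using a b by (auto intro!: derivative_eq_intros simp: inner_add_left inner_Basis has_vector_derivative_def scaleR_conv_of_real)
    have "((\<lambda>s. \<Sum>cs\<leftarrow>L. partials cs f (x + s *\<^sub>R b)) has_vector_derivative
        (\<Sum>cs\<leftarrow>L. partials (b # cs) f x)) (at 0)"
      using L(1)
    proof (induction L)
      case (Cons cs L)
      then show ?case
        using has_partial_deriv[OF schwartzD(1)[OF f, of cs x], of b]
        by (auto simp: partials_Cons intro!: has_vector_derivative_add)
    qed simp
    note D = has_vector_derivative_add[OF has_vector_derivative_mult[OF lin
          has_partial_deriv[OF schwartzD(1)[OF f bs, of x], of b]] this]
    show "partials (b # bs) (\<lambda>x. of_real (x \<bullet> a) * f x) x =
        of_real (x \<bullet> a) * partials (b # bs) f x + (\<Sum>cs\<leftarrow>?L. partials cs f x)"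
      unfolding partials_Cons[of b bs] L(2)[OF f]
      by (rule partial_deriv_eqI[OF has_vector_derivative_eq_rhs[OF D]])
         (auto simp: partials_Cons o_def)
  qed
qed

text \<open>The coordinate costs one power of the weight, hence \<open>Suc N\<close> in the bound;
  the commutators with the derivatives are the lower order terms in \<open>L\<close>.\<close>

lemma schwartz_op_mult_coordinate:
  fixes a :: "'a::euclidean_space"
  assumes a: "a \<in> Basis"
  shows "schwartz_op (\<lambda>f x. of_real (x \<bullet> a) * f x)"
proof -
  have *: "(\<forall>f\<in>schwartz_space. \<forall>x. partials bs (\<lambda>x. of_real (x \<bullet> a) * f x) differentiable (at x)) \<and>
     (\<exists>q. dominated q \<and> (\<forall>f\<in>schwartz_space. \<forall>x.
        (1 + norm x) ^ N * cmod (partials bs (\<lambda>x. of_real (x \<bullet> a) * f x) x) \<le> q f))"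
    if bs: "bs \<in> lists Basis" for bs N
  proof -
    obtain L where L: "set L \<subseteq> lists Basis" "\<And>f. f \<in> schwartz_space \<Longrightarrow>
      partials bs (\<lambda>x. of_real (x \<bullet> a) * f x) =
        (\<lambda>x. of_real (x \<bullet> a) * partials bs f x + (\<Sum>cs\<leftarrow>L. partials cs f x))"
      using partials_mult_coordinate[OF a bs] by blast
    have d: "(\<lambda>x. \<Sum>cs\<leftarrow>L. partials cs f x) differentiable (at x)" if "f \<in> schwartz_space" for f x
      using L(1) by (induction L) (auto intro!: derivative_intros schwartzD(1)[OF that])
    have i: "(\<lambda>x. complex_of_real (x \<bullet> a)) differentiable (at x)" for x
      by (auto simp: differentiable_def intro!: derivative_intros exI)
    have e: "dominated (\<lambda>f. \<Sum>cs\<leftarrow>L. seminorm N cs f)"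
      using L(1) by (induction L) (auto intro: dominated_zero dominated_add dominated_seminorm)
    have n: "(1 + norm x) ^ N * cmod (\<Sum>cs\<leftarrow>L. partials cs f x) \<le> (\<Sum>cs\<leftarrow>L. seminorm N cs f)"
      if "f \<in> schwartz_space" for f x
      using L(1)
    proof (induction L)
      case (Cons cs L)
      have "(1 + norm x) ^ N * cmod (partials cs f x + (\<Sum>cs\<leftarrow>L. partials cs f x))
          \<le> (1 + norm x) ^ N * (cmod (partials cs f x) + cmod (\<Sum>cs\<leftarrow>L. partials cs f x))"
        by (intro mult_left_mono norm_triangle_ineq) simp
      then show ?case
        using Cons le_seminorm[OF that, of cs x N] by (auto simp: distrib_left)
    qed simp
    have "(1 + norm x) ^ N * cmod (of_real (x \<bullet> a) * partials bs f x + (\<Sum>cs\<leftarrow>L. partials cs f x))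
        \<le> seminorm (Suc N) bs f + (\<Sum>cs\<leftarrow>L. seminorm N cs f)" if f: "f \<in> schwartz_space" for f x
    proof -
      have "(1 + norm x) ^ N * cmod (of_real (x \<bullet> a) * partials bs f x) \<le> (1 + norm x) ^ N * ((1 + norm x) * cmod (partials bs f x))"
        using Basis_le_norm[OF a, of x] by (intro mult_left_mono) (auto simp: norm_mult intro!: mult_right_mono)
      also have "\<dots> \<le> seminorm (Suc N) bs f"
        using le_seminorm[OF f bs, of x "Suc N"] by (simp add: mult_ac)
      finally have 1: "(1 + norm x) ^ N * cmod (of_real (x \<bullet> a) * partials bs f x) \<le> seminorm (Suc N) bs f" .
      have "(1 + norm x) ^ N * cmod (of_real (x \<bullet> a) * partials bs f x + (\<Sum>cs\<leftarrow>L. partials cs f x))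
        \<le> (1 + norm x) ^ N * (cmod (of_real (x \<bullet> a) * partials bs f x) + cmod (\<Sum>cs\<leftarrow>L. partials cs f x))"
        by (intro mult_left_mono norm_triangle_ineq) simp
      with 1 n[OF f, of x] show ?thesis
        by (simp add: distrib_left)
    qed
    moreover have "dominated (\<lambda>f. seminorm (Suc N) bs f + (\<Sum>cs\<leftarrow>L. seminorm N cs f))"
      by (intro dominated_add e dominated_seminorm bs)
    ultimately show ?thesis
      using d i schwartzD(1)[OF _ bs] by (auto simp: L(2) intro!: derivative_intros)
  qed
  show ?thesis
    unfolding schwartz_op_def
  proof (intro conjI ballI allI)
    show "(\<lambda>x. of_real (x \<bullet> a) * f x) \<in> schwartz_space" if "f \<in> schwartz_space" for f
      by (rule schwartzI) (use * that in blast)+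
    show "dominated (\<lambda>f. seminorm N bs (\<lambda>x. of_real (x \<bullet> a) * f x))" if bs: "bs \<in> lists Basis" for N bs
    proof -
      obtain q where "dominated q" and q: "\<And>f x. f \<in> schwartz_space \<Longrightarrow>
          (1 + norm x) ^ N * cmod (partials bs (\<lambda>x. of_real (x \<bullet> a) * f x) x) \<le> q f"
        using *[OF bs, of N] by blast
      then show ?thesis
        by (intro dominated_mono[OF \<open>dominated q\<close>] seminorm_le)
    qed
  qed
qed

section \<open>The Fourier transform of Schwartz functions\<close>

text \<open>The mean value inequality on a symmetric interval treats both signs of \<open>s\<close>
  at once. It supplies the increment estimates for differentiation under the integral.\<close>

lemma norm_increment_le:
  fixes g :: "real \<Rightarrow> 'a::real_normed_vector"
  assumes "\<And>r. \<bar>r\<bar> \<le> \<bar>s\<bar> \<Longrightarrow> (g has_vector_derivative g' r) (at r)"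
    and "\<And>r. \<bar>r\<bar> \<le> \<bar>s\<bar> \<Longrightarrow> norm (g' r) \<le> B"
  shows "norm (g s - g 0) \<le> \<bar>s\<bar> * B"
proof -
  have "norm (g s - g 0) \<le> B * norm (s - 0)"
  proof (rule differentiable_bound[where S="{-\<bar>s\<bar>..\<bar>s\<bar>}" and f'="\<lambda>r h. h *\<^sub>R g' r"])
    fix r assume "r \<in> {-\<bar>s\<bar>..\<bar>s\<bar>}"
    then have r: "\<bar>r\<bar> \<le> \<bar>s\<bar>" by auto
    show "(g has_derivative (\<lambda>h. h *\<^sub>R g' r)) (at r within {-\<bar>s\<bar>..\<bar>s\<bar>})"
      using assms(1)[OF r] by (simp add: has_vector_derivative_def has_derivative_at_withinI)
    show "onorm (\<lambda>h. h *\<^sub>R g' r) \<le> B"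
      using assms(2)[OF r] by (intro onorm_bound order_trans[OF norm_ge_zero assms(2)[OF r]])
        (simp add: mult.commute[of B] mult_left_mono)
  qed auto
  then show ?thesis
    by (simp add: mult.commute)
qed

text \<open>No integration by parts: the transform of a translate is known exactly, and its
  derivative in the shift is computed once from that formula and once under the integral.\<close>

lemma fourier_partial_deriv:
  fixes f :: "'a::euclidean_space \<Rightarrow> complex"
  assumes f: "f \<in> schwartz_space" and b: "b \<in> Basis"
  shows "fourier (partial_deriv b f) \<xi> = \<i> * of_real (\<xi> \<bullet> b) * fourier f \<xi>"
proof -
  note f' = schwartz_partial_deriv[OF f b]
  note [measurable] = rapidD(2)[OF schwartz_rapid[OF f]] rapidD(2)[OF schwartz_rapid[OF f']]
  let ?F = "\<lambda>s x. f (x + s *\<^sub>R b) * exp (- (\<i> * of_real (\<xi> \<bullet> x)))"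
  obtain C where C: "\<And>x. norm (partial_deriv b f x) * (1 + (norm x)\<^sup>2) ^ DIM('a) \<le> C"
    using rapidD(3)[OF schwartz_rapid[OF f']] by blast
  have C0: "C \<ge> 0"
    using C[of 0] by (simp add: order_trans[OF norm_ge_zero])
  \<comment> \<open>Origin of the factor 3: with \<open>a\<close>, \<open>b\<close> the squared
    norms of \<open>x\<close>, \<open>y\<close> and \<open>c\<close> the norm of \<open>y\<close>,
    the bound \<open>2 * c \<le> b + 1\<close> turns the first premise into
    \<open>1 + a \<le> 2 * b + 3\<close>.\<close>
  have lin: "a \<le> b + 1 + 2 * c \<Longrightarrow> 0 \<le> b + 1 - 2 * c \<Longrightarrow> 0 \<le> b \<Longrightarrow> 1 + a \<le> 3 * (1 + b)" for a b c :: real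
    by argo
  \<comment> \<open>Moving a point by at most 1 changes the weight by a bounded factor, so a single
    integrable function bounds the derivative along the whole segment.\<close>
  have near: "norm (partial_deriv b f y) \<le> 3 ^ DIM('a) * C * (1 / (1 + (norm x)\<^sup>2) ^ DIM('a))"
    if "norm (x - y) \<le> 1" for x y
  proof -
    have "norm x \<le> norm y + 1"
      using that norm_triangle_ineq2[of x y] by linarith
    then have "(norm x)\<^sup>2 \<le> (norm y + 1)\<^sup>2"
      by (intro power_mono) auto
    moreover have "0 \<le> (norm y - 1)\<^sup>2" "0 \<le> (norm y)\<^sup>2"
      by simp_all
    ultimately have "1 + (norm x)\<^sup>2 \<le> 3 * (1 + (norm y)\<^sup>2)"
      using lin[of "(norm x)\<^sup>2" "(norm y)\<^sup>2" "norm y"] unfolding power2_sum power2_diff by simp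
    then have "(1 + (norm x)\<^sup>2) ^ DIM('a) \<le> (3 * (1 + (norm y)\<^sup>2)) ^ DIM('a)"
      by (intro power_mono) auto
    then have "norm (partial_deriv b f y) * (1 + (norm x)\<^sup>2) ^ DIM('a)
        \<le> norm (partial_deriv b f y) * (3 * (1 + (norm y)\<^sup>2)) ^ DIM('a)"
      by (intro mult_left_mono) auto
    also have "\<dots> \<le> 3 ^ DIM('a) * C"
      using mult_left_mono[OF C[of y], of "3 ^ DIM('a)"] unfolding power_mult_distrib by (simp add: mult_ac)
    finally show ?thesis
      by (simp add: pos_le_divide_eq zero_less_power add_pos_nonneg)
  qed
  have "((\<lambda>s. \<integral>x. ?F s x \<partial>lborel) has_vector_derivative
      (\<integral>x. partial_deriv b f x * exp (- (\<i> * of_real (\<xi> \<bullet> x))) \<partial>lborel)) (at 0)"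
  proof (rule has_vector_derivative_integral_param)
    show "integrable lborel (?F s)" for s
      using integrable_lborel_affine[OF rapid_integrable[OF schwartz_rapid[OF f]], of 1 "s *\<^sub>R b"]
      by (intro integrable_fourier_kernel) (simp add: add.commute)
    show "((\<lambda>s. ?F s x) has_vector_derivative partial_deriv b f x * exp (- (\<i> * of_real (\<xi> \<bullet> x)))) (at 0)" for x
      by (intro has_vector_derivative_mult_left has_partial_deriv schwartz_differentiable f)
    show "norm (?F s x - ?F 0 x) \<le> \<bar>s\<bar> * (3 ^ DIM('a) * C * (1 / (1 + (norm x)\<^sup>2) ^ DIM('a)))" if "\<bar>s\<bar> \<le> 1" for s x
    proof -
      have "norm (f (x + s *\<^sub>R b) - f (x + 0 *\<^sub>R b)) \<le> \<bar>s\<bar> * (3 ^ DIM('a) * C * (1 / (1 + (norm x)\<^sup>2) ^ DIM('a)))"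
      proof (rule norm_increment_le)
        show "((\<lambda>s. f (x + s *\<^sub>R b)) has_vector_derivative partial_deriv b f (x + r *\<^sub>R b)) (at r)" for r
          by (intro has_partial_deriv_at schwartz_differentiable f)
        show "norm (partial_deriv b f (x + r *\<^sub>R b)) \<le> 3 ^ DIM('a) * C * (1 / (1 + (norm x)\<^sup>2) ^ DIM('a))"
          if "\<bar>r\<bar> \<le> \<bar>s\<bar>" for r
          using that \<open>\<bar>s\<bar> \<le> 1\<close> b by (intro near) simp
      qed
      moreover have "?F s x - ?F 0 x = (f (x + s *\<^sub>R b) - f (x + 0 *\<^sub>R b)) * exp (- (\<i> * of_real (\<xi> \<bullet> x)))"
        by (simp add: left_diff_distrib)
      ultimately show ?thesis
        by (simp only: norm_fourier_kernel(1)[of "\<lambda>_. f (x + s *\<^sub>R b) - f (x + 0 *\<^sub>R b)"])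
    qed
    show "integrable lborel (\<lambda>x::'a. 3 ^ DIM('a) * C * (1 / (1 + (norm x)\<^sup>2) ^ DIM('a)))"
      by (intro integrable_mult_right integrable_inverse_weight)
  qed measurable
  moreover have "(\<integral>x. ?F s x \<partial>lborel) = fourier f \<xi> * exp (\<i> * of_real (\<xi> \<bullet> (s *\<^sub>R b)))" for s
    using fourier_translate[of f "s *\<^sub>R b" \<xi>] by (simp add: fourier_def)
  ultimately have "((\<lambda>s. fourier f \<xi> * exp (\<i> * of_real (\<xi> \<bullet> (s *\<^sub>R b)))) has_vector_derivative
      fourier (partial_deriv b f) \<xi>) (at 0)"
    by (simp add: fourier_def[of "partial_deriv b f"])
  moreover have "((\<lambda>s. fourier f \<xi> * exp (\<i> * of_real (\<xi> \<bullet> (s *\<^sub>R b)))) has_vector_derivative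
      fourier f \<xi> * (\<i> * of_real (\<xi> \<bullet> b))) (at 0)"
  proof -
    have "((\<lambda>z. fourier f \<xi> * exp (\<i> * (z * of_real (\<xi> \<bullet> b)))) has_field_derivative
        fourier f \<xi> * (\<i> * of_real (\<xi> \<bullet> b))) (at (of_real 0))"
      by (auto intro!: derivative_eq_intros)
    from has_vector_derivative_real_field[OF this] show ?thesis
      by simp
  qed
  ultimately show ?thesis
    using vector_derivative_unique_at by (metis mult.commute)
qed

text \<open>The sign makes the symbol \<open>(norm \<xi>)\<^sup>2\<close>. It is spelled as a
  product with \<open>- 1\<close> so that the rules for scalar multiples apply.\<close>

definition neg_laplacian :: "('a::euclidean_space \<Rightarrow> complex) \<Rightarrow> 'a \<Rightarrow> complex" where
  "neg_laplacian f x = - 1 * (\<Sum>b\<in>Basis. partial_deriv b (partial_deriv b f) x)"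

lemma neg_laplacian_schwartz: "f \<in> schwartz_space \<Longrightarrow> neg_laplacian f \<in> schwartz_space"
  unfolding neg_laplacian_def[abs_def]
  by (intro schwartz_cmult schwartz_sum schwartz_partial_deriv)

lemma fourier_sum:
  "(\<And>i. i \<in> I \<Longrightarrow> integrable lborel (f i)) \<Longrightarrow>
    fourier (\<lambda>x. \<Sum>i\<in>I. f i x) \<xi> = (\<Sum>i\<in>I. fourier (f i) \<xi>)"
  by (induction I rule: infinite_finite_induct) (auto simp: fourier_add)

lemma schwartz_integrable: "f \<in> schwartz_space \<Longrightarrow> integrable lborel f"
  by (intro rapid_integrable schwartz_rapid)

lemma fourier_neg_laplacian:
  fixes f :: "'a::euclidean_space \<Rightarrow> complex"
  assumes f: "f \<in> schwartz_space"
  shows "fourier (neg_laplacian f) \<xi> = of_real ((norm \<xi>)\<^sup>2) * fourier f \<xi>"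
proof -
  have ii: "\<i> * z * (\<i> * z * w) = - (z * z * w)" for z w
  proof -
    have "\<i> * z * (\<i> * z * w) = (\<i> * \<i>) * (z * z * w)"
      by (simp only: mult_ac)
    then show ?thesis by simp
  qed
  have "fourier (neg_laplacian f) \<xi> = - 1 * (\<Sum>b\<in>Basis. fourier (partial_deriv b (partial_deriv b f)) \<xi>)"
    unfolding neg_laplacian_def[abs_def] fourier_cmult
    by (subst fourier_sum) (auto intro!: schwartz_integrable schwartz_partial_deriv f)
  also have "\<dots> = - 1 * (\<Sum>b\<in>Basis. - of_real ((\<xi> \<bullet> b)\<^sup>2) * fourier f \<xi>)"
    using f by (intro arg_cong2[where f="(*)"] sum.cong refl)
      (simp add: fourier_partial_deriv schwartz_partial_deriv power2_eq_square ii)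
  also have "\<dots> = of_real ((norm \<xi>)\<^sup>2) * fourier f \<xi>"
    by (simp add: norm_sq_Basis sum_negf sum_distrib_right)
  finally show ?thesis .
qed

lemma norm_power_fourier:
  assumes "f \<in> schwartz_space"
  shows "\<exists>g\<in>schwartz_space. \<forall>\<xi>. fourier g \<xi> = of_real (norm \<xi> ^ (2 * j)) * fourier f \<xi>"
proof (induction j)
  case 0
  then show ?case using assms by auto
next
  case (Suc j)
  then obtain g where "g \<in> schwartz_space" "\<And>\<xi>. fourier g \<xi> = of_real (norm \<xi> ^ (2 * j)) * fourier f \<xi>"
    by blast
  then show ?case
    by (intro bexI[of _ "neg_laplacian g"])
       (simp_all add: neg_laplacian_schwartz fourier_neg_laplacian power2_eq_square mult.assoc)
qed

text \<open>Iterates of the identity plus \<open>neg_laplacian\<close>. They yield the decay of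
  transforms, and later they shift a power of the weight from \<open>fourier \<phi>\<close> to a
  measure, which becomes finite in this way.\<close>

lemma weight_fourier:
  assumes "f \<in> schwartz_space"
  shows "\<exists>g\<in>schwartz_space. \<forall>\<xi>. fourier g \<xi> = of_real ((1 + (norm \<xi>)\<^sup>2) ^ j) * fourier f \<xi>"
proof (induction j)
  case 0
  then show ?case using assms by auto
next
  case (Suc j)
  then obtain g where g: "g \<in> schwartz_space" "\<And>\<xi>. fourier g \<xi> = of_real ((1 + (norm \<xi>)\<^sup>2) ^ j) * fourier f \<xi>"
    by blast
  have "fourier (\<lambda>x. g x + neg_laplacian g x) \<xi> = of_real ((1 + (norm \<xi>)\<^sup>2) ^ Suc j) * fourier f \<xi>" for \<xi>
    using g by (simp add: fourier_add schwartz_integrable neg_laplacian_schwartz fourier_neg_laplacian algebra_simps)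
  then show ?case
    using g(1) by (intro bexI[of _ "\<lambda>x. g x + neg_laplacian g x"] schwartz_add neg_laplacian_schwartz) auto
qed

text \<open>A transform is bounded by an L1 norm; this is applied to the function whose transform
  carries the weight.\<close>

lemma fourier_rapid:
  assumes "f \<in> schwartz_space"
  shows "rapid (fourier f)"
  unfolding rapid_def
proof (intro conjI allI)
  fix N
  obtain g where g: "g \<in> schwartz_space" "\<And>\<xi>. fourier g \<xi> = of_real ((1 + (norm \<xi>)\<^sup>2) ^ N) * fourier f \<xi>"
    using weight_fourier[OF assms, of N] by blast
  have "norm (fourier f \<xi>) * (1 + (norm \<xi>)\<^sup>2) ^ N \<le> (\<integral>x. norm (g x) \<partial>lborel)" for \<xi>
  proof -
    have "norm (fourier f \<xi>) * (1 + (norm \<xi>)\<^sup>2) ^ N = norm (fourier g \<xi>)"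
      unfolding g(2) norm_mult norm_of_real by simp
    then show ?thesis
      using norm_fourier_le[of g \<xi>] by simp
  qed
  then show "\<exists>C. \<forall>\<xi>. norm (fourier f \<xi>) * (1 + (norm \<xi>)\<^sup>2) ^ N \<le> C"
    by blast
qed (intro continuous_on_fourier schwartz_integrable assms)

text \<open>Continuity and polynomial growth are what survives when \<open>L_rad\<close> is composed
  with the norm.\<close>

definition poly_bounded :: "('a::euclidean_space \<Rightarrow> complex) \<Rightarrow> bool" where
  "poly_bounded m \<longleftrightarrow> continuous_on UNIV m \<and> (\<exists>C M. \<forall>x. norm (m x) \<le> C * (1 + (norm x)\<^sup>2) ^ M)"

lemma rapid_mult:
  assumes m: "poly_bounded m" and g: "rapid g"
  shows "rapid (\<lambda>x. m x * g x)"
  unfolding rapid_def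
proof (intro conjI allI)
  fix N
  obtain C M where C: "\<And>x. norm (m x) \<le> C * (1 + (norm x)\<^sup>2) ^ M"
    using m by (auto simp: poly_bounded_def)
  obtain D where D: "\<And>x. norm (g x) * (1 + (norm x)\<^sup>2) ^ (M + N) \<le> D"
    using rapidD(3)[OF g] by blast
  have "0 \<le> C"
    using C[of 0] by (simp add: order_trans[OF norm_ge_zero])
  have "norm (m x * g x) * (1 + (norm x)\<^sup>2) ^ N \<le> C * D" for x
  proof -
    have "norm (m x * g x) * (1 + (norm x)\<^sup>2) ^ N \<le> (C * (1 + (norm x)\<^sup>2) ^ M) * norm (g x) * (1 + (norm x)\<^sup>2) ^ N"
      unfolding norm_mult by (intro mult_right_mono C) auto
    also have "\<dots> = C * (norm (g x) * (1 + (norm x)\<^sup>2) ^ (M + N))"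
      by (simp add: power_add mult_ac)
    also have "\<dots> \<le> C * D"
      by (intro mult_left_mono D \<open>0 \<le> C\<close>)
    finally show ?thesis .
  qed
  then show "\<exists>C. \<forall>x. norm (m x * g x) * (1 + (norm x)\<^sup>2) ^ N \<le> C"
    by blast
qed (use m rapidD(1)[OF g] in \<open>auto simp: poly_bounded_def intro!: continuous_intros\<close>)

lemma poly_bounded_mult:
  assumes "poly_bounded m" "poly_bounded n"
  shows "poly_bounded (\<lambda>x. m x * n x)"
proof -
  obtain C M D N where C: "\<And>x. norm (m x) \<le> C * (1 + (norm x)\<^sup>2) ^ M"
    and D: "\<And>x. norm (n x) \<le> D * (1 + (norm x)\<^sup>2) ^ N"
    using assms unfolding poly_bounded_def by metis
  have "norm (m x * n x) \<le> C * D * (1 + (norm x)\<^sup>2) ^ (M + N)" for x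
    using mult_mono[OF C[of x] D[of x] order_trans[OF norm_ge_zero C[of x]] norm_ge_zero]
    by (simp add: norm_mult power_add mult_ac)
  then show ?thesis
    using assms by (auto simp: poly_bounded_def intro!: continuous_intros)
qed

lemma bounded_poly_bounded:
  assumes "continuous_on UNIV u" "bounded (range u)"
  shows "poly_bounded u"
proof -
  obtain B where "\<And>x. norm (u x) \<le> B"
    using assms(2) by (auto simp: bounded_iff)
  then show ?thesis
    unfolding poly_bounded_def by (intro conjI exI[of _ B] exI[of _ 0] assms(1)) simp
qed

lemma schwartz_mult_integrable:
  assumes "\<theta> \<in> schwartz_space" "continuous_on UNIV u" "bounded (range u)"
  shows "integrable lborel (\<lambda>x. \<theta> x * u x)"
  using rapid_integrable[OF rapid_mult[OF bounded_poly_bounded[OF assms(2,3)] schwartz_rapid[OF assms(1)]]]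
  by (simp add: mult.commute)

lemma poly_bounded_const: "poly_bounded (\<lambda>x. c)"
  by (rule bounded_poly_bounded) auto

lemma norm_le_weight: "norm x \<le> 1 + (norm x)\<^sup>2"
proof -
  have "2 * norm x \<le> 1 + (norm x)\<^sup>2"
    using zero_le_power2[of "1 - norm x"] unfolding power2_diff by simp
  then show ?thesis
    using norm_ge_zero[of x] by linarith
qed

lemma poly_bounded_norm_power: "poly_bounded (\<lambda>x. of_real (norm x ^ k))"
  unfolding poly_bounded_def
proof (intro conjI exI allI)
  fix x :: 'a
  show "norm (complex_of_real (norm x ^ k)) \<le> 1 * (1 + (norm x)\<^sup>2) ^ k"
    using norm_le_weight[of x] by (simp add: norm_power power_mono)
qed (auto intro!: continuous_intros)

lemma poly_bounded_inner: "poly_bounded (\<lambda>x. of_real (x \<bullet> a))"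
  unfolding poly_bounded_def
proof (intro conjI exI allI)
  fix x :: 'a
  from mult_left_mono[OF norm_le_weight[of x] norm_ge_zero[of a]]
  show "norm (complex_of_real (x \<bullet> a)) \<le> norm a * (1 + (norm x)\<^sup>2) ^ 1"
    using Cauchy_Schwarz_ineq2[of x a] by (simp add: mult.commute)
qed (auto intro!: continuous_intros)

lemma rapid_slice:
  fixes A :: "real^'d^'m"
  assumes A: "A \<in> stiefel" and g: "rapid g"
  shows "rapid (\<lambda>\<omega>. g (\<omega> v* A))"
  unfolding rapid_def
proof (intro conjI allI)
  show "continuous_on UNIV (\<lambda>\<omega>. g (\<omega> v* A))"
    by (intro continuous_on_compose2[OF rapidD(1)[OF g]] continuous_intros) auto
  fix N
  obtain C where "\<And>x. norm (g x) * (1 + (norm x)\<^sup>2) ^ N \<le> C"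
    using rapidD(3)[OF g] by blast
  from this[of "_ v* A"] show "\<exists>C. \<forall>\<omega>. norm (g (\<omega> v* A)) * (1 + (norm \<omega>)\<^sup>2) ^ N \<le> C"
    using A by auto
qed

section \<open>Rotation invariant measures\<close>

text \<open>The Householder reflection in the hyperplane orthogonal to \<open>y - z\<close>. Equal
  norms give \<open>2 * (y \<bullet> v) = v \<bullet> v\<close>, which makes \<open>y\<close> land
  on \<open>z\<close>.\<close>

lemma orthogonal_transformation_exists:
  fixes y z :: "'a::euclidean_space"
  assumes "norm y = norm z"
  obtains U where "orthogonal_transformation U" "U y = z"
proof (cases "y = z")
  case True
  then show thesis
    using that[of "\<lambda>x. x"] by (simp add: orthogonal_transformation_def linear_id[unfolded id_def])
next
  case False
  define v where "v = y - z"
  define r where "r = 2 / (v \<bullet> v)"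
  define U where "U x = x - (r * (x \<bullet> v)) *\<^sub>R v" for x
  have r: "r * (v \<bullet> v) = 2"
    using False by (simp add: r_def v_def)
  have "linear U"
    unfolding U_def by (rule linearI) (auto simp: algebra_simps)
  moreover have "U x \<bullet> U w = x \<bullet> w" for x w
  proof -
    have "U x \<bullet> U w = x \<bullet> w - r * (x \<bullet> v) * (w \<bullet> v) - r * (w \<bullet> v) * (x \<bullet> v - r * (x \<bullet> v) * (v \<bullet> v))"
      unfolding U_def inner_diff_left inner_diff_right inner_scaleR_left inner_scaleR_right inner_commute[of v w] ..
    also have "r * (x \<bullet> v) * (v \<bullet> v) = 2 * (x \<bullet> v)"
      using r by (metis mult.commute mult.assoc)
    finally show ?thesis
      by (simp add: mult_ac)
  qed
  moreover have "U y = z"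
  proof -
    have "2 * (y \<bullet> v) = v \<bullet> v"
      using assms by (simp add: v_def inner_diff_left inner_diff_right inner_commute norm_eq)
    then have "r * (y \<bullet> v) = 1"
      using r by (metis mult.left_commute mult_cancel_left zero_neq_numeral mult.right_neutral)
    then show ?thesis
      by (simp add: U_def) (simp add: v_def)
  qed
  ultimately show thesis
    using that[of U] by (simp add: orthogonal_transformation_def)
qed

lemma fourier_integral_measure:
  fixes \<phi> :: "'a::euclidean_space \<Rightarrow> complex" and \<rho> :: "'a measure"
  assumes "finite_measure \<rho>" and [measurable_cong]: "sets \<rho> = sets borel" and \<phi>: "integrable lborel \<phi>"
  shows "(\<integral>x. fourier \<phi> x \<partial>\<rho>) = (\<integral>y. \<phi> y * (\<integral>x. exp (- (\<i> * of_real (x \<bullet> y))) \<partial>\<rho>) \<partial>lborel)"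
proof -
  interpret finite_measure \<rho> by fact
  interpret pair_sigma_finite \<rho> "lborel :: 'a measure" ..
  have [measurable]: "\<phi> \<in> borel_measurable borel"
    using \<phi> by (simp add: borel_measurable_integrable)
  have "integrable (\<rho> \<Otimes>\<^sub>M lborel) (\<lambda>(x, y). \<phi> y * exp (- (\<i> * of_real (x \<bullet> y))))"
    by (rule Fubini_integrable) (use integrable_fourier_kernel(1)[OF \<phi>] in simp_all)
  then show ?thesis
    using Fubini_integral[of "\<lambda>x y. \<phi> y * exp (- (\<i> * of_real (x \<bullet> y)))"]
    by (simp add: fourier_def)
qed

text \<open>The kernel \<open>exp (- i x\<cdot>y)\<close> is symmetric and rotation invariant. Pairing \<open>\<rho>\<^sub>1 - \<rho>\<^sub>2\<close> with
  the Fourier transform of a radial function, which is radial, shows that the radial function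
  \<open>D\<close>, the Fourier transform of \<open>\<rho>\<^sub>1 - \<rho>\<^sub>2\<close>, is orthogonal to all radial functions.\<close>

lemma rotation_invariant_fourier_eq:
  fixes \<rho>1 \<rho>2 :: "'a::euclidean_space measure"
  assumes fin: "finite_measure \<rho>1" "finite_measure \<rho>2"
    and sets [measurable_cong]: "sets \<rho>1 = sets borel" "sets \<rho>2 = sets borel"
    and inv: "\<And>U. orthogonal_transformation U \<Longrightarrow> distr \<rho>1 borel U = \<rho>1"
      "\<And>U. orthogonal_transformation U \<Longrightarrow> distr \<rho>2 borel U = \<rho>2"
    and norm: "distr \<rho>1 borel norm = distr \<rho>2 borel norm"
    and \<phi>: "integrable lborel \<phi>"
  shows "(\<integral>x. fourier \<phi> x \<partial>\<rho>1) = (\<integral>x. fourier \<phi> x \<partial>\<rho>2)"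
proof -
  define P where "P \<rho> y = (\<integral>x. exp (- (\<i> * of_real (x \<bullet> y))) \<partial>\<rho>)" for \<rho> and y :: 'a
  have P_rot: "P \<rho> (U y) = P \<rho> y"
    if U: "orthogonal_transformation U" and [measurable_cong]: "sets \<rho> = sets borel"
      and i: "distr \<rho> borel U = \<rho>" for \<rho> U y
  proof -
    note [measurable] = orthogonal_transformation_measurable[OF U]
    have "P \<rho> (U y) = (\<integral>x. exp (- (\<i> * of_real (x \<bullet> U y))) \<partial>distr \<rho> borel U)"
      by (simp add: P_def i)
    also have "\<dots> = P \<rho> y"
      using U by (subst integral_distr) (simp_all add: P_def orthogonal_transformation_def)
    finally show ?thesis .
  qed
  have P_cont: "continuous_on UNIV (P \<rho>)" and P_bound: "norm (P \<rho> y) \<le> measure \<rho> (space \<rho>)"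
    if "finite_measure \<rho>" and [measurable_cong]: "sets \<rho> = sets borel" for \<rho> y
  proof -
    interpret finite_measure \<rho> by fact
    show "continuous_on UNIV (P \<rho>)"
      unfolding P_def
      by (rule continuous_on_integral_param[where w="\<lambda>_. 1"]) (auto intro!: continuous_intros)
    show "norm (P \<rho> y) \<le> measure \<rho> (space \<rho>)"
      unfolding P_def by (rule order_trans[OF integral_norm_bound]) simp
  qed
  define D where "D y = P \<rho>1 y - P \<rho>2 y" for y
  have D_cont: "continuous_on UNIV D"
    unfolding D_def by (intro continuous_intros P_cont fin sets)
  then have [measurable]: "D \<in> borel_measurable borel"
    by (rule borel_measurable_continuous_onI)
  define B where "B = measure \<rho>1 (space \<rho>1) + measure \<rho>2 (space \<rho>2)"
  have D_bound: "norm (D y) \<le> B" for y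
    unfolding D_def B_def
    by (rule order_trans[OF norm_triangle_ineq4]) (intro add_mono P_bound fin sets)
  have D_rot: "D (U y) = D y" if "orthogonal_transformation U" for U y
    using P_rot[OF that] inv[OF that] sets by (simp add: D_def)
  have pair: "(\<integral>x. fourier f x \<partial>\<rho>1) - (\<integral>x. fourier f x \<partial>\<rho>2) = (\<integral>y. f y * D y \<partial>lborel)"
    if f: "integrable lborel f" for f
  proof -
    have i: "integrable lborel (\<lambda>y. f y * P \<rho> y)" if r: "finite_measure \<rho>" "sets \<rho> = sets borel" for \<rho>
    proof (rule Bochner_Integration.integrable_bound)
      show "integrable lborel (\<lambda>y. measure \<rho> (space \<rho>) * norm (f y))"
        using f by simp
      have [measurable]: "P \<rho> \<in> borel_measurable borel" "f \<in> borel_measurable borel"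
        using P_cont[OF r] f by (auto intro: borel_measurable_continuous_onI)
      show "(\<lambda>y. f y * P \<rho> y) \<in> borel_measurable lborel"
        by measurable
      show "AE y in lborel. norm (f y * P \<rho> y) \<le> norm (measure \<rho> (space \<rho>) * norm (f y))"
        using P_bound[OF r] by (intro AE_I2) (simp add: norm_mult mult.commute[of "measure \<rho> _"] mult_left_mono)
    qed
    show ?thesis
      using i[OF fin(1) sets(1)] i[OF fin(2) sets(2)]
      by (simp add: fourier_integral_measure fin sets f P_def[symmetric] D_def right_diff_distrib)
  qed
  have [measurable]: "(\<lambda>y. cnj (D y)) \<in> borel_measurable borel"
    by (intro borel_measurable_continuous_onI continuous_on_cnj D_cont)
  \<comment> \<open>The conjugate turns the pairing with \<open>D\<close> into the integral of
    \<open>(norm (D y))\<^sup>2\<close>; the Gaussian makes it integrable, keeps it radial and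
    vanishes nowhere.\<close>
  define q where "q y = cnj (D y) * of_real (gauss y)" for y
  have q: "integrable lborel q"
  proof (rule Bochner_Integration.integrable_bound)
    show "integrable lborel (\<lambda>y::'a. B * gauss y)"
      by simp
    show "AE y in lborel. norm (q y) \<le> norm (B * gauss y)"
      using D_bound by (intro AE_I2) (simp add: q_def norm_mult abs_mult mult_right_mono order_trans[OF _ abs_ge_self])
  qed (simp add: q_def[abs_def])
  then have [measurable]: "q \<in> borel_measurable borel"
    by (simp add: borel_measurable_integrable)
  have q_rot: "q (U y) = q y" if "orthogonal_transformation U" for U y
    using that by (simp add: q_def D_rot gauss_def orthogonal_transformation_norm)
  obtain e :: 'a where e: "norm e = 1"
    using norm_Basis SOME_Basis by blast
  \<comment> \<open>A radial function has a radial transform, recorded as its profile along the line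
    through \<open>e\<close>. Integrals against the two measures then see only the law of the
    norm.\<close>
  define Q where "Q r = fourier q (r *\<^sub>R e)" for r
  have "continuous_on UNIV Q"
    unfolding Q_def by (intro continuous_on_compose2[OF continuous_on_fourier[OF q, of UNIV]] continuous_intros) auto
  then have [measurable]: "Q \<in> borel_measurable borel"
    by (rule borel_measurable_continuous_onI)
  have Q: "fourier q = (\<lambda>x. Q (norm x))"
  proof
    fix x :: 'a
    obtain U where U: "orthogonal_transformation U" "U (norm x *\<^sub>R e) = x"
      using orthogonal_transformation_exists[of "norm x *\<^sub>R e" x] e by auto
    have "fourier q x = fourier (\<lambda>y. q (U y)) (norm x *\<^sub>R e)"
      using fourier_orthogonal[OF _ U(1), of q] U(2) by simp
    then show "fourier q x = Q (norm x)"
      by (simp add: q_rot[OF U(1)] Q_def)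
  qed
  have "(\<integral>x. fourier q x \<partial>\<rho>1) = (\<integral>r. Q r \<partial>distr \<rho>1 borel norm)"
    by (subst integral_distr) (simp_all add: Q)
  also have "\<dots> = (\<integral>x. fourier q x \<partial>\<rho>2)"
    unfolding norm by (subst integral_distr) (simp_all add: Q)
  finally have "(\<integral>y. q y * D y \<partial>lborel) = 0"
    using pair[OF q] by simp
  moreover have "q y * D y = of_real ((norm (D y))\<^sup>2 * gauss y)" for y
    by (simp only: q_def of_real_mult complex_norm_square mult_ac)
  ultimately have z: "(\<integral>y. (norm (D y))\<^sup>2 * gauss y \<partial>lborel) = 0"
    by (simp only: integral_complex_of_real) simp
  have "integrable lborel (\<lambda>y. (norm (D y))\<^sup>2 * gauss y)"
  proof (rule Bochner_Integration.integrable_bound)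
    show "integrable lborel (\<lambda>y::'a. B\<^sup>2 * gauss y)"
      by simp
    show "AE y in lborel. norm ((norm (D y))\<^sup>2 * gauss y) \<le> norm (B\<^sup>2 * gauss y)"
      using D_bound by (intro AE_I2) (simp add: abs_mult mult_right_mono power_mono)
  qed simp
  with z have "AE y in lborel. (norm (D y))\<^sup>2 * gauss y = 0"
    by (subst (asm) integral_nonneg_eq_0_iff_AE) auto
  then have "AE y in lborel. \<phi> y * D y = 0"
    by eventually_elim (auto simp: gauss_def)
  then have "(\<integral>y. \<phi> y * D y \<partial>lborel) = 0"
    by (rule integral_eq_zero_AE)
  with pair[OF \<phi>] show ?thesis
    by simp
qed

section \<open>Change of dimension in radial integrals\<close>

lemma nn_integral_norm_le_scale:
  fixes r :: real
  assumes r: "r > 0"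
  shows "integral\<^sup>N lborel (\<lambda>x::'a::euclidean_space. ennreal (norm x ^ k) * indicator {..r} (norm x))
    = ennreal (r ^ (DIM('a) + k)) * integral\<^sup>N lborel (\<lambda>x::'a. ennreal (norm x ^ k) * indicator {..1} (norm x))"
proof -
  have "integral\<^sup>N lborel (\<lambda>x::'a. ennreal (norm x ^ k) * indicator {..r} (norm x))
      = ennreal (r ^ DIM('a)) *
        integral\<^sup>N lborel (\<lambda>x::'a. ennreal (norm (r *\<^sub>R x) ^ k) * indicator {..r} (norm (r *\<^sub>R x)))"
    by (rule nn_integral_lborel_scale) (use r in measurable)
  also have "(\<lambda>x::'a. ennreal (norm (r *\<^sub>R x) ^ k) * indicator {..r} (norm (r *\<^sub>R x)))
      = (\<lambda>x. ennreal (r ^ k) * (ennreal (norm x ^ k) * indicator {..1} (norm x)))"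
    using r by (auto simp: fun_eq_iff power_mult_distrib ennreal_mult mult.assoc split: split_indicator)
  also have "ennreal (r ^ DIM('a)) * integral\<^sup>N lborel (\<lambda>x::'a. ennreal (r ^ k) * (ennreal (norm x ^ k) * indicator {..1} (norm x)))
      = ennreal (r ^ (DIM('a) + k)) * integral\<^sup>N lborel (\<lambda>x::'a. ennreal (norm x ^ k) * indicator {..1} (norm x))"
    using r by (simp add: nn_integral_cmult power_add ennreal_mult mult.assoc)
  finally show ?thesis .
qed

lemma nn_integral_norm_le_nonpos:
  fixes r :: real
  assumes "r \<le> 0"
  shows "integral\<^sup>N lborel (\<lambda>x::'a::euclidean_space. ennreal (norm x ^ k) * indicator {..r} (norm x)) = 0"
proof -
  have "AE x in lborel. ennreal (norm (x::'a) ^ k) * indicator {..r} (norm x) = 0"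
    using AE_lborel_singleton[of "0::'a"]
  proof eventually_elim
    case (elim x)
    then have "\<not> norm x \<le> r"
      using assms by (simp add: not_le) (meson le_less_trans zero_less_norm_iff)
    then show ?case by simp
  qed
  then show ?thesis
    by (subst nn_integral_0_iff_AE) measurable
qed

text \<open>Both sides scale with the same exponent under dilations.\<close>

lemma radial_integral_dimension_change:
  assumes dim: "DIM('b::euclidean_space) + k = DIM('a::euclidean_space)"
  obtains C where "C \<ge> 0" "\<And>g. g \<in> borel_measurable borel \<Longrightarrow>
    integral\<^sup>N lborel (\<lambda>x::'b. ennreal (norm x ^ k) * g (norm x)) = ennreal C * integral\<^sup>N lborel (\<lambda>x::'a. g (norm x))"
proof -
  define I where "I = integral\<^sup>N lborel (\<lambda>x::'b. ennreal (norm x ^ k) * indicator {..1} (norm x))"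
  \<comment> \<open>The factor \<open>norm x ^ 0\<close> gives the shape of
    \<open>nn_integral_norm_le_scale\<close> with exponent 0.\<close>
  define V where "V = integral\<^sup>N lborel (\<lambda>x::'a. ennreal (norm x ^ 0) * indicator {..1} (norm x))"
  have ball: "integral\<^sup>N lborel (\<lambda>x::'c::euclidean_space. indicator {..1} (norm x)) = ennreal (unit_ball_vol (real DIM('c)))"
  proof -
    have "(\<lambda>x::'c. indicator {..1} (norm x)) = (indicator (cball 0 1) :: 'c \<Rightarrow> ennreal)"
      by (auto simp: fun_eq_iff split: split_indicator)
    then show ?thesis
      by (simp add: emeasure_cball)
  qed
  have V: "V = ennreal (unit_ball_vol (real DIM('a)))"
    by (simp add: V_def ball)
  have "I \<le> integral\<^sup>N lborel (\<lambda>x::'b. indicator {..1} (norm x))"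
    unfolding I_def
  proof (intro nn_integral_mono)
    fix x :: 'b
    have "norm x \<le> 1 \<Longrightarrow> norm x ^ k \<le> 1"
      by (simp add: power_le_one)
    then show "ennreal (norm x ^ k) * indicator {..1} (norm x) \<le> indicator {..1} (norm x)"
      by (auto split: split_indicator)
  qed
  then have "I < \<infinity>"
    by (simp add: ball) (meson ennreal_less_top order_le_less_trans)
  have vol: "unit_ball_vol (real DIM('a)) \<noteq> 0" "unit_ball_vol (real DIM('a)) \<ge> 0"
    using unit_ball_vol_pos[of "real DIM('a)"] by linarith+
  \<comment> \<open>The unit balls force this constant; scaling then gives equality on all other
    half-lines \<open>{..r}\<close>.\<close>
  define C where "C = enn2real I / unit_ball_vol (real DIM('a))"
  have C: "C \<ge> 0" "ennreal C * V = I"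
    using \<open>I < \<infinity>\<close> vol by (simp_all add: C_def V ennreal_mult[symmetric] less_top)
  define M where "M = distr (density lborel (\<lambda>x::'b. ennreal (norm x ^ k))) borel norm"
  define N where "N = distr (density lborel (\<lambda>x::'a. ennreal C)) borel norm"
  have M: "emeasure M A = integral\<^sup>N lborel (\<lambda>x::'b. ennreal (norm x ^ k) * indicator A (norm x))"
    and N: "emeasure N A = ennreal C * integral\<^sup>N lborel (\<lambda>x::'a. ennreal (norm x ^ 0) * indicator A (norm x))"
    if [measurable]: "A \<in> sets borel" for A
    unfolding M_def N_def
    by (simp_all add: emeasure_distr emeasure_density nn_integral_cmult indicator_vimage[symmetric] vimage_def
        indicator_def of_bool_def)
  have MN: "emeasure M {..r} = emeasure N {..r}" for r
  proof (cases "r \<le> 0")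
    case True
    then show ?thesis
      by (simp only: M N nn_integral_norm_le_nonpos borel_closed closed_atMost mult_zero_right)
  next
    case False
    then have "r > 0" by simp
    have "emeasure M {..r} = ennreal (r ^ DIM('a)) * (ennreal C * V)"
      unfolding M[OF borel_closed[OF closed_atMost]] nn_integral_norm_le_scale[OF \<open>r > 0\<close>] dim C
      by (simp add: I_def)
    also have "\<dots> = emeasure N {..r}"
      unfolding N[OF borel_closed[OF closed_atMost]] nn_integral_norm_le_scale[OF \<open>r > 0\<close>] V_def
      by (simp add: mult_ac)
    finally show ?thesis .
  qed
  have "M = N"
  proof (rule measure_eqI_generator_eq)
    show "Int_stable (range (\<lambda>r::real. {..r}))"
      by (auto simp: Int_stable_def)
    show "sets M = sigma_sets UNIV (range (\<lambda>r::real. {..r}))" "sets N = sigma_sets UNIV (range (\<lambda>r::real. {..r}))"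
      by (simp_all add: M_def N_def borel_eq_atMost)
    show "range (\<lambda>n. {..real n}) \<subseteq> range (\<lambda>r::real. {..r})"
      by auto
    show "(\<Union>n. {..real n}) = UNIV"
      by (auto intro: real_arch_simple)
    show "emeasure M {..real n} \<noteq> \<infinity>" for n
    proof -
      have "emeasure N {..real n} < \<infinity>"
      proof (cases "real n \<le> 0")
        case True
        then show ?thesis
          by (simp only: N nn_integral_norm_le_nonpos borel_closed closed_atMost mult_zero_right) simp
      next
        case False
        then have "real n > 0" by simp
        show ?thesis
          unfolding N[OF borel_closed[OF closed_atMost]] nn_integral_norm_le_scale[OF \<open>real n > 0\<close>] V_def[symmetric] V
          by (simp add: ennreal_mult_less_top)
      qed
      then show ?thesis by (simp add: MN)
    qed
  qed (auto simp: MN)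
  have "integral\<^sup>N lborel (\<lambda>x::'b. ennreal (norm x ^ k) * g (norm x)) = ennreal C * integral\<^sup>N lborel (\<lambda>x::'a. g (norm x))"
    if [measurable]: "g \<in> borel_measurable borel" for g
  proof -
    have "integral\<^sup>N lborel (\<lambda>x::'b. ennreal (norm x ^ k) * g (norm x)) = integral\<^sup>N M g"
      by (simp add: M_def nn_integral_distr nn_integral_density)
    also have "\<dots> = ennreal C * integral\<^sup>N lborel (\<lambda>x::'a. g (norm x))"
      unfolding \<open>M = N\<close> by (simp add: N_def nn_integral_distr nn_integral_density nn_integral_cmult)
    finally show ?thesis .
  qed
  with C(1) show thesis
    by (rule that)
qed

section \<open>The filtered back-projection\<close>

lemma closed_stiefel: "closed (stiefel :: (real^'d^'m) set)"
  unfolding stiefel_def matrix_matrix_mult_def transpose_def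
  by (intro closed_Collect_eq continuous_intros)

lemma stiefel_measurable [measurable]: "stiefel \<in> sets (borel :: (real^'d^'m) measure)"
  by (rule borel_closed[OF closed_stiefel])

lemma stiefel_haar_AE:
  assumes "stiefel_haar k \<sigma>"
  shows "AE A in \<sigma>. A \<in> stiefel"
  by (rule AE_I[where N="- stiefel"]) (use assms in \<open>auto simp: stiefel_haar_def\<close>)

lemma borel_measurable_vector_matrix [measurable (raw)]:
  fixes f :: "'z \<Rightarrow> real^'m" and g :: "'z \<Rightarrow> real^'d^'m"
  assumes "f \<in> borel_measurable M" "g \<in> borel_measurable M"
  shows "(\<lambda>x. f x v* g x) \<in> borel_measurable M"
  by (rule borel_measurable_continuous_Pair[OF assms]) (intro continuous_intros)

text \<open>Two finite measures on the full space are compared: \<open>\<rho>1\<close>, the image of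
  the density \<open>norm \<omega> ^ k * p (norm \<omega>)\<close> under
  \<open>\<omega> v* A\<close> averaged over \<open>\<sigma>\<close>, and \<open>\<rho>2\<close>, a
  multiple of \<open>p (norm x)\<close>. Both are rotation invariant, and since
  \<open>\<omega> v* A\<close> has the norm of \<open>\<omega>\<close>, the change of dimension
  gives them the same law of the norm.\<close>

lemma stiefel_haar_average:
  fixes \<sigma> :: "(real^'d^'m) measure"
  assumes dim: "CARD('m) + k = CARD('d)" and \<sigma>: "stiefel_haar k \<sigma>"
  obtains C :: real where "\<And>\<phi> x. \<phi> \<in> schwartz_space \<Longrightarrow>
    (\<integral>A. (\<integral>\<omega>. of_real (norm \<omega> ^ k) * (fourier \<phi> (\<omega> v* A) * exp (\<i> * of_real ((\<omega> v* A) \<bullet> x))) \<partial>lborel) \<partial>\<sigma>)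
      = of_real C * (\<integral>\<xi>. fourier \<phi> \<xi> * exp (\<i> * of_real (\<xi> \<bullet> x)) \<partial>lborel)"
proof -
  have [measurable_cong]: "sets \<sigma> = sets borel"
    and rot: "\<And>U. orthogonal_matrix U \<Longrightarrow> distr \<sigma> borel (\<lambda>A. A ** U) = \<sigma>"
    and tot: "emeasure \<sigma> UNIV < \<infinity>"
    using \<sigma> by (auto simp: stiefel_haar_def)
  have space: "space \<sigma> = UNIV"
    using sets_eq_imp_space_eq[OF \<open>sets \<sigma> = sets borel\<close>] by simp
  interpret \<sigma>: finite_measure \<sigma>
    by standard (use tot space in simp)
  interpret pair_sigma_finite \<sigma> "lborel :: (real^'m) measure" ..
  have AE: "AE A in \<sigma>. A \<in> stiefel"
    by (rule stiefel_haar_AE[OF \<sigma>])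
  define M where "M = CARD('d)"
  \<comment> \<open>As \<open>M\<close> is the dimension, this weight makes both measures finite;
    the symbol from \<open>weight_fourier\<close> cancels it exactly.\<close>
  define p where "p r = 1 / (1 + r\<^sup>2) ^ M" for r :: real
  have p_pos: "p r > 0" for r
    unfolding p_def by (intro divide_pos_pos zero_less_power add_pos_nonneg) auto
  have [measurable]: "p \<in> borel_measurable borel"
    unfolding p_def by measurable
  obtain C where C: "C \<ge> 0" "\<And>g. g \<in> borel_measurable borel \<Longrightarrow>
    integral\<^sup>N lborel (\<lambda>x::real^'m. ennreal (norm x ^ k) * g (norm x)) = ennreal C * integral\<^sup>N lborel (\<lambda>x::real^'d. g (norm x))"
    using radial_integral_dimension_change[where 'a="real^'d" and 'b="real^'m" and k=k] dim by auto
  \<comment> \<open>For \<open>A\<close> in the Stiefel manifold the inner integral of a radial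
    function does not depend on \<open>A\<close>, so integration over \<open>\<sigma>\<close>
    contributes the total mass.\<close>
  define c where "c = C * measure \<sigma> UNIV"
  have c: "c \<ge> 0" "ennreal c = ennreal C * emeasure \<sigma> UNIV"
    using C(1) by (simp_all add: c_def \<sigma>.emeasure_eq_measure ennreal_mult)
  let ?W = "\<lambda>z :: (real^'d^'m) \<times> (real^'m). ennreal (norm (snd z) ^ k * p (norm (snd z)))"
  let ?T = "\<lambda>z :: (real^'d^'m) \<times> (real^'m). snd z v* fst z"
  define \<rho>1 where "\<rho>1 = distr (density (\<sigma> \<Otimes>\<^sub>M lborel) ?W) borel ?T"
  define \<rho>2 where "\<rho>2 = density lborel (\<lambda>x::real^'d. ennreal (c * p (norm x)))"
  have sets [measurable_cong]: "sets \<rho>1 = sets borel" "sets \<rho>2 = sets borel"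
    by (auto simp: \<rho>1_def \<rho>2_def)
  have int1: "integral\<^sup>N \<rho>1 g = (\<integral>\<^sup>+A. (\<integral>\<^sup>+\<omega>. ennreal (norm \<omega> ^ k * p (norm \<omega>)) * g (\<omega> v* A) \<partial>lborel) \<partial>\<sigma>)"
    if [measurable]: "g \<in> borel_measurable borel" for g
    unfolding \<rho>1_def
    by (simp add: nn_integral_distr nn_integral_density lborel.nn_integral_fst[symmetric] case_prod_beta)
  have int2: "integral\<^sup>N \<rho>2 g = (\<integral>\<^sup>+x. ennreal (c * p (norm x)) * g x \<partial>lborel)"
    if [measurable]: "g \<in> borel_measurable borel" for g
    unfolding \<rho>2_def by (simp add: nn_integral_density)
  have norm_eq: "integral\<^sup>N \<rho>1 (\<lambda>x. g (norm x)) = integral\<^sup>N \<rho>2 (\<lambda>x. g (norm x))"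
    if [measurable]: "g \<in> borel_measurable borel" for g
  proof -
    have m: "(\<lambda>x::real^'d. g (norm x)) \<in> borel_measurable borel"
      by measurable
    have "integral\<^sup>N \<rho>1 (\<lambda>x. g (norm x))
        = (\<integral>\<^sup>+A. (\<integral>\<^sup>+\<omega>. ennreal (norm \<omega> ^ k) * (ennreal (p (norm \<omega>)) * g (norm (\<omega>::real^'m))) \<partial>lborel) \<partial>\<sigma>)"
      unfolding int1[OF m]
      by (intro nn_integral_cong_AE)
         (use AE in eventually_elim, simp add: ennreal_mult p_pos[THEN less_imp_le] mult.assoc)
    also have "\<dots> = ennreal c * integral\<^sup>N lborel (\<lambda>x::real^'d. ennreal (p (norm x)) * g (norm x))"
      using C(2)[of "\<lambda>r. ennreal (p r) * g r"] by (simp add: c space mult_ac)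
    also have "\<dots> = integral\<^sup>N \<rho>2 (\<lambda>x. g (norm x))"
      using int2[of "\<lambda>x. g (norm x)"] c p_pos[THEN less_imp_le]
      by (simp add: ennreal_mult nn_integral_cmult mult.assoc)
    finally show ?thesis .
  qed
  have fin2: "integral\<^sup>N \<rho>2 (\<lambda>x. 1) < \<infinity>"
  proof -
    have "integrable lborel (\<lambda>x::real^'d. c * p (norm x))"
      unfolding p_def M_def using integrable_inverse_weight[where 'a="real^'d"]
      by (intro integrable_mult_right) simp
    then show ?thesis
      using c(1) p_pos[THEN less_imp_le] by (simp only: int2[OF borel_measurable_const]) (simp add: nn_integral_eq_integral)
  qed
  have fin: "finite_measure \<rho>1" "finite_measure \<rho>2"
    using fin2 norm_eq[of "\<lambda>_. 1"] by (auto intro!: finite_measureI)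
  have nrm: "distr \<rho>1 borel norm = distr \<rho>2 borel norm"
  proof (rule measure_eqI)
    fix A assume "A \<in> sets (distr \<rho>1 borel norm)"
    then have [measurable]: "A \<in> sets borel" by simp
    have "emeasure (distr \<rho> borel norm) A = integral\<^sup>N \<rho> (\<lambda>x. indicator A (norm x))"
      if [measurable_cong]: "sets \<rho> = sets borel" for \<rho> :: "(real^'d) measure"
      by (simp add: nn_integral_distr[symmetric, of norm \<rho> borel "indicator A"])
    then show "emeasure (distr \<rho>1 borel norm) A = emeasure (distr \<rho>2 borel norm) A"
      using norm_eq[of "indicator A"] sets by simp
  qed simp
  have inv: "distr \<rho>1 borel U = \<rho>1" "distr \<rho>2 borel U = \<rho>2"
    if U: "orthogonal_transformation U" for U :: "real^'d \<Rightarrow> real^'d"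
  proof -
    have lin: "linear U" and orth: "orthogonal_matrix (transpose (matrix U))"
      using U by (auto simp: orthogonal_transformation_matrix orthogonal_matrix_transpose)
    note [measurable] = orthogonal_transformation_measurable[OF U]
    \<comment> \<open>A rotation of the image point is a right multiplication of \<open>A\<close>,
      under which \<open>\<sigma>\<close> is invariant.\<close>
    have U_eq: "U (\<omega> v* A) = \<omega> v* (A ** transpose (matrix U))" for \<omega> :: "real^'m" and A
    proof -
      have "U (\<omega> v* A) = matrix U *v (\<omega> v* A)"
        using fun_cong[OF matrix_vector_mul(2)[OF lin]] by simp
      then show ?thesis
        by (simp add: vector_matrix_mul_assoc[symmetric])
    qed
    have *: "distr \<rho> borel U = \<rho>" if [measurable_cong]: "sets \<rho> = sets borel"
      and i: "\<And>g. g \<in> borel_measurable borel \<Longrightarrow> integral\<^sup>N \<rho> (\<lambda>x. g (U x)) = integral\<^sup>N \<rho> g" for \<rho>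
    proof (rule measure_eqI)
      fix A assume "A \<in> sets (distr \<rho> borel U)"
      then have [measurable]: "A \<in> sets borel" by simp
      show "emeasure (distr \<rho> borel U) A = emeasure \<rho> A"
        using i[of "indicator A"]
        by (simp add: nn_integral_distr[symmetric, of U \<rho> borel "indicator A"] that)
    qed (simp add: that)
    show "distr \<rho>2 borel U = \<rho>2"
    proof (rule *[OF sets(2)])
      fix g :: "real^'d \<Rightarrow> ennreal" assume [measurable]: "g \<in> borel_measurable borel"
      have "(\<integral>\<^sup>+x. ennreal (c * p (norm x)) * g x \<partial>distr lborel borel U) = (\<integral>\<^sup>+x. ennreal (c * p (norm x)) * g (U x) \<partial>lborel)"
        using U by (simp add: nn_integral_distr orthogonal_transformation_norm)
      then show "integral\<^sup>N \<rho>2 (\<lambda>x. g (U x)) = integral\<^sup>N \<rho>2 g"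
        by (simp add: int2 lborel_distr_orthogonal[OF U])
    qed
    show "distr \<rho>1 borel U = \<rho>1"
    proof (rule *[OF sets(1)])
      fix g :: "real^'d \<Rightarrow> ennreal" assume [measurable]: "g \<in> borel_measurable borel"
      let ?V = "transpose (matrix U)"
      have [measurable]: "(\<lambda>A :: real^'d^'m. A ** ?V) \<in> borel_measurable borel"
        unfolding matrix_matrix_mult_def by (intro borel_measurable_continuous_onI continuous_intros)
      have "(\<integral>\<^sup>+A. (\<integral>\<^sup>+\<omega>. ennreal (norm \<omega> ^ k * p (norm \<omega>)) * g (\<omega> v* A) \<partial>lborel) \<partial>distr \<sigma> borel (\<lambda>A. A ** ?V))
          = (\<integral>\<^sup>+A. (\<integral>\<^sup>+\<omega>. ennreal (norm \<omega> ^ k * p (norm \<omega>)) * g (U (\<omega> v* A)) \<partial>lborel) \<partial>\<sigma>)"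
        by (subst nn_integral_distr) (simp_all add: U_eq)
      then show "integral\<^sup>N \<rho>1 (\<lambda>x. g (U x)) = integral\<^sup>N \<rho>1 g"
        by (simp add: int1 rot[OF orth])
    qed
  qed
  have "(\<integral>A. (\<integral>\<omega>. of_real (norm \<omega> ^ k) * (fourier \<phi> (\<omega> v* A) * exp (\<i> * of_real ((\<omega> v* A) \<bullet> x))) \<partial>lborel) \<partial>\<sigma>)
      = of_real c * (\<integral>\<xi>. fourier \<phi> \<xi> * exp (\<i> * of_real (\<xi> \<bullet> x)) \<partial>lborel)"
    if \<phi>: "\<phi> \<in> schwartz_space" for \<phi> x
  proof -
    obtain \<psi> where \<psi>: "\<psi> \<in> schwartz_space" "\<And>\<xi>. fourier \<psi> \<xi> = of_real ((1 + (norm \<xi>)\<^sup>2) ^ M) * fourier \<phi> \<xi>"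
      using weight_fourier[OF \<phi>] by blast
    \<comment> \<open>The translation produces the phase at \<open>x\<close>, so the entire
      integrand is \<open>p\<close> times the transform of one integrable function.\<close>
    define \<eta> where "\<eta> y = \<psi> (y + x)" for y
    have i\<eta>: "integrable lborel \<eta>"
      using integrable_lborel_affine[OF schwartz_integrable[OF \<psi>(1)], of 1 x] by (simp add: \<eta>_def[abs_def] add.commute)
    have fe: "fourier \<eta> \<xi> = fourier \<psi> \<xi> * exp (\<i> * of_real (\<xi> \<bullet> x))" for \<xi>
      unfolding \<eta>_def using rapidD(2)[OF schwartz_rapid[OF \<psi>(1)]] by (rule fourier_translate)
    then have F: "of_real (p (norm \<xi>)) * fourier \<eta> \<xi> = fourier \<phi> \<xi> * exp (\<i> * of_real (\<xi> \<bullet> x))" for \<xi>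
    proof -
      have "(1 + (norm \<xi>)\<^sup>2) ^ M \<noteq> 0"
        by (simp add: add_nonneg_eq_0_iff)
      then have "complex_of_real (p (norm \<xi>)) * of_real ((1 + (norm \<xi>)\<^sup>2) ^ M) = 1"
        unfolding p_def of_real_mult[symmetric] by simp
      then show ?thesis
        by (simp only: fe \<psi>(2) mult.assoc[symmetric] mult_1_left)
    qed
    note [measurable] = borel_measurable_continuous_onI[OF continuous_on_fourier[OF i\<eta>]]
    have i1: "integrable \<rho>1 (fourier \<eta>)"
      by (rule finite_measure.integrable_const_bound[OF fin(1), where B="\<integral>x. norm (\<eta> x) \<partial>lborel"])
         (auto simp: norm_fourier_le)
    have pk: "0 \<le> norm \<omega> ^ k * p (norm \<omega>)" for \<omega> :: "real^'m"
      using p_pos[of "norm \<omega>"] by simp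
    have i1': "integrable (\<sigma> \<Otimes>\<^sub>M lborel) (\<lambda>z. of_real (norm (snd z) ^ k * p (norm (snd z))) * fourier \<eta> (snd z v* fst z))"
      using i1 pk unfolding \<rho>1_def
      by (simp add: integrable_distr_eq integrable_density case_prod_beta scaleR_conv_of_real)
    have "(\<integral>x. fourier \<eta> x \<partial>\<rho>1) = (\<integral>z. of_real (norm (snd z) ^ k * p (norm (snd z))) * fourier \<eta> (snd z v* fst z) \<partial>(\<sigma> \<Otimes>\<^sub>M lborel))"
      using pk unfolding \<rho>1_def
      by (simp add: integral_distr integral_density case_prod_beta scaleR_conv_of_real)
    also have "\<dots> = (\<integral>A. (\<integral>\<omega>. of_real (norm \<omega> ^ k * p (norm \<omega>)) * fourier \<eta> (\<omega> v* A) \<partial>lborel) \<partial>\<sigma>)"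
      using integral_fst'[OF i1'] by simp
    also have "\<dots> = (\<integral>A. (\<integral>\<omega>. of_real (norm \<omega> ^ k) * (fourier \<phi> (\<omega> v* A) * exp (\<i> * of_real ((\<omega> v* A) \<bullet> x))) \<partial>lborel) \<partial>\<sigma>)"
    proof (rule integral_cong_AE)
      show "AE A in \<sigma>. (\<integral>\<omega>. of_real (norm \<omega> ^ k * p (norm \<omega>)) * fourier \<eta> (\<omega> v* A) \<partial>lborel)
        = (\<integral>\<omega>. of_real (norm \<omega> ^ k) * (fourier \<phi> (\<omega> v* A) * exp (\<i> * of_real ((\<omega> v* A) \<bullet> x))) \<partial>lborel)"
        using AE by eventually_elim (simp add: F[symmetric] mult.assoc)
      show "(\<lambda>A. \<integral>\<omega>. of_real (norm \<omega> ^ k * p (norm \<omega>)) * fourier \<eta> (\<omega> v* A) \<partial>lborel) \<in> borel_measurable \<sigma>"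
        by measurable
      show "(\<lambda>A. \<integral>\<omega>. of_real (norm \<omega> ^ k) * (fourier \<phi> (\<omega> v* A) * exp (\<i> * of_real ((\<omega> v* A) \<bullet> x))) \<partial>lborel) \<in> borel_measurable \<sigma>"
        unfolding F[symmetric] by measurable
    qed
    finally have 1: "(\<integral>x. fourier \<eta> x \<partial>\<rho>1) = \<dots>" .
    have "(\<integral>x. fourier \<eta> x \<partial>\<rho>2) = (\<integral>\<xi>. of_real (c * p (norm \<xi>)) * fourier \<eta> \<xi> \<partial>lborel)"
      unfolding \<rho>2_def using c(1) p_pos[THEN less_imp_le]
      by (subst integral_density) (simp_all add: scaleR_conv_of_real)
    also have "\<dots> = of_real c * (\<integral>\<xi>. fourier \<phi> \<xi> * exp (\<i> * of_real (\<xi> \<bullet> x)) \<partial>lborel)"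
      unfolding F[symmetric] by (simp add: mult.assoc)
    finally show ?thesis
      using 1 rotation_invariant_fourier_eq[OF fin sets inv nrm i\<eta>] by simp
  qed
  then show thesis
    by (rule that)
qed

text \<open>Even powers are realised by k-plane transforms of iterated Laplacians, because
  \<open>\<omega> v* A\<close> has the norm of \<open>\<omega>\<close>.\<close>

lemma fourier_kplane_bci:
  fixes A :: "real^'d^'m"
  assumes A: "A \<in> stiefel" and \<phi>: "\<phi> \<in> schwartz_space"
  shows "\<exists>v. bci v \<and> (\<forall>\<omega>. fourier v \<omega> = of_real (norm \<omega> ^ k) * fourier \<phi> (\<omega> v* A))"
proof (rule bci_mult_norm_power)
  fix j
  obtain \<psi> where \<psi>: "\<psi> \<in> schwartz_space" "\<And>\<xi>. fourier \<psi> \<xi> = of_real (norm \<xi> ^ (2 * j)) * fourier \<phi> \<xi>"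
    using norm_power_fourier[OF \<phi>] by blast
  then show "\<exists>u. bci u \<and> (\<forall>\<omega>. fourier u \<omega> = of_real (norm \<omega> ^ (2 * j)) * fourier \<phi> (\<omega> v* A))"
    using A by (intro exI[of _ "\<lambda>t. kplane \<psi> (A, t)"])
      (simp add: bci_kplane schwartz_rapid fourier_kplane schwartz_integrable)
qed

lemma fourier_inv_slice:
  fixes A :: "real^'d^'m"
  assumes A: "A \<in> stiefel" and \<psi>: "\<psi> \<in> schwartz_space"
  shows "fourier_inv (\<lambda>\<omega>. fourier \<psi> (\<omega> v* A)) t = kplane \<psi> (A, t)"
proof -
  have f: "fourier (\<lambda>t. kplane \<psi> (A, t)) = (\<lambda>\<omega>. fourier \<psi> (\<omega> v* A))"
    using A \<psi> by (auto simp: fourier_kplane schwartz_integrable)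
  then have "integrable lborel (fourier (\<lambda>t. kplane \<psi> (A, t)))"
    using rapid_integrable[OF rapid_slice[OF A fourier_rapid[OF \<psi>]]] by simp
  from fourier_inversion[OF bci_kplane[OF A schwartz_rapid[OF \<psi>]] this]
  show ?thesis
    by (simp add: f)
qed

section \<open>The filter K slice by slice\<close>

lemma filter_K_kplane:
  fixes A :: "real^'d^'m"
  assumes "\<phi> \<in> schwartz_space"
  shows "filter_K k (kplane \<phi>) (A, t) = (if A \<in> stiefel then
     fourier_inv (\<lambda>\<omega>. of_real (filter_const CARD('d) k * norm \<omega> ^ k) * fourier \<phi> (\<omega> v* A)) t else 0)"
proof (cases "A \<in> stiefel")
  case True
  then show ?thesis
    using assms by (simp add: filter_K_def on_t_def multiplier_def fourier_kplane schwartz_integrable)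
next
  case False
  then have "(\<lambda>s. kplane \<phi> (A, s)) = (\<lambda>s. 0)"
    by (simp add: kplane_def)
  with False show ?thesis
    by (simp add: filter_K_def on_t_def multiplier_def fourier_inv_def)
qed

lemma rapid_filter:
  fixes A :: "real^'d^'m"
  assumes "A \<in> stiefel" "\<phi> \<in> schwartz_space"
  shows "rapid (\<lambda>\<omega>. of_real (c * norm \<omega> ^ k) * fourier \<phi> (\<omega> v* A))"
  unfolding of_real_mult
  by (intro rapid_mult poly_bounded_mult poly_bounded_const poly_bounded_norm_power
      rapid_slice[OF assms(1) fourier_rapid[OF assms(2)]])

text \<open>For odd \<open>k\<close> the function \<open>h\<close> may be singular at 0, so
  integrability of \<open>fourier_inv h\<close> is not read off from smoothness. Instead
  \<open>h\<close> is already known to be the transform of \<open>?u\<close>; inversion identifies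
  \<open>fourier_inv h\<close> with \<open>?u\<close>, and transforming again returns
  \<open>h\<close>.\<close>

lemma fourier_filter:
  fixes A :: "real^'d^'m" and c :: real and k :: nat
  assumes A: "A \<in> stiefel" and \<phi>: "\<phi> \<in> schwartz_space"
  defines "h \<equiv> \<lambda>\<omega>. of_real (c * norm \<omega> ^ k) * fourier \<phi> (\<omega> v* A)"
  shows "fourier (fourier_inv h) = h"
proof -
  obtain v where v: "bci v" "\<And>\<omega>. fourier v \<omega> = of_real (norm \<omega> ^ k) * fourier \<phi> (\<omega> v* A)"
    using fourier_kplane_bci[OF A \<phi>] by blast
  let ?u = "\<lambda>x. of_real c * v x + 0 * v x"
  have u: "bci ?u"
    by (rule bci_lincomb(1)[OF v(1) v(1)])
  have h: "fourier ?u = h"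
    by (rule ext) (simp only: bci_lincomb(2)[OF v(1) v(1)] h_def v(2), simp)
  have "integrable lborel h"
    unfolding h_def by (rule rapid_integrable[OF rapid_filter[OF A \<phi>]])
  then have "fourier_inv h = ?u"
    using fourier_inversion[OF u] by (simp only: h)
  then show ?thesis
    by (simp only: h)
qed

lemma on_t_multiplier_kplane:
  fixes \<phi> \<psi> :: "real^'d \<Rightarrow> complex" and m :: "real^'m \<Rightarrow> complex"
  assumes \<phi>: "\<phi> \<in> schwartz_space" and \<psi>: "\<psi> \<in> schwartz_space"
    and eq: "\<And>(A :: real^'d^'m) \<omega>. A \<in> stiefel \<Longrightarrow> fourier \<psi> (\<omega> v* A) = m \<omega> * fourier \<phi> (\<omega> v* A)"
  shows "on_t (multiplier m) (kplane \<phi>) = (kplane \<psi> :: (real^'d^'m) \<times> (real^'m) \<Rightarrow> complex)"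
proof (rule ext, clarify)
  fix A :: "real^'d^'m" and t
  show "on_t (multiplier m) (kplane \<phi>) (A, t) = kplane \<psi> (A, t)"
  proof (cases "A \<in> stiefel")
    case True
    have "fourier_inv (\<lambda>\<omega>. m \<omega> * fourier \<phi> (\<omega> v* A)) t = kplane \<psi> (A, t)"
      using fourier_inv_slice[OF True \<psi>, of t] by (simp add: eq[OF True])
    then show ?thesis
      using True \<phi> by (simp add: on_t_def multiplier_def fourier_kplane schwartz_integrable)
  next
    case False
    then have "(\<lambda>s. kplane \<phi> (A, s)) = (\<lambda>s. 0)"
      by (simp add: kplane_def)
    with False show ?thesis
      by (simp add: on_t_def multiplier_def fourier_inv_def kplane_def)
  qed
qed

text \<open>By \<open>fourier_filter\<close> the outer transform undoes the inverse transform inside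
  the filter, so the two symbols just multiply, and they commute.\<close>

lemma on_t_multiplier_filter_K:
  fixes \<phi> \<psi> :: "real^'d \<Rightarrow> complex" and m :: "real^'m \<Rightarrow> complex"
  assumes \<phi>: "\<phi> \<in> schwartz_space" and \<psi>: "\<psi> \<in> schwartz_space"
    and eq: "\<And>(A :: real^'d^'m) \<omega>. A \<in> stiefel \<Longrightarrow> fourier \<psi> (\<omega> v* A) = m \<omega> * fourier \<phi> (\<omega> v* A)"
  shows "on_t (multiplier m) (filter_K k (kplane \<phi>)) =
    (filter_K k (kplane \<psi>) :: (real^'d^'m) \<times> (real^'m) \<Rightarrow> complex)"
proof (rule ext, clarify)
  fix A :: "real^'d^'m" and t
  show "on_t (multiplier m) (filter_K k (kplane \<phi>)) (A, t) = filter_K k (kplane \<psi>) (A, t)"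
  proof (cases "A \<in> stiefel")
    case True
    then show ?thesis
      using fourier_filter[OF True \<phi>, of "filter_const CARD('d) k" k]
      by (simp add: on_t_def multiplier_def filter_K_kplane \<phi> \<psi> eq mult_ac)
  qed (simp add: on_t_def multiplier_def filter_K_kplane \<phi> \<psi> fourier_inv_def)
qed

lemma fourier_inv_lincomb:
  assumes "integrable lborel f" "integrable lborel g"
  shows "fourier_inv (\<lambda>\<xi>. a * f \<xi> + b * g \<xi>) x = a * fourier_inv f x + b * fourier_inv g x"
  using assms by (simp add: fourier_inv_eq fourier_add fourier_cmult add_divide_distrib)

lemma filter_K_lincomb:
  fixes p :: "(real^'d^'m) \<times> (real^'m)"
  assumes \<phi>: "\<phi> \<in> schwartz_space" and \<psi>: "\<psi> \<in> schwartz_space"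
  shows "filter_K k (kplane (\<lambda>x. a * \<phi> x + b * \<psi> x)) p
    = a * filter_K k (kplane \<phi>) p + b * filter_K k (kplane \<psi>) p"
proof (cases p)
  case (Pair A t)
  show ?thesis
  proof (cases "A \<in> stiefel")
    case True
    let ?w = "\<lambda>\<omega>::real^'m. complex_of_real (filter_const CARD('d) k * norm \<omega> ^ k)"
    have "fourier (\<lambda>x. a * \<phi> x + b * \<psi> x) \<xi> = a * fourier \<phi> \<xi> + b * fourier \<psi> \<xi>" for \<xi>
      using \<phi> \<psi> by (intro bci_lincomb(2) rapid_bci schwartz_rapid)
    then have "(\<lambda>\<omega>. ?w \<omega> * fourier (\<lambda>x. a * \<phi> x + b * \<psi> x) (\<omega> v* A))
        = (\<lambda>\<omega>. a * (?w \<omega> * fourier \<phi> (\<omega> v* A)) + b * (?w \<omega> * fourier \<psi> (\<omega> v* A)))"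
      by (simp add: fun_eq_iff algebra_simps)
    then show ?thesis
      using True \<phi> \<psi>
      by (simp only: Pair filter_K_kplane schwartz_lincomb if_True
          fourier_inv_lincomb[OF rapid_integrable[OF rapid_filter[OF True \<phi>]] rapid_integrable[OF rapid_filter[OF True \<psi>]]])
  qed (simp add: Pair filter_K_kplane schwartz_lincomb \<phi> \<psi>)
qed

lemma fourier_inv_fourier_schwartz:
  "\<phi> \<in> schwartz_space \<Longrightarrow> fourier_inv (fourier \<phi>) = \<phi>"
  by (intro fourier_inversion rapid_bci rapid_integrable fourier_rapid schwartz_rapid)

text \<open>In the paper \<open>C = 1\<close>. Its value is irrelevant for the intertwining relations.\<close>

lemma kplane_dual_filter_K:
  fixes \<sigma> :: "(real^'d^'m) measure"
  assumes dim: "CARD('m) + k = CARD('d)" and \<sigma>: "stiefel_haar k \<sigma>"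
  obtains C where "\<And>\<phi>. \<phi> \<in> schwartz_space \<Longrightarrow> kplane_dual \<sigma> (filter_K k (kplane \<phi>)) = (\<lambda>x. C * \<phi> x)"
proof -
  have [measurable_cong]: "sets \<sigma> = sets borel"
    using \<sigma> by (simp add: stiefel_haar_def)
  obtain c where c: "\<And>\<phi> x. \<phi> \<in> schwartz_space \<Longrightarrow>
    (\<integral>A. (\<integral>\<omega>. of_real (norm \<omega> ^ k) * (fourier \<phi> (\<omega> v* A) * exp (\<i> * of_real ((\<omega> v* A) \<bullet> x))) \<partial>lborel) \<partial>\<sigma>)
      = of_real c * (\<integral>\<xi>. fourier \<phi> \<xi> * exp (\<i> * of_real (\<xi> \<bullet> x)) \<partial>lborel)"
    using stiefel_haar_average[OF dim \<sigma>] by blast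
  let ?n = "complex_of_real ((2 * pi) ^ CARD('m))" and ?N = "complex_of_real ((2 * pi) ^ CARD('d))"
  let ?c0 = "complex_of_real (filter_const CARD('d) k)"
  \<comment> \<open>The powers of \<open>2 * pi\<close> belong to the inverse transforms on the
    transverse and on the full space; \<open>c\<close> is the constant of
    \<open>stiefel_haar_average\<close>.\<close>
  have "kplane_dual \<sigma> (filter_K k (kplane \<phi>)) x = ?c0 / ?n * (of_real c * ?N) * \<phi> x"
    if \<phi>: "\<phi> \<in> schwartz_space" for \<phi> x
  proof -
    note [measurable] = rapidD(2)[OF fourier_rapid[OF \<phi>]]
    let ?R = "\<lambda>A. \<integral>\<omega>. of_real (norm \<omega> ^ k) * (fourier \<phi> (\<omega> v* A) * exp (\<i> * of_real ((\<omega> v* A) \<bullet> x))) \<partial>lborel"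
    have R: "?R \<in> borel_measurable \<sigma>"
      by measurable
    have "filter_K k (kplane \<phi>) (A, A *v x) = indicator stiefel A * (?c0 / ?n * ?R A)" for A :: "real^'d^'m"
    proof (cases "A \<in> stiefel")
      case True
      have "of_real (filter_const CARD('d) k * norm \<omega> ^ k) * fourier \<phi> (\<omega> v* A) * exp (\<i> * of_real (\<omega> \<bullet> (A *v x)))
        = ?c0 * (of_real (norm \<omega> ^ k) * (fourier \<phi> (\<omega> v* A) * exp (\<i> * of_real ((\<omega> v* A) \<bullet> x))))" for \<omega>
        by (simp add: dot_lmul_matrix mult_ac)
      then have "(\<integral>\<omega>. of_real (filter_const CARD('d) k * norm \<omega> ^ k) * fourier \<phi> (\<omega> v* A) * exp (\<i> * of_real (\<omega> \<bullet> (A *v x))) \<partial>lborel)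
        = ?c0 * ?R A"
        by (simp only: integral_mult_right_zero)
      with True show ?thesis
        by (simp only: filter_K_kplane[OF \<phi>] fourier_inv_def) simp
    qed (simp add: filter_K_kplane \<phi>)
    then have "kplane_dual \<sigma> (filter_K k (kplane \<phi>)) x = (\<integral>A. indicator stiefel A * (?c0 / ?n * ?R A) \<partial>\<sigma>)"
      unfolding kplane_dual_def by presburger
    also have "\<dots> = (\<integral>A. ?c0 / ?n * ?R A \<partial>\<sigma>)"
    proof (rule integral_cong_AE)
      show "AE A in \<sigma>. indicator stiefel A * (?c0 / ?n * ?R A) = ?c0 / ?n * ?R A"
        using stiefel_haar_AE[OF \<sigma>] by eventually_elim simp
    qed (use R in measurable)
    also have "\<dots> = ?c0 / ?n * (of_real c * (\<integral>\<xi>. fourier \<phi> \<xi> * exp (\<i> * of_real (\<xi> \<bullet> x)) \<partial>lborel))"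
      by (simp only: integral_mult_right_zero c[OF \<phi>])
    also have "(\<integral>\<xi>. fourier \<phi> \<xi> * exp (\<i> * of_real (\<xi> \<bullet> x)) \<partial>lborel) = ?N * \<phi> x"
      using fun_cong[OF fourier_inv_fourier_schwartz[OF \<phi>], of x] by (simp add: fourier_inv_def field_simps)
    finally show ?thesis
      by (simp add: mult.assoc)
  qed
  then show thesis
    by (intro that[of "?c0 / ?n * (of_real c * ?N)"] ext)
qed

section \<open>Gaussians are Schwartz functions\<close>

text \<open>Polynomials as the coefficients that occur in derivatives of a Gaussian. Generating them
  inductively gives growth, differentiability and closure under derivatives by one induction
  each.\<close>

inductive poly_fun :: "('a::euclidean_space \<Rightarrow> complex) \<Rightarrow> bool" where
  const: "poly_fun (\<lambda>x. c)"
| coord: "poly_fun (\<lambda>x. of_real (x \<bullet> b))"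
| add: "poly_fun p \<Longrightarrow> poly_fun q \<Longrightarrow> poly_fun (\<lambda>x. p x + q x)"
| mult: "poly_fun p \<Longrightarrow> poly_fun q \<Longrightarrow> poly_fun (\<lambda>x. p x * q x)"

lemma poly_bounded_add:
  assumes "poly_bounded m" "poly_bounded n"
  shows "poly_bounded (\<lambda>x. m x + n x)"
proof -
  obtain C M D N where C: "\<And>x. norm (m x) \<le> C * (1 + (norm x)\<^sup>2) ^ M"
    and D: "\<And>x. norm (n x) \<le> D * (1 + (norm x)\<^sup>2) ^ N"
    using assms unfolding poly_bounded_def by metis
  have "norm (m x + n x) \<le> (\<bar>C\<bar> + \<bar>D\<bar>) * (1 + (norm x)\<^sup>2) ^ (M + N)" for x
  proof -
    have "C * (1 + (norm x)\<^sup>2) ^ M \<le> \<bar>C\<bar> * (1 + (norm x)\<^sup>2) ^ (M + N)"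
      "D * (1 + (norm x)\<^sup>2) ^ N \<le> \<bar>D\<bar> * (1 + (norm x)\<^sup>2) ^ (M + N)"
      by (intro mult_mono power_increasing; simp)+
    then show ?thesis
      unfolding distrib_right using norm_triangle_ineq[of "m x" "n x"] C[of x] D[of x] by linarith
  qed
  then show ?thesis
    using assms by (auto simp: poly_bounded_def intro!: continuous_intros)
qed

lemma poly_fun_poly_bounded: "poly_fun p \<Longrightarrow> poly_bounded p"
  by (induction rule: poly_fun.induct)
     (auto intro: poly_bounded_const poly_bounded_inner poly_bounded_add poly_bounded_mult)

lemma poly_fun_differentiable: "poly_fun p \<Longrightarrow> p differentiable (at x)"
proof (induction rule: poly_fun.induct)
  case (coord b)
  show ?case
    by (auto simp: differentiable_def intro!: derivative_intros exI)
qed (auto intro!: derivative_intros)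

lemma poly_fun_deriv:
  assumes "poly_fun p"
  shows "\<exists>p'. poly_fun p' \<and> (\<forall>x. ((\<lambda>s. p (x + s *\<^sub>R b)) has_vector_derivative p' x) (at 0))"
  using assms
proof (induction rule: poly_fun.induct)
  case (const c)
  show ?case
    by (intro exI[of _ "\<lambda>x. 0"] conjI poly_fun.const) simp
next
  case (coord a)
  have "((\<lambda>s. complex_of_real ((x + s *\<^sub>R b) \<bullet> a)) has_vector_derivative of_real (b \<bullet> a)) (at 0)" for x
    by (auto intro!: derivative_eq_intros simp: inner_add_left has_vector_derivative_def scaleR_conv_of_real)
  then show ?case
    by (intro exI[of _ "\<lambda>x. of_real (b \<bullet> a)"] conjI poly_fun.const allI)
next
  case (add p q)
  then obtain p' q' where "poly_fun p'" "poly_fun q'"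
    "\<And>x. ((\<lambda>s. p (x + s *\<^sub>R b)) has_vector_derivative p' x) (at 0)"
    "\<And>x. ((\<lambda>s. q (x + s *\<^sub>R b)) has_vector_derivative q' x) (at 0)"
    by blast
  then show ?case
    by (intro exI[of _ "\<lambda>x. p' x + q' x"] conjI poly_fun.add allI has_vector_derivative_add)
next
  case (mult p q)
  then obtain p' q' where d: "poly_fun p'" "poly_fun q'"
    "\<And>x. ((\<lambda>s. p (x + s *\<^sub>R b)) has_vector_derivative p' x) (at 0)"
    "\<And>x. ((\<lambda>s. q (x + s *\<^sub>R b)) has_vector_derivative q' x) (at 0)"
    by blast
  have "((\<lambda>s. p (x + s *\<^sub>R b) * q (x + s *\<^sub>R b)) has_vector_derivative p x * q' x + p' x * q x) (at 0)" for x
    using has_vector_derivative_mult[OF d(3)[of x] d(4)[of x]] by simp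
  then show ?case
    using mult d by (intro exI[of _ "\<lambda>x. p x * q' x + p' x * q x"] conjI poly_fun.intros allI)
qed

text \<open>Centre and width are free, for testing at arbitrary points and scales. The inner product
  in the exponent, in place of a squared norm, is differentiated by the product rule.\<close>

definition gauss_at :: "real \<Rightarrow> 'a::euclidean_space \<Rightarrow> 'a \<Rightarrow> complex" where
  "gauss_at a x0 x = of_real (exp (- (a * ((x - x0) \<bullet> (x - x0)))))"

lemma gauss_at_deriv:
  "((\<lambda>s. gauss_at a x0 (x + s *\<^sub>R b)) has_vector_derivative
      (of_real (- 2 * a) * (of_real (x \<bullet> b) + of_real (- (x0 \<bullet> b)))) * gauss_at a x0 x) (at 0)"
proof -
  have "((\<lambda>s. exp (- (a * ((x + s *\<^sub>R b - x0) \<bullet> (x + s *\<^sub>R b - x0))))) has_real_derivative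
      exp (- (a * ((x - x0) \<bullet> (x - x0)))) * (- (2 * a * ((x - x0) \<bullet> b)))) (at 0)"
    by (auto intro!: derivative_eq_intros simp: has_field_derivative_def fun_eq_iff inner_commute algebra_simps)
  from has_vector_derivative_of_real[where 'a=complex, OF this] show ?thesis
    unfolding gauss_at_def by (rule has_vector_derivative_eq_rhs) (simp add: algebra_simps)
qed

lemma gauss_at_differentiable: "gauss_at a x0 differentiable (at x)"
proof -
  have "((\<lambda>x. exp (- (a * ((x - x0) \<bullet> (x - x0))))) has_derivative
      (\<lambda>h. exp (- (a * ((x - x0) \<bullet> (x - x0)))) * - (a * ((x - x0) \<bullet> h + h \<bullet> (x - x0))))) (at x)"
    by (auto intro!: derivative_eq_intros)
  from has_derivative_of_real[where 'a=complex, OF this] show ?thesis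
    unfolding gauss_at_def[abs_def] differentiable_def by blast
qed

lemma gauss_at_rapid:
  fixes x0 :: "'a::euclidean_space"
  assumes a: "a > 0"
  shows "rapid (gauss_at a x0)"
  unfolding rapid_def
proof (intro conjI allI)
  show "continuous_on UNIV (gauss_at a x0)"
    unfolding gauss_at_def[abs_def] by (intro continuous_intros)
  fix N
  \<comment> \<open>From \<open>z \<le> exp z\<close> at
    \<open>z = a * (1 + y) / real (Suc N)\<close>, raised to the power \<open>Suc N\<close>;
    \<open>exp a\<close> is what remains of \<open>exp (a * (1 + y))\<close> after division by
    \<open>exp (a * y)\<close>.\<close>
  define K where "K = (real (Suc N) / a) ^ Suc N * exp a"
  have 1: "(1 + y) ^ N * exp (- (a * y)) \<le> K" if y: "y \<ge> 0" for y
  proof -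
    have "a * (1 + y) / real (Suc N) \<le> exp (a * (1 + y) / real (Suc N))"
      using exp_ge_add_one_self[of "a * (1 + y) / real (Suc N)"] by linarith
    then have "(1 + y) \<le> real (Suc N) / a * exp (a * (1 + y) / real (Suc N))"
      using a by (simp add: field_simps)
    then have "(1 + y) ^ Suc N \<le> (real (Suc N) / a * exp (a * (1 + y) / real (Suc N))) ^ Suc N"
      using y by (intro power_mono) auto
    also have "\<dots> = (real (Suc N) / a) ^ Suc N * exp (a * (1 + y))"
      unfolding power_mult_distrib exp_of_nat_mult[symmetric] by simp
    finally have "(1 + y) ^ Suc N * exp (- (a * y)) \<le> K"
      using mult_right_mono[of "(1 + y) ^ Suc N" _ "exp (- (a * y))"]
      by (fastforce simp: K_def distrib_left exp_add exp_minus field_simps)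
    moreover have "(1 + y) ^ N * exp (- (a * y)) \<le> (1 + y) ^ Suc N * exp (- (a * y))"
      using y by (intro mult_right_mono power_increasing) auto
    ultimately show ?thesis by linarith
  qed
  have "norm (gauss_at a x0 x) * (1 + (norm x)\<^sup>2) ^ N \<le> (2 * (1 + (norm x0)\<^sup>2)) ^ N * K" for x
  proof -
    have "norm x \<le> norm x0 + norm (x - x0)"
      using norm_triangle_ineq[of x0 "x - x0"] by simp
    then have "(norm x)\<^sup>2 \<le> (norm x0 + norm (x - x0))\<^sup>2"
      by (intro power_mono) auto
    moreover have "0 \<le> (norm x0 - norm (x - x0))\<^sup>2" "0 \<le> (norm x0 * norm (x - x0))\<^sup>2"
      by simp_all
    \<comment> \<open>Peetre's inequality in abstract form: \<open>u\<close> and \<open>v\<close>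
      stand for the squared norms of \<open>x0\<close> and \<open>x - x0\<close>, and
      \<open>w\<close> for the product of the norms.\<close>
    moreover have "1 + (norm x)\<^sup>2 \<le> 2 * ((1 + u) * (1 + v))"
      if "(norm x)\<^sup>2 \<le> u + v + 2 * w" "0 \<le> u + v - 2 * w" "0 \<le> u * v" for u v w
      using that by (simp add: algebra_simps)
    ultimately have "1 + (norm x)\<^sup>2 \<le> 2 * ((1 + (norm x0)\<^sup>2) * (1 + (norm (x - x0))\<^sup>2))"
      unfolding power2_sum power2_diff power_mult_distrib by (simp add: mult.assoc)
    then have "1 + (norm x)\<^sup>2 \<le> 2 * (1 + (norm x0)\<^sup>2) * (1 + (norm (x - x0))\<^sup>2)"
      by (simp only: mult.assoc)
    then have "(1 + (norm x)\<^sup>2) ^ N \<le> (2 * (1 + (norm x0)\<^sup>2) * (1 + (norm (x - x0))\<^sup>2)) ^ N"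
      by (rule power_mono) simp
    also have "\<dots> = (2 * (1 + (norm x0)\<^sup>2)) ^ N * (1 + (norm (x - x0))\<^sup>2) ^ N"
      by (rule power_mult_distrib)
    finally have "norm (gauss_at a x0 x) * (1 + (norm x)\<^sup>2) ^ N
        \<le> norm (gauss_at a x0 x) * ((2 * (1 + (norm x0)\<^sup>2)) ^ N * (1 + (norm (x - x0))\<^sup>2) ^ N)"
      by (intro mult_left_mono) auto
    also have "\<dots> = (2 * (1 + (norm x0)\<^sup>2)) ^ N * ((1 + (norm (x - x0))\<^sup>2) ^ N * exp (- (a * (norm (x - x0))\<^sup>2)))"
      by (simp add: gauss_at_def power2_norm_eq_inner mult_ac)
    also have "\<dots> \<le> (2 * (1 + (norm x0)\<^sup>2)) ^ N * K"
      by (intro mult_left_mono 1) auto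
    finally show ?thesis .
  qed
  then show "\<exists>C. \<forall>x. norm (gauss_at a x0 x) * (1 + (norm x)\<^sup>2) ^ N \<le> C"
    by blast
qed

lemma gauss_at_schwartz:
  fixes x0 :: "'a::euclidean_space"
  assumes a: "a > 0"
  shows "gauss_at a x0 \<in> schwartz_space"
proof -
  have part: "\<exists>p. poly_fun p \<and> partials bs (gauss_at a x0) = (\<lambda>x. p x * gauss_at a x0 x)"
    if "bs \<in> lists Basis" for bs :: "'a list"
    using that
  proof (induction bs)
    case Nil
    show ?case
      by (intro exI[of _ "\<lambda>x. 1"] conjI poly_fun.const) simp
  next
    case (Cons b bs)
    then obtain p where p: "poly_fun p" "partials bs (gauss_at a x0) = (\<lambda>x. p x * gauss_at a x0 x)"
      by auto
    obtain p' where p': "poly_fun p'" "\<And>x. ((\<lambda>s. p (x + s *\<^sub>R b)) has_vector_derivative p' x) (at 0)"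
      using poly_fun_deriv[OF p(1), of b] by blast
    let ?l = "\<lambda>x. of_real (- 2 * a) * (of_real (x \<bullet> b) + of_real (- (x0 \<bullet> b))) :: complex"
    have "partials (b # bs) (gauss_at a x0) x = (p x * ?l x + p' x) * gauss_at a x0 x" for x
      unfolding partials_Cons p(2)
      by (rule partial_deriv_eqI[OF has_vector_derivative_eq_rhs[OF
            has_vector_derivative_mult[OF p'(2) gauss_at_deriv]]])
         (simp add: algebra_simps)
    moreover have "poly_fun (\<lambda>x. p x * ?l x + p' x)"
      by (intro poly_fun.intros p p')
    ultimately show ?case
      by blast
  qed
  show ?thesis
  proof (rule schwartzI)
    fix bs :: "'a list" assume "bs \<in> lists Basis"
    then obtain p where p: "poly_fun p" "partials bs (gauss_at a x0) = (\<lambda>x. p x * gauss_at a x0 x)"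
      using part by blast
    show "partials bs (gauss_at a x0) differentiable (at x)" for x
      unfolding p(2) by (intro derivative_intros poly_fun_differentiable p(1) gauss_at_differentiable)
    fix N
    have "rapid (partials bs (gauss_at a x0))"
      unfolding p(2) by (intro rapid_mult poly_fun_poly_bounded p(1) gauss_at_rapid a)
    then obtain C where C: "\<And>x. norm (partials bs (gauss_at a x0) x) * (1 + (norm x)\<^sup>2) ^ N \<le> C"
      using rapidD(3) by blast
    have "(1 + norm x) ^ N * cmod (partials bs (gauss_at a x0) x) \<le> 2 ^ N * C" for x
    proof -
      have "(1 + norm x) ^ N * cmod (partials bs (gauss_at a x0) x)
          \<le> 2 ^ N * (cmod (partials bs (gauss_at a x0) x) * (1 + (norm x)\<^sup>2) ^ N)"
        using mult_right_mono[OF one_plus_norm_power_le, of "cmod (partials bs (gauss_at a x0) x)" x N]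
        by (simp add: mult_ac)
      also have "\<dots> \<le> 2 ^ N * C"
        by (intro mult_left_mono C) simp
      finally show ?thesis .
    qed
    then show "\<exists>B. \<forall>x. (1 + norm x) ^ N * cmod (partials bs (gauss_at a x0) x) \<le> B"
      by blast
  qed
qed

text \<open>Testing against ever narrower Gaussians centred at \<open>x\<close> recovers the value
  of \<open>u\<close> there.\<close>

lemma schwartz_separates:
  fixes u :: "'a::euclidean_space \<Rightarrow> complex"
  assumes u: "continuous_on UNIV u" "bounded (range u)"
    and 0: "\<And>\<theta>. \<theta> \<in> schwartz_space \<Longrightarrow> (\<integral>x. \<theta> x * u x \<partial>lborel) = 0"
  shows "u x = 0"
proof -
  have [measurable]: "u \<in> borel_measurable borel"
    using u(1) by (rule borel_measurable_continuous_onI)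
  have "(\<integral>y. of_real (gauss y) * u (x + inverse (real (Suc n)) *\<^sub>R y) \<partial>lborel) = 0" for n
  proof -
    define e where "e = inverse (real (Suc n))"
    \<comment> \<open>Chosen so that \<open>gauss_at a x\<close> at \<open>x + e *\<^sub>R y\<close>
      is the standard Gaussian in \<open>y\<close>.\<close>
    define a where "a = 1 / (2 * e\<^sup>2)"
    have e: "e > 0"
      by (simp add: e_def)
    then have a: "a > 0"
      by (simp add: a_def)
    have [measurable]: "gauss_at a x \<in> borel_measurable borel"
      by (rule rapidD(2)[OF gauss_at_rapid[OF a]])
    have g: "gauss_at a x (x + e *\<^sub>R y) = of_real (gauss y)" for y
      using e by (simp add: gauss_at_def gauss_def a_def dot_square_norm field_simps power2_eq_square)
    have "0 = (\<integral>y. gauss_at a x y * u y \<partial>lborel)"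
      by (rule 0[OF gauss_at_schwartz[OF a], symmetric])
    also have "\<dots> = of_real (\<bar>e\<bar> ^ DIM('a)) * (\<integral>y. gauss_at a x (x + e *\<^sub>R y) * u (x + e *\<^sub>R y) \<partial>lborel)"
      by (rule lborel_integral_affine) (use e in simp_all)
    finally show ?thesis
      using e unfolding g e_def[symmetric] by simp
  qed
  then have "(\<lambda>n. 0) \<longlonglongrightarrow> of_real (sqrt (2 * pi) ^ DIM('a)) * u x"
    using approx_identity[OF u, of x] by (simp only:)
  then have "of_real (sqrt (2 * pi) ^ DIM('a)) * u x = 0"
    by (rule LIMSEQ_unique[OF _ tendsto_const])
  then show ?thesis
    by simp
qed

section \<open>Duality\<close>

lemma topspace_seminorm_topology:
  assumes "I \<noteq> {}" "\<And>i. i \<in> I \<Longrightarrow> p i (\<lambda>x. 0) \<le> 0"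
  shows "topspace (seminorm_topology X I p) = X"
proof -
  have "f \<in> \<Union> {{g \<in> X. p i (\<lambda>x. g x - f x) < e} |i f e. i \<in> I \<and> f \<in> X \<and> e > 0}" if f: "f \<in> X" for f
  proof -
    obtain i where i: "i \<in> I" using assms(1) by blast
    have "p i (\<lambda>x. f x - f x) < 1"
      using assms(2)[OF i] by simp
    then show ?thesis
      using i f by (intro UnionI[of "{g \<in> X. p i (\<lambda>x. g x - f x) < 1}"]) (auto intro!: exI[of _ i] exI[of _ f] exI[of _ 1])
  qed
  then show ?thesis
    by (auto simp: seminorm_topology_def topology_generated_by_topspace)
qed

lemma openin_seminorm_ball:
  "i \<in> I \<Longrightarrow> f \<in> X \<Longrightarrow> e > 0 \<Longrightarrow> openin (seminorm_topology X I p) {g \<in> X. p i (\<lambda>x. g x - f x) < e}"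
  unfolding seminorm_topology_def by (rule topology_generated_by_Basis) blast

lemma schwartz_eq: "schwartz = seminorm_topology schwartz_space (UNIV \<times> lists Basis) (\<lambda>(N, bs). seminorm N bs)"
  unfolding schwartz_def seminorm_def[abs_def] ..

lemma seminorm_zero:
  fixes bs :: "'a::euclidean_space list"
  assumes "bs \<in> lists Basis"
  shows "seminorm N bs (\<lambda>x. 0) \<le> 0"
  using seminorm_lincomb[OF schwartz_zero schwartz_zero assms, of N 0 0] by simp

lemma topspace_schwartz [simp]: "topspace schwartz = schwartz_space"
  unfolding schwartz_eq by (rule topspace_seminorm_topology) (auto intro: seminorm_zero)

lemma dominated_neighbourhood:
  assumes q: "dominated q" and f: "f \<in> schwartz_space" and r: "r > 0"
  shows "\<exists>T. openin schwartz T \<and> f \<in> T \<and> (\<forall>g\<in>T. q (\<lambda>x. g x - f x) < r)"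
proof -
  obtain C F where F: "C \<ge> 0" "finite F" "F \<subseteq> UNIV \<times> lists Basis"
      "\<And>f. f \<in> schwartz_space \<Longrightarrow> q f \<le> C * (\<Sum>(N, bs)\<in>F. seminorm N bs f)"
    using q unfolding dominated_def by metis
  \<comment> \<open>The summand 1 keeps the denominator positive when \<open>C\<close> or
    \<open>card F\<close> is 0, and it makes the final estimate strict.\<close>
  define \<delta> where "\<delta> = r / (C * real (card F) + 1)"
  have C1: "C * real (card F) + 1 > 0"
    using F(1) by (intro add_nonneg_pos mult_nonneg_nonneg) auto
  then have \<delta>: "\<delta> > 0"
    using r by (simp add: \<delta>_def)
  define B where "B i = {g \<in> schwartz_space. (case i of (N, bs) \<Rightarrow> seminorm N bs) (\<lambda>x. g x - f x) < \<delta>}" for i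
  have "openin schwartz (B i)" if "i \<in> F" for i
    unfolding B_def schwartz_eq using that F(3) f \<delta> by (intro openin_seminorm_ball) auto
  then have "openin schwartz ((\<Inter>i\<in>F. B i) \<inter> topspace schwartz)"
    by (intro openin_INT F(2))
  moreover have "f \<in> (\<Inter>i\<in>F. B i) \<inter> topspace schwartz"
  proof -
    have "f \<in> B i" if "i \<in> F" for i
    proof -
      obtain N bs where i: "i = (N, bs)"
        by (cases i)
      then have "bs \<in> lists Basis"
        using that F(3) by blast
      then show ?thesis
        using f seminorm_zero[of bs N] \<delta> by (simp add: B_def i)
    qed
    with f show ?thesis by auto
  qed
  moreover have "q (\<lambda>x. g x - f x) < r" if g: "g \<in> (\<Inter>i\<in>F. B i) \<inter> topspace schwartz" for g
  proof -
    have "q (\<lambda>x. g x - f x) \<le> C * (\<Sum>(N, bs)\<in>F. seminorm N bs (\<lambda>x. g x - f x))"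
      using g f by (intro F(4) schwartz_diff) auto
    also have "(\<Sum>(N, bs)\<in>F. seminorm N bs (\<lambda>x. g x - f x)) \<le> (\<Sum>i\<in>F. \<delta>)"
      using g by (intro sum_mono) (auto simp: B_def less_imp_le)
    then have "C * (\<Sum>(N, bs)\<in>F. seminorm N bs (\<lambda>x. g x - f x)) \<le> C * (\<Sum>i\<in>F. \<delta>)"
      using F(1) by (rule mult_left_mono)
    also have "\<dots> < r"
    proof -
      have "C * (\<Sum>i\<in>F. \<delta>) < (C * real (card F) + 1) * \<delta>"
        using \<delta> by (simp add: distrib_right mult.assoc)
      also have "\<dots> = r"
        using C1 by (simp add: \<delta>_def)
      finally show ?thesis .
    qed
    finally show ?thesis .
  qed
  ultimately show ?thesis
    by blast
qed

lemma continuous_functional_schwartz: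
  fixes v :: "('a::euclidean_space \<Rightarrow> complex) \<Rightarrow> complex"
  assumes "dominated (\<lambda>f. cmod (v f))"
    and lin: "\<And>f g. f \<in> schwartz_space \<Longrightarrow> g \<in> schwartz_space \<Longrightarrow> v (\<lambda>x. f x - g x) = v f - v g"
  shows "continuous_map schwartz euclidean v"
  unfolding continuous_map_def
proof (intro conjI allI impI)
  fix U :: "complex set" assume "openin euclidean U"
  then have U: "open U" by simp
  show "openin schwartz {f \<in> topspace schwartz. v f \<in> U}"
  proof (subst openin_subopen, clarsimp)
    fix f :: "'a \<Rightarrow> complex" assume f: "f \<in> schwartz_space" "v f \<in> U"
    then obtain r where r: "r > 0" "ball (v f) r \<subseteq> U"
      using U open_contains_ball by blast
    obtain T where T: "openin schwartz T" "f \<in> T" "\<And>g. g \<in> T \<Longrightarrow> cmod (v (\<lambda>x. g x - f x)) < r"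
      using dominated_neighbourhood[OF assms(1) f(1) r(1)] by blast
    have sub: "T \<subseteq> schwartz_space"
      using openin_subset[OF T(1)] by simp
    have "v g \<in> U" if "g \<in> T" for g
      using T(3)[OF that] r(2) lin[of g f] that sub f(1)
      by (intro subsetD[OF r(2)]) (auto simp: dist_norm norm_minus_commute)
    then show "\<exists>T. openin schwartz T \<and> f \<in> T \<and> T \<subseteq> {f \<in> schwartz_space. v f \<in> U}"
      using T sub by blast
  qed
qed auto

text \<open>The balls of the subbase have arbitrary centres \<open>a\<close>, so smallness near
  \<open>f\<close> must be carried over by a triangle inequality. It is demanded on \<open>Y\<close>
  only, where suprema are finite.\<close>

lemma continuous_operator_schwartz:
  assumes T: "\<And>f. f \<in> schwartz_space \<Longrightarrow> T f \<in> Y" and J: "J \<noteq> {}"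
    and lin: "\<And>f g. f \<in> schwartz_space \<Longrightarrow> g \<in> schwartz_space \<Longrightarrow> T (\<lambda>x. f x - g x) = (\<lambda>y. T f y - T g y)"
    and dom: "\<And>j. j \<in> J \<Longrightarrow> dominated (\<lambda>f. q j (T f))"
    and tri: "\<And>j a b c. j \<in> J \<Longrightarrow> a \<in> Y \<Longrightarrow> b \<in> Y \<Longrightarrow> c \<in> Y \<Longrightarrow>
      q j (\<lambda>y. a y - c y) \<le> q j (\<lambda>y. a y - b y) + q j (\<lambda>y. b y - c y)"
    and zero: "\<And>j. j \<in> J \<Longrightarrow> q j (\<lambda>y. 0) \<le> 0"
  shows "continuous_map schwartz (seminorm_topology Y J q) T"
  unfolding seminorm_topology_def
proof (rule continuous_on_generated_topo)
  show "T ` topspace schwartz \<subseteq> \<Union> {{g \<in> Y. q j (\<lambda>y. g y - a y) < e} |j a e. j \<in> J \<and> a \<in> Y \<and> e > 0}"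
    using topspace_seminorm_topology[of J q Y, OF J zero] T
    by (auto simp: seminorm_topology_def topology_generated_by_topspace)
  fix V assume "V \<in> {{g \<in> Y. q j (\<lambda>y. g y - a y) < e} |j a e. j \<in> J \<and> a \<in> Y \<and> e > 0}"
  then obtain j a e where V: "V = {g \<in> Y. q j (\<lambda>y. g y - a y) < e}" and j: "j \<in> J" and a: "a \<in> Y" and e: "e > 0"
    by blast
  show "openin schwartz (T -` V \<inter> topspace schwartz)"
  proof (subst openin_subopen, intro ballI)
    fix f assume "f \<in> T -` V \<inter> topspace schwartz"
    then have f: "T f \<in> V" "f \<in> schwartz_space"
      by auto
    then have "e - q j (\<lambda>y. T f y - a y) > 0"
      by (simp add: V)
    from dominated_neighbourhood[OF dom[OF j] f(2) this]
    obtain W where W: "openin schwartz W" "f \<in> W"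
      "\<And>g. g \<in> W \<Longrightarrow> q j (T (\<lambda>x. g x - f x)) < e - q j (\<lambda>y. T f y - a y)"
      by blast
    have sub: "W \<subseteq> schwartz_space"
      using openin_subset[OF W(1)] by simp
    have "T g \<in> V" if g: "g \<in> W" for g
    proof -
      have gS: "g \<in> schwartz_space" using g sub by blast
      have "q j (\<lambda>y. T g y - a y) \<le> q j (\<lambda>y. T g y - T f y) + q j (\<lambda>y. T f y - a y)"
        by (intro tri j a T gS f(2))
      also have "q j (\<lambda>y. T g y - T f y) < e - q j (\<lambda>y. T f y - a y)"
        using W(3)[OF g] by (simp add: lin[OF gS f(2)])
      finally show ?thesis
        using T[OF gS] by (simp add: V)
    qed
    then show "\<exists>W. openin schwartz W \<and> f \<in> W \<and> W \<subseteq> T -` V \<inter> topspace schwartz"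
      using W sub by auto
  qed
qed

section \<open>Linear functionals and the weak-* topology\<close>

lemma dualI:
  assumes "u \<in> extensional (topspace T)" "continuous_map T euclidean u"
    "\<And>f g. f \<in> topspace T \<Longrightarrow> g \<in> topspace T \<Longrightarrow> u (\<lambda>x. f x + g x) = u f + u g"
    "\<And>c f. f \<in> topspace T \<Longrightarrow> u (\<lambda>x. c * f x) = c * u f"
  shows "u \<in> dual T"
  using assms by (simp add: dual_def)

lemma dualD:
  assumes "u \<in> dual T"
  shows "u \<in> extensional (topspace T)" "continuous_map T euclidean u"
    "f \<in> topspace T \<Longrightarrow> g \<in> topspace T \<Longrightarrow> u (\<lambda>x. f x + g x) = u f + u g"
    "f \<in> topspace T \<Longrightarrow> u (\<lambda>x. c * f x) = c * u f"
  using assms by (simp_all add: dual_def)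

lemma continuous_map_restrict_cong:
  "continuous_map T euclidean u \<Longrightarrow> continuous_map T euclidean (restrict u (topspace T))"
  by (rule continuous_map_eq) auto

lemma dual_lincomb:
  assumes f: "f \<in> dual schwartz" and g: "g \<in> dual schwartz"
  shows "(\<lambda>\<phi>\<in>topspace schwartz. c * f \<phi> + g \<phi>) \<in> dual schwartz"
proof (rule dualI)
  have "continuous_map schwartz euclidean ((\<lambda>z. c * fst z + snd z) \<circ> (\<lambda>\<phi>. (f \<phi>, g \<phi>)))"
  proof (rule continuous_map_compose)
    show "continuous_map schwartz (prod_topology euclidean euclidean) (\<lambda>\<phi>. (f \<phi>, g \<phi>))"
      using dualD(2)[OF f] dualD(2)[OF g] by (rule continuous_map_pairedI)
    show "continuous_map (prod_topology euclidean euclidean) euclidean (\<lambda>z. c * fst z + snd z)"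
      by (simp add: euclidean_product_topology) (intro continuous_intros)
  qed
  then show "continuous_map schwartz euclidean (\<lambda>\<phi>\<in>topspace schwartz. c * f \<phi> + g \<phi>)"
    by (intro continuous_map_restrict_cong) (simp add: comp_def)
qed (use dualD(3,4)[OF f] dualD(3,4)[OF g] in \<open>auto simp: schwartz_add schwartz_cmult algebra_simps\<close>)

lemma dual_schwartz_sum:
  assumes u: "u \<in> dual schwartz" and "finite F" "F \<subseteq> schwartz_space"
  shows "u (\<lambda>x. \<Sum>\<phi>\<in>F. c \<phi> * \<phi> x) = (\<Sum>\<phi>\<in>F. c \<phi> * u \<phi>)"
  using assms(2,3)
proof (induction F)
  case empty
  show ?case
    using dualD(4)[OF u, of "\<lambda>x. 0" 0] by (simp add: schwartz_zero)
next
  case (insert \<phi> F)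
  then show ?case
    using dualD(3)[OF u, of "\<lambda>x. c \<phi> * \<phi> x" "\<lambda>x. \<Sum>\<phi>\<in>F. c \<phi> * \<phi> x"] dualD(4)[OF u, of \<phi> "c \<phi>"]
    by (simp add: schwartz_cmult schwartz_sum subset_iff)
qed

text \<open>Induction on \<open>F\<close>. If some \<open>f0\<close> vanishes on \<open>F\<close>
  but not at \<open>\<phi>0\<close>, subtracting a multiple of evaluation at \<open>\<phi>0\<close>
  reduces the claim to \<open>F\<close>; otherwise vanishing on \<open>F\<close> already entails
  vanishing at \<open>\<phi>0\<close>.\<close>

lemma dual_functional_finite:
  fixes \<Lambda> :: "(('a::euclidean_space \<Rightarrow> complex) \<Rightarrow> complex) \<Rightarrow> complex"
  assumes "finite F" "F \<subseteq> schwartz_space"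
    and lin: "\<And>f g c. f \<in> dual schwartz \<Longrightarrow> g \<in> dual schwartz \<Longrightarrow>
      \<Lambda> (\<lambda>\<phi>\<in>topspace schwartz. c * f \<phi> + g \<phi>) = c * \<Lambda> f + \<Lambda> g"
    and ker: "\<And>f. f \<in> dual schwartz \<Longrightarrow> (\<And>\<phi>. \<phi> \<in> F \<Longrightarrow> f \<phi> = 0) \<Longrightarrow> \<Lambda> f = 0"
  shows "\<exists>c. \<forall>f\<in>dual schwartz. \<Lambda> f = (\<Sum>\<phi>\<in>F. c \<phi> * f \<phi>)"
  using assms
proof (induction F arbitrary: \<Lambda> rule: finite_induct)
  case empty
  then show ?case by simp
next
  case (insert \<phi>0 F)
  have \<phi>0: "\<phi>0 \<in> schwartz_space" and F: "F \<subseteq> schwartz_space"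
    using insert.prems(1) by auto
  show ?case
  proof (cases "\<forall>f\<in>dual schwartz. (\<forall>\<phi>\<in>F. f \<phi> = 0) \<longrightarrow> f \<phi>0 = 0")
    case True
    then have "\<Lambda> f = 0" if "f \<in> dual schwartz" "\<And>\<phi>. \<phi> \<in> F \<Longrightarrow> f \<phi> = 0" for f
      using insert.prems(3) that by blast
    then obtain c where c: "\<And>f. f \<in> dual schwartz \<Longrightarrow> \<Lambda> f = (\<Sum>\<phi>\<in>F. c \<phi> * f \<phi>)"
      using insert.IH[OF F insert.prems(2)] by blast
    then have "\<Lambda> f = (\<Sum>\<phi>\<in>insert \<phi>0 F. (c(\<phi>0 := 0)) \<phi> * f \<phi>)" if "f \<in> dual schwartz" for f
      using that insert.hyps by (auto intro!: sum.cong)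
    then show ?thesis by blast
  next
    case False
    then obtain f0 where f0: "f0 \<in> dual schwartz" "\<And>\<phi>. \<phi> \<in> F \<Longrightarrow> f0 \<phi> = 0" "f0 \<phi>0 \<noteq> 0"
      by blast
    define a where "a = \<Lambda> f0 / f0 \<phi>0"
    define \<Lambda>' where "\<Lambda>' f = \<Lambda> f - a * f \<phi>0" for f
    have "\<Lambda>' (\<lambda>\<phi>\<in>topspace schwartz. c * f \<phi> + g \<phi>) = c * \<Lambda>' f + \<Lambda>' g"
      if "f \<in> dual schwartz" "g \<in> dual schwartz" for f g c
      unfolding \<Lambda>'_def insert.prems(2)[OF that] using \<phi>0 by (simp add: algebra_simps)
    moreover have "\<Lambda>' f = 0" if f: "f \<in> dual schwartz" "\<And>\<phi>. \<phi> \<in> F \<Longrightarrow> f \<phi> = 0" for f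
    proof -
      let ?g = "\<lambda>\<phi>\<in>topspace schwartz. (- (f \<phi>0 / f0 \<phi>0)) * f0 \<phi> + f \<phi>"
      have "\<Lambda> ?g = 0"
      proof (rule insert.prems(3))
        show "?g \<in> dual schwartz"
          by (rule dual_lincomb[OF f0(1) f(1)])
        show "?g \<phi> = 0" if "\<phi> \<in> insert \<phi>0 F" for \<phi>
          using that f f0 \<phi>0 F by auto
      qed
      then have "- (f \<phi>0 / f0 \<phi>0) * \<Lambda> f0 + \<Lambda> f = 0"
        using insert.prems(2)[OF f0(1) f(1), of "- (f \<phi>0 / f0 \<phi>0)"] by (simp only:)
      then show ?thesis
        using f0(3) by (simp add: \<Lambda>'_def a_def field_simps)
    qed
    ultimately obtain c where c: "\<And>f. f \<in> dual schwartz \<Longrightarrow> \<Lambda>' f = (\<Sum>\<phi>\<in>F. c \<phi> * f \<phi>)"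
      using insert.IH[OF F, of \<Lambda>'] by blast
    have "\<Lambda> f = (\<Sum>\<phi>\<in>insert \<phi>0 F. (c(\<phi>0 := a)) \<phi> * f \<phi>)" if "f \<in> dual schwartz" for f
    proof -
      have "(\<Sum>\<phi>\<in>F. (c(\<phi>0 := a)) \<phi> * f \<phi>) = (\<Sum>\<phi>\<in>F. c \<phi> * f \<phi>)"
        using insert.hyps by (intro sum.cong) auto
      then show ?thesis
        using c[OF that] insert.hyps by (simp add: \<Lambda>'_def algebra_simps)
    qed
    then show ?thesis by blast
  qed
qed

lemma topspace_weak_star: "topspace (weak_star T) = dual T"
  by (auto simp: weak_star_def dual_def PiE_def)

text \<open>A basic neighbourhood of zero on which \<open>\<Lambda>\<close> stays below 1 constrains
  only finitely many coordinates. On functionals that vanish there \<open>\<Lambda>\<close> is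
  bounded, hence 0 by scaling; so it is a combination of evaluations, which by linearity is one
  evaluation.\<close>

lemma weak_star_functional:
  fixes \<Lambda> :: "(('a::euclidean_space \<Rightarrow> complex) \<Rightarrow> complex) \<Rightarrow> complex"
  assumes cont: "continuous_map (weak_star schwartz) euclidean \<Lambda>"
    and lin: "\<And>f g c. f \<in> dual schwartz \<Longrightarrow> g \<in> dual schwartz \<Longrightarrow>
      \<Lambda> (\<lambda>\<phi>\<in>topspace schwartz. c * f \<phi> + g \<phi>) = c * \<Lambda> f + \<Lambda> g"
  shows "\<exists>\<psi>\<in>schwartz_space. \<forall>f\<in>dual schwartz. \<Lambda> f = f \<psi>"
proof -
  \<comment> \<open>The zero of the dual, restricted because functionals are extensional. It also
    fills the second place in sums of the form that \<open>lin\<close> expects.\<close>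
  define z where "z = (\<lambda>\<phi>\<in>(schwartz_space :: ('a \<Rightarrow> complex) set). 0 :: complex)"
  have z: "z \<in> dual schwartz"
    by (rule dualI) (auto simp: z_def schwartz_add schwartz_cmult intro!: continuous_map_restrict_cong[of schwartz, simplified])
  have \<Lambda>z: "\<Lambda> z = 0"
    using lin[OF z z, of 1] by (simp add: z_def cong: restrict_cong)
  have "openin (weak_star schwartz) {f \<in> topspace (weak_star schwartz). \<Lambda> f \<in> ball 0 1}"
    by (rule openin_continuous_map_preimage[OF cont]) simp
  then have "openin (weak_star schwartz) {f \<in> dual schwartz. \<Lambda> f \<in> ball 0 1}"
    by (simp only: topspace_weak_star)
  then obtain U where U: "openin (product_topology (\<lambda>_. euclidean) (topspace schwartz)) U"
    "{f \<in> dual schwartz. \<Lambda> f \<in> ball 0 1} = U \<inter> dual schwartz"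
    by (auto simp: weak_star_def openin_subtopology)
  have "z \<in> {f \<in> dual schwartz. \<Lambda> f \<in> ball 0 1}"
    using z \<Lambda>z by simp
  then have "z \<in> U"
    by (simp only: U(2) Int_iff)
  then obtain V where V: "finite {\<phi> \<in> topspace schwartz. V \<phi> \<noteq> (UNIV :: complex set)}"
    "z \<in> Pi\<^sub>E (topspace schwartz) V" "Pi\<^sub>E (topspace schwartz) V \<subseteq> U"
    using U(1) unfolding openin_product_topology_alt by auto
  define F where "F = {\<phi> \<in> topspace schwartz. V \<phi> \<noteq> (UNIV :: complex set)}"
  have F: "finite F" "F \<subseteq> schwartz_space"
    using V(1) by (auto simp: F_def)
  have small: "cmod (\<Lambda> f) < 1" if f: "f \<in> dual schwartz" "\<And>\<phi>. \<phi> \<in> F \<Longrightarrow> f \<phi> = 0" for f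
  proof -
    have "f \<in> Pi\<^sub>E (topspace schwartz) V"
    proof (rule PiE_I)
      fix \<phi> :: "'a \<Rightarrow> complex" assume \<phi>: "\<phi> \<in> topspace schwartz"
      show "f \<phi> \<in> V \<phi>"
      proof (cases "\<phi> \<in> F")
        case True
        have "z \<phi> \<in> V \<phi>"
          using V(2) \<phi> by (rule PiE_mem)
        then show ?thesis
          using True f(2) \<phi> by (simp add: z_def)
      qed (use \<phi> in \<open>simp add: F_def\<close>)
    qed (use dualD(1)[OF f(1)] in \<open>simp add: extensional_def\<close>)
    then have "f \<in> U \<inter> dual schwartz"
      using V(3) f(1) by blast
    then show ?thesis
      unfolding U(2)[symmetric] by simp
  qed
  have "\<Lambda> f = 0" if f: "f \<in> dual schwartz" "\<And>\<phi>. \<phi> \<in> F \<Longrightarrow> f \<phi> = 0" for f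
  proof (rule ccontr)
    assume "\<Lambda> f \<noteq> 0"
    let ?c = "1 / \<Lambda> f"
    let ?g = "\<lambda>\<phi>\<in>topspace schwartz. ?c * f \<phi> + z \<phi>"
    have "cmod (\<Lambda> ?g) < 1"
      using f F(2) by (intro small dual_lincomb z) (auto simp: z_def)
    then show False
      using lin[OF f(1) z, of ?c] \<Lambda>z \<open>\<Lambda> f \<noteq> 0\<close> by simp
  qed
  then obtain c where c: "\<And>f. f \<in> dual schwartz \<Longrightarrow> \<Lambda> f = (\<Sum>\<phi>\<in>F. c \<phi> * f \<phi>)"
    using dual_functional_finite[OF F lin] by blast
  show ?thesis
  proof (intro bexI ballI)
    show "(\<lambda>x. \<Sum>\<phi>\<in>F. c \<phi> * \<phi> x) \<in> schwartz_space"
      using F(2) by (intro schwartz_sum schwartz_cmult) auto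
    show "\<Lambda> f = f (\<lambda>x. \<Sum>\<phi>\<in>F. c \<phi> * \<phi> x)" if "f \<in> dual schwartz" for f
      using c[OF that] dual_schwartz_sum[OF that F] by simp
  qed
qed

section \<open>Regular distributions and the transpose of a multiplier\<close>

lemma regular_distr_dual:
  assumes \<theta>: "\<theta> \<in> schwartz_space"
  shows "regular_distr \<theta> \<in> dual schwartz"
proof -
  have i: "integrable lborel (\<lambda>x. \<theta> x * f x)" if "f \<in> schwartz_space" for f
    by (rule schwartz_mult_integrable[OF \<theta> bciD(2,3)[OF rapid_bci[OF schwartz_rapid[OF that]]]])
  have "continuous_map schwartz euclidean (\<lambda>f. \<integral>x. \<theta> x * f x \<partial>lborel)"
  proof (rule continuous_functional_schwartz)
    have "cmod (\<integral>x. \<theta> x * f x \<partial>lborel) \<le> (\<integral>x. norm (\<theta> x) \<partial>lborel) * seminorm 0 [] f"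
      if f: "f \<in> schwartz_space" for f
    proof -
      have "cmod (\<integral>x. \<theta> x * f x \<partial>lborel) \<le> (\<integral>x. norm (\<theta> x * f x) \<partial>lborel)"
        by (rule integral_norm_bound)
      also have "\<dots> \<le> (\<integral>x. norm (\<theta> x) * seminorm 0 [] f \<partial>lborel)"
      proof (rule integral_mono)
        show "norm (\<theta> x * f x) \<le> norm (\<theta> x) * seminorm 0 [] f" for x
          using le_seminorm[OF f, of "[]" x 0] by (simp add: norm_mult mult_left_mono)
      qed (use i[OF f] schwartz_integrable[OF \<theta>] in simp_all)
      finally show ?thesis by simp
    qed
    moreover have "dominated (\<lambda>f. (\<integral>x. norm (\<theta> x) \<partial>lborel) * seminorm 0 [] f)"
      by (intro dominated_scale dominated_seminorm) auto
    ultimately show "dominated (\<lambda>f. cmod (\<integral>x. \<theta> x * f x \<partial>lborel))"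
      by (blast intro: dominated_mono)
  qed (simp add: right_diff_distrib i)
  then show ?thesis
    unfolding regular_distr_def
    by (intro dualI continuous_map_restrict_cong) (auto simp: schwartz_add schwartz_cmult i distrib_left mult.left_commute)
qed

lemma fourier_inv_continuous_bounded:
  assumes "integrable lborel h"
  shows "continuous_on UNIV (fourier_inv h)" "bounded (range (fourier_inv h))"
proof -
  have "continuous_on UNIV (\<lambda>x. fourier h (- x) / of_real ((2 * pi) ^ DIM('a)))"
    by (intro continuous_intros continuous_on_compose2[OF continuous_on_fourier[OF assms, of UNIV]]) auto
  then show "continuous_on UNIV (fourier_inv h)"
    by (simp add: fourier_inv_eq[abs_def])
  show "bounded (range (fourier_inv h))"
    unfolding bounded_iff
    by (rule exI[of _ "(\<integral>x. norm (h x) \<partial>lborel) / (2 * pi) ^ DIM('a)"])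
       (auto simp: fourier_inv_eq norm_divide norm_power norm_mult intro!: divide_right_mono norm_fourier_le)
qed

text \<open>By weak-* continuity \<open>L\<close> is the transpose of an operator on the Schwartz space, and pairing
  with Schwartz functions identifies that operator with the multiplier. In particular the
  multiplier preserves the Schwartz space, although its symbol need not be smooth at the origin.\<close>

lemma lsi_multiplier:
  fixes L :: "(('a::euclidean_space \<Rightarrow> complex) \<Rightarrow> complex) \<Rightarrow> ('a \<Rightarrow> complex) \<Rightarrow> complex"
  assumes L: "continuous_lsi L" and resp: "has_frequency_response L m" and m: "poly_bounded m"
    and \<phi>: "\<phi> \<in> schwartz_space"
  shows "multiplier_adj m \<phi> \<in> schwartz_space"
    and "f \<in> dual schwartz \<Longrightarrow> L f \<phi> = f (multiplier_adj m \<phi>)"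
proof -
  have cont: "continuous_map (weak_star schwartz) (weak_star schwartz) L"
    using L by (simp add: continuous_lsi_def)
  have "continuous_map (weak_star schwartz) euclidean (\<lambda>f. f \<phi>)"
    unfolding weak_star_def
    by (intro continuous_map_from_subtopology continuous_map_product_projection) (simp add: \<phi>)
  from continuous_map_compose[OF cont this]
  have "continuous_map (weak_star schwartz) euclidean (\<lambda>f. L f \<phi>)"
    by (simp add: comp_def)
  moreover have "L (\<lambda>\<phi>\<in>topspace schwartz. c * f \<phi> + g \<phi>) \<phi> = c * L f \<phi> + L g \<phi>"
    if "f \<in> dual schwartz" "g \<in> dual schwartz" for f g c
    using L that \<phi> by (simp add: continuous_lsi_def)
  ultimately obtain \<psi> where \<psi>: "\<psi> \<in> schwartz_space" "\<And>f. f \<in> dual schwartz \<Longrightarrow> L f \<phi> = f \<psi>"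
    using weak_star_functional[of "\<lambda>f. L f \<phi>"] by blast
  have m': "poly_bounded (\<lambda>\<xi>. m (- \<xi>))"
  proof -
    obtain C M where "\<And>x. norm (m x) \<le> C * (1 + (norm x)\<^sup>2) ^ M"
      using m by (auto simp: poly_bounded_def)
    from this[of "- _"] have "\<exists>C M. \<forall>x. norm (m (- x)) \<le> C * (1 + (norm x)\<^sup>2) ^ M"
      by auto
    then show ?thesis
      using m by (auto simp: poly_bounded_def intro!: continuous_intros continuous_on_compose2[of UNIV m])
  qed
  have i: "integrable lborel (\<lambda>\<xi>. m \<xi> * fourier \<theta> \<xi>)" "integrable lborel (\<lambda>\<xi>. m (- \<xi>) * fourier \<theta> \<xi>)"
    if "\<theta> \<in> schwartz_space" for \<theta>
    using rapid_integrable[OF rapid_mult[OF m fourier_rapid[OF that]]]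
      rapid_integrable[OF rapid_mult[OF m' fourier_rapid[OF that]]] by auto
  \<comment> \<open>At this point \<open>multiplier_adj m \<phi>\<close> is only known to be
    continuous and bounded, which is the generality of \<open>schwartz_separates\<close>.\<close>
  have adj: "continuous_on UNIV (multiplier_adj m \<phi>)" "bounded (range (multiplier_adj m \<phi>))"
    unfolding multiplier_adj_def multiplier_def by (rule fourier_inv_continuous_bounded[OF i(2)[OF \<phi>]])+
  have "\<psi> x - multiplier_adj m \<phi> x = 0" for x
  proof (rule schwartz_separates[where u="\<lambda>x. \<psi> x - multiplier_adj m \<phi> x"])
    show "continuous_on UNIV (\<lambda>x. \<psi> x - multiplier_adj m \<phi> x)"
      by (intro continuous_intros adj schwartz_continuous \<psi>)
    show "bounded (range (\<lambda>x. \<psi> x - multiplier_adj m \<phi> x))"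
      using bounded_minus_comp[of \<psi> UNIV "multiplier_adj m \<phi>"] adj(2) bciD(3)[OF rapid_bci[OF schwartz_rapid[OF \<psi>(1)]]]
      by simp
    fix \<theta> :: "'a \<Rightarrow> complex" assume \<theta>: "\<theta> \<in> schwartz_space"
    have "regular_distr \<theta> \<psi> = L (regular_distr \<theta>) \<phi>"
      by (rule \<psi>(2)[symmetric, OF regular_distr_dual[OF \<theta>]])
    also have "\<dots> = regular_distr (multiplier m \<theta>) \<phi>"
      using resp \<theta> by (simp add: has_frequency_response_def)
    finally have "(\<integral>x. \<theta> x * \<psi> x \<partial>lborel) = (\<integral>x. multiplier m \<theta> x * \<phi> x \<partial>lborel)"
      using \<phi> \<psi>(1) by (simp add: regular_distr_def)
    also have "\<dots> = (\<integral>x. \<theta> x * multiplier_adj m \<phi> x \<partial>lborel)"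
      by (intro multiplier_adjoint schwartz_integrable i \<theta> \<phi>)
    finally have eq: "(\<integral>x. \<theta> x * \<psi> x \<partial>lborel) = (\<integral>x. \<theta> x * multiplier_adj m \<phi> x \<partial>lborel)" .
    have "integrable lborel (\<lambda>x. \<theta> x * \<psi> x)"
      by (rule schwartz_mult_integrable[OF \<theta> bciD(2,3)[OF rapid_bci[OF schwartz_rapid[OF \<psi>(1)]]]])
    then show "(\<integral>x. \<theta> x * (\<psi> x - multiplier_adj m \<phi> x) \<partial>lborel) = 0"
      using schwartz_mult_integrable[OF \<theta> adj] eq by (simp add: right_diff_distrib)
  qed
  then have "multiplier_adj m \<phi> = \<psi>"
    by (auto simp: fun_eq_iff)
  with \<psi> show "multiplier_adj m \<phi> \<in> schwartz_space"
    "f \<in> dual schwartz \<Longrightarrow> L f \<phi> = f (multiplier_adj m \<phi>)"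
    by auto
qed

text \<open>Membership of the result in the Schwartz space supplies the integrability for inversion,
  although the symbol may be rough.\<close>

lemma fourier_multiplier:
  assumes m: "poly_bounded m" and \<phi>: "\<phi> \<in> schwartz_space" and "multiplier m \<phi> \<in> schwartz_space"
  shows "fourier (multiplier m \<phi>) \<xi> = m \<xi> * fourier \<phi> \<xi>"
  using fourier_fourier_inv[of "\<lambda>\<xi>. m \<xi> * fourier \<phi> \<xi>"] schwartz_integrable[OF assms(3)]
    rapid_bci[OF rapid_mult[OF m fourier_rapid[OF \<phi>]]]
  unfolding multiplier_def by (simp add: fun_eq_iff)

section \<open>Continuity of the \<open>k\<close>-plane transform\<close>

subsection \<open>Plane rotations\<close>

lemma skew_unit_mult:
  fixes y :: "real^'d"
  shows "y v* skew_unit i j = (y $ i) *\<^sub>R axis j 1 - (y $ j) *\<^sub>R axis i 1"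
proof (rule vec_eq_iff[THEN iffD2], rule allI)
  fix b
  have "(y v* skew_unit i j) $ b = (\<Sum>a\<in>UNIV. y $ a * (of_bool (a = i \<and> b = j) - of_bool (a = j \<and> b = i)))"
    by (simp add: vector_matrix_mult_def skew_unit_def mult.commute)
  also have "\<dots> = (\<Sum>a\<in>UNIV. if a = i then (if b = j then y $ i else 0) else 0)
      - (\<Sum>a\<in>UNIV. if a = j then (if b = i then y $ j else 0) else 0)"
    unfolding sum_subtractf[symmetric] by (rule sum.cong) auto
  finally show "(y v* skew_unit i j) $ b = ((y $ i) *\<^sub>R axis j 1 - (y $ j) *\<^sub>R axis i 1) $ b"
    by (simp add: axis_def)
qed

lemma skew_unit_inner: "(y v* skew_unit i j) \<bullet> z = - (y \<bullet> (z v* skew_unit i j))" for y z :: "real^'d"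
  by (simp add: skew_unit_mult inner_diff_left inner_diff_right inner_axis inner_axis')

lemma skew_unit_cube: "((y v* skew_unit i j) v* skew_unit i j) v* skew_unit i j = - (y v* skew_unit i j)"
  for y :: "real^'d"
  by (cases "i = j") (simp_all add: skew_unit_mult axis_def)

lemma plane_rotation_mult:
  fixes y :: "real^'d"
  shows "y v* plane_rotation i j s =
    y + sin s *\<^sub>R (y v* skew_unit i j) + (1 - cos s) *\<^sub>R ((y v* skew_unit i j) v* skew_unit i j)"
proof -
  have "y v* (c *\<^sub>R B) = c *\<^sub>R (y v* B)" for c and B :: "real^'d^'d"
    by (simp add: vector_matrix_mult_def vec_eq_iff sum_distrib_left mult_ac)
  moreover have "y v* (B + C) = y v* B + y v* C" for B C :: "real^'d^'d"
    by (simp add: vector_matrix_mult_def vec_eq_iff sum.distrib algebra_simps)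
  ultimately show ?thesis
    by (simp add: plane_rotation_def vector_matrix_mul_assoc)
qed

text \<open>Skewness of \<open>?J\<close>, and its cube being its negative, reduce the inner
  products of the expansion to a few. The coefficient of \<open>?J y \<bullet> ?J z\<close> vanishes
  by the Pythagorean identity for \<open>sin\<close> and \<open>cos\<close>; the other mixed terms
  cancel in pairs.\<close>

lemma plane_rotation_orthogonal: "orthogonal_transformation (\<lambda>y. y v* plane_rotation i j s)"
  unfolding orthogonal_transformation_def
proof (intro conjI allI)
  show "linear (\<lambda>y. y v* plane_rotation i j s)"
    by (rule linear_vector_matrix)
  fix y z :: "real^'a"
  let ?J = "\<lambda>y. y v* skew_unit i j"
  have J: "?J u \<bullet> v = - (u \<bullet> ?J v)" for u v :: "real^'a"
    by (rule skew_unit_inner)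
  have 1: "y \<bullet> ?J (?J z) = - (?J y \<bullet> ?J z)" "?J (?J y) \<bullet> z = - (?J y \<bullet> ?J z)"
    "?J (?J y) \<bullet> ?J (?J z) = ?J y \<bullet> ?J z" "?J (?J y) \<bullet> ?J z = - (?J y \<bullet> ?J (?J z))"
    using J[of y "?J z"] J[of "?J y" z] J[of "?J y" "?J (?J z)"] J[of "?J y" "?J z"]
    by (simp_all add: skew_unit_cube)
  have 2: "?J y \<bullet> z = - (y \<bullet> ?J z)"
    by (rule J)
  have 3: "cos s * (cos s * r) + sin s * (sin s * r) = r" for r
    by (simp add: mult.assoc[symmetric] distrib_right[symmetric])
  show "(y v* plane_rotation i j s) \<bullet> (z v* plane_rotation i j s) = y \<bullet> z"
    unfolding plane_rotation_mult inner_add_left inner_add_right inner_scaleR_left inner_scaleR_right 1 2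
    by (simp add: algebra_simps 3)
qed

lemma plane_rotation_norm [simp]: "norm (y v* plane_rotation i j s) = norm y"
  using orthogonal_transformation_norm[OF plane_rotation_orthogonal] .

lemma plane_rotation_0 [simp]: "y v* plane_rotation i j 0 = y"
  by (simp add: plane_rotation_mult)

text \<open>The one-parameter group law, which carries derivatives at 0 to all angles.\<close>

lemma plane_rotation_add:
  "(y v* plane_rotation i j r) v* plane_rotation i j h = y v* plane_rotation i j (r + h)" for y :: "real^'d"
proof -
  let ?J = "\<lambda>y. y v* skew_unit i j"
  have lin: "?J (u + v) = ?J u + ?J v" "?J (c *\<^sub>R u) = c *\<^sub>R ?J u" "?J (- u) = - ?J u" for u v :: "real^'d" and c
    by (simp_all add: linear_add[OF linear_vector_matrix] linear_scale[OF linear_vector_matrix]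
        linear_neg[OF linear_vector_matrix])
  have "(y v* plane_rotation i j r) v* plane_rotation i j h =
     y + (sin r + sin h - sin r * (1 - cos h) - (1 - cos r) * sin h) *\<^sub>R ?J y
       + ((1 - cos r) + (1 - cos h) + sin r * sin h - (1 - cos r) * (1 - cos h)) *\<^sub>R ?J (?J y)"
    unfolding plane_rotation_mult lin skew_unit_cube
    by (simp add: algebra_simps)
  also have "sin r + sin h - sin r * (1 - cos h) - (1 - cos r) * sin h = sin (r + h)"
    by (simp add: sin_add algebra_simps)
  also have "(1 - cos r) + (1 - cos h) + sin r * sin h - (1 - cos r) * (1 - cos h) = 1 - cos (r + h)"
    by (simp add: cos_add algebra_simps)
  finally show ?thesis
    by (simp add: plane_rotation_mult)
qed

lemma plane_rotation_deriv:
  fixes y :: "real^'d"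
  shows "((\<lambda>s. y v* plane_rotation i j s) has_derivative
    (\<lambda>h. h *\<^sub>R ((y v* plane_rotation i j r) v* skew_unit i j))) (at r)"
proof -
  let ?J = "\<lambda>y. y v* skew_unit i j"
  have lin: "?J (u + v) = ?J u + ?J v" "?J (c *\<^sub>R u) = c *\<^sub>R ?J u" for u v :: "real^'d" and c
    by (simp_all add: linear_add[OF linear_vector_matrix] linear_scale[OF linear_vector_matrix])
  have "((\<lambda>s. y + sin s *\<^sub>R ?J y + (1 - cos s) *\<^sub>R ?J (?J y)) has_derivative
      (\<lambda>h. (h * cos r) *\<^sub>R ?J y + (h * sin r) *\<^sub>R ?J (?J y))) (at r)"
    by (auto intro!: derivative_eq_intros)
  moreover have "?J (y v* plane_rotation i j r) = cos r *\<^sub>R ?J y + sin r *\<^sub>R ?J (?J y)"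
    unfolding plane_rotation_mult lin skew_unit_cube by (simp add: algebra_simps)
  ultimately show ?thesis
    by (simp add: plane_rotation_mult scaleR_add_right)
qed

lemma stiefel_rotate [simp]: "A ** plane_rotation i j s \<in> stiefel \<longleftrightarrow> A \<in> stiefel"
  for A :: "real^'d^'m"
proof -
  let ?R = "plane_rotation i j s :: real^'d^'d"
  have "matrix (\<lambda>y. y v* ?R) = transpose ?R"
    by (subst transpose_matrix_vector[symmetric]) (rule matrix_of_matrix_vector_mul)
  then have "orthogonal_matrix (transpose ?R)"
    using plane_rotation_orthogonal[of i j s] by (simp add: orthogonal_transformation_matrix)
  then have R: "?R ** transpose ?R = mat 1"
    by (simp add: orthogonal_matrix_def)
  have "(A ** ?R) ** transpose (A ** ?R) = A ** (?R ** transpose ?R) ** transpose A"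
    by (simp only: matrix_transpose_mul matrix_mul_assoc)
  then show ?thesis
    by (simp add: stiefel_def R)
qed

subsection \<open>Derivatives along the frame fields\<close>

text \<open>The iterated derivatives of a \<open>k\<close>-plane transform along the frame fields have the following
  form: derivatives in the direction of \<open>t\<close> give the factors, rotations act on \<open>\<psi>\<close>.\<close>

definition freq_mono :: "'m list \<Rightarrow> real^'m \<Rightarrow> complex" where
  "freq_mono ls \<omega> = (\<Prod>l\<leftarrow>ls. \<i> * of_real (\<omega> \<bullet> axis l 1))"

definition kplane_deriv :: "'m list \<Rightarrow> (real^'d \<Rightarrow> complex) \<Rightarrow> (real^'d^'m) \<times> (real^'m) \<Rightarrow> complex" where
  "kplane_deriv ls \<psi> = (\<lambda>(A, t). if A \<in> stiefel
     then fourier_inv (\<lambda>\<omega>. freq_mono ls \<omega> * fourier \<psi> (\<omega> v* A)) t else 0)"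

text \<open>The derivative of \<open>\<psi>\<close> along the linear vector field
  \<open>x v* skew_unit i j\<close>. The coefficients \<open>1\<close> and \<open>- 1\<close> are
  written out to match \<open>schwartz_op_lincomb\<close>.\<close>

definition rotation_deriv :: "'d \<Rightarrow> 'd \<Rightarrow> (real^'d \<Rightarrow> complex) \<Rightarrow> real^'d \<Rightarrow> complex" where
  "rotation_deriv i j \<psi> x = 1 * (of_real (x \<bullet> axis i 1) * partial_deriv (axis j 1) \<psi> x)
     + (- 1) * (of_real (x \<bullet> axis j 1) * partial_deriv (axis i 1) \<psi> x)"

lemma poly_bounded_freq_mono: "poly_bounded (freq_mono ls)"
proof (induction ls)
  case Nil
  show ?case
    unfolding freq_mono_def[abs_def] by (simp add: poly_bounded_const)
next
  case (Cons l ls)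
  have "poly_bounded (\<lambda>\<omega>. (\<i> * of_real (\<omega> \<bullet> axis l 1)) * freq_mono ls \<omega>)"
    by (intro poly_bounded_mult poly_bounded_const poly_bounded_inner Cons)
  then show ?case
    by (simp add: freq_mono_def[abs_def])
qed

lemma schwartz_op_rotation_deriv: "schwartz_op (rotation_deriv i j)"
proof -
  have "schwartz_op (\<lambda>\<psi> x. complex_of_real (x \<bullet> axis a 1) * partial_deriv (axis b (1::real)) \<psi> x)" for a b :: 'a
    using schwartz_op_comp[OF schwartz_op_mult_coordinate[of "axis a (1::real)"] schwartz_op_partial_deriv[of "axis b (1::real)"]]
    by simp
  from schwartz_op_lincomb[OF this this, of 1 i j "- 1" j i] show ?thesis
    by (simp only: rotation_deriv_def[abs_def])
qed

lemma kplane_deriv_Nil: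
  assumes "\<psi> \<in> schwartz_space"
  shows "kplane_deriv [] \<psi> = kplane \<psi>"
proof (rule ext, clarify)
  fix A :: "real^'a^'b" and t
  show "kplane_deriv [] \<psi> (A, t) = kplane \<psi> (A, t)"
  proof (cases "A \<in> stiefel")
    case True
    then show ?thesis
      using assms by (simp add: kplane_deriv_def freq_mono_def fourier_inv_slice)
  qed (simp add: kplane_deriv_def kplane_def)
qed

lemma rapid_freq_mono:
  fixes A :: "real^'d^'m"
  assumes "A \<in> stiefel" "\<psi> \<in> schwartz_space"
  shows "rapid (\<lambda>\<omega>. freq_mono ls \<omega> * fourier \<psi> (\<omega> v* A))"
  by (intro rapid_mult poly_bounded_freq_mono rapid_slice assms(1) fourier_rapid assms(2))

lemma has_vector_derivative_fourier_inv_translate: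
  fixes h :: "real^'m \<Rightarrow> complex"
  assumes "rapid h"
  shows "((\<lambda>s. fourier_inv h (t + s *\<^sub>R axis l 1)) has_vector_derivative
    fourier_inv (\<lambda>\<omega>. (\<i> * of_real (\<omega> \<bullet> axis l 1)) * h \<omega>) t) (at 0)"
proof -
  let ?e = "axis l 1 :: real^'m"
  let ?F = "\<lambda>s \<omega>. h \<omega> * exp (\<i> * of_real (\<omega> \<bullet> (t + s *\<^sub>R ?e)))"
  note [measurable] = rapidD(2)[OF assms]
  have hl: "rapid (\<lambda>\<omega>. (\<i> * of_real (\<omega> \<bullet> ?e)) * h \<omega>)"
    by (intro rapid_mult[OF _ assms] poly_bounded_mult poly_bounded_const poly_bounded_inner)
  have d: "((\<lambda>s. exp (\<i> * of_real (\<omega> \<bullet> (t + s *\<^sub>R ?e)))) has_vector_derivative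
      (\<i> * of_real (\<omega> \<bullet> ?e)) * exp (\<i> * of_real (\<omega> \<bullet> (t + r *\<^sub>R ?e)))) (at r)" for \<omega> r
  proof -
    have "((\<lambda>z. exp (\<i> * (of_real (\<omega> \<bullet> t) + z * of_real (\<omega> \<bullet> ?e)))) has_field_derivative
      (\<i> * of_real (\<omega> \<bullet> ?e)) * exp (\<i> * (of_real (\<omega> \<bullet> t) + of_real r * of_real (\<omega> \<bullet> ?e)))) (at (of_real r))"
      by (auto intro!: derivative_eq_intros)
    from has_vector_derivative_real_field[OF this] show ?thesis
      by (simp add: inner_add_right)
  qed
  have "((\<lambda>s. \<integral>\<omega>. ?F s \<omega> \<partial>lborel) has_vector_derivative
      (\<integral>\<omega>. (\<i> * of_real (\<omega> \<bullet> ?e)) * h \<omega> * exp (\<i> * of_real (\<omega> \<bullet> t)) \<partial>lborel)) (at 0)"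
  proof (rule has_vector_derivative_integral_param)
    show "integrable lborel (?F s)" for s
      by (rule integrable_fourier_kernel(3)[OF rapid_integrable[OF assms]])
    show "((\<lambda>s. ?F s \<omega>) has_vector_derivative (\<i> * of_real (\<omega> \<bullet> ?e)) * h \<omega> * exp (\<i> * of_real (\<omega> \<bullet> t))) (at 0)" for \<omega>
      using has_vector_derivative_mult_right[OF d[of \<omega> 0], of "h \<omega>"] by (simp add: mult_ac)
    show "norm (?F s \<omega> - ?F 0 \<omega>) \<le> \<bar>s\<bar> * norm ((\<i> * of_real (\<omega> \<bullet> ?e)) * h \<omega>)" for s \<omega>
    proof -
      have "norm (exp (\<i> * of_real (\<omega> \<bullet> (t + s *\<^sub>R ?e))) - exp (\<i> * of_real (\<omega> \<bullet> (t + 0 *\<^sub>R ?e))))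
          \<le> \<bar>s\<bar> * norm (\<omega> \<bullet> ?e)"
        by (rule norm_increment_le[OF d]) (simp add: norm_mult)
      from mult_left_mono[OF this norm_ge_zero[of "h \<omega>"]] show ?thesis
        by (simp add: norm_mult right_diff_distrib[symmetric] mult_ac)
    qed
    show "integrable lborel (\<lambda>\<omega>. norm ((\<i> * of_real (\<omega> \<bullet> ?e)) * h \<omega>))"
      by (intro integrable_norm rapid_integrable hl)
  qed measurable
  from has_vector_derivative_divide[OF this]
  show ?thesis
    by (simp add: fourier_inv_def)
qed

lemma has_vector_derivative_rotate:
  fixes \<psi> :: "real^'d \<Rightarrow> complex"
  assumes "\<psi> \<in> schwartz_space"
  shows "((\<lambda>s. \<psi> (x v* plane_rotation i j s)) has_vector_derivative
    rotation_deriv i j \<psi> (x v* plane_rotation i j r)) (at r)"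
proof -
  let ?y = "x v* plane_rotation i j r"
  let ?D = "\<lambda>h::real^'d. \<Sum>b\<in>Basis. (h \<bullet> b) *\<^sub>R partial_deriv b \<psi> ?y"
  have D: "(\<psi> has_derivative ?D) (at ?y)"
    by (rule has_derivative_partials[OF schwartz_differentiable[OF assms]])
  have lin: "linear ?D"
    using D by (rule has_derivative_linear)
  have axis: "?D (axis a 1) = partial_deriv (axis a 1) \<psi> ?y" for a
    by (simp add: inner_Basis if_distrib[of "\<lambda>c. c *\<^sub>R _"] sum.delta cong: if_cong)
  have "?D (?y v* skew_unit i j) = rotation_deriv i j \<psi> ?y"
    unfolding skew_unit_mult linear_diff[OF lin] linear_scale[OF lin] axis
    by (simp add: rotation_deriv_def inner_axis scaleR_conv_of_real)
  moreover have "?D (h *\<^sub>R (?y v* skew_unit i j)) = h *\<^sub>R ?D (?y v* skew_unit i j)" for h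
    by (rule linear_scale[OF lin])
  ultimately show ?thesis
    using has_derivative_compose[OF plane_rotation_deriv D]
    by (simp add: has_vector_derivative_def)
qed

lemma rapid_le_inverse_weight:
  fixes f :: "'a::euclidean_space \<Rightarrow> complex"
  assumes "rapid f"
  shows "\<exists>C. \<forall>x. norm (f x) \<le> C * (1 / (1 + (norm x)\<^sup>2) ^ N)"
proof -
  obtain C where C: "\<And>x. norm (f x) * (1 + (norm x)\<^sup>2) ^ N \<le> C"
    using rapidD(3)[OF assms] by blast
  have "norm (f x) \<le> C * (1 / (1 + (norm x)\<^sup>2) ^ N)" for x
    using C[of x] by (simp add: pos_le_divide_eq zero_less_power add_pos_nonneg)
  then show ?thesis by blast
qed

text \<open>The Fourier transform commutes with rotations, so rotating the frequency amounts to
  rotating the argument of \<open>\<psi>\<close>, which is differentiated under the integral.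
  Rotations preserve the norm, hence the dominating weight is uniform in the angle.\<close>

lemma has_vector_derivative_fourier_rotate:
  fixes \<psi> :: "real^'d \<Rightarrow> complex"
  assumes \<psi>: "\<psi> \<in> schwartz_space"
  shows "((\<lambda>s. fourier \<psi> (\<xi> v* plane_rotation i j s)) has_vector_derivative
    fourier (rotation_deriv i j \<psi>) (\<xi> v* plane_rotation i j r)) (at r)"
proof -
  note Z = schwartz_opD[OF schwartz_op_rotation_deriv \<psi>, of i j]
  note [measurable] = rapidD(2)[OF schwartz_rapid[OF \<psi>]] rapidD(2)[OF schwartz_rapid[OF Z]]
  obtain C where C: "\<And>x. norm (rotation_deriv i j \<psi> x) \<le> C * (1 / (1 + (norm x)\<^sup>2) ^ CARD('d))"
    using rapid_le_inverse_weight[OF schwartz_rapid[OF Z]] by blast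
  have [measurable]: "(\<lambda>x::real^'d. x v* plane_rotation i j s) \<in> borel_measurable borel" for s
    by measurable
  have 0: "((\<lambda>s. fourier \<psi> (\<xi> v* plane_rotation i j s)) has_vector_derivative
    fourier (rotation_deriv i j \<psi>) \<xi>) (at 0)" for \<xi>
  proof -
    let ?F = "\<lambda>s x. \<psi> (x v* plane_rotation i j s) * exp (- (\<i> * of_real (\<xi> \<bullet> x)))"
    have "((\<lambda>s. \<integral>x. ?F s x \<partial>lborel) has_vector_derivative
        (\<integral>x. rotation_deriv i j \<psi> x * exp (- (\<i> * of_real (\<xi> \<bullet> x))) \<partial>lborel)) (at 0)"
    proof (rule has_vector_derivative_integral_param)
      show "integrable lborel (?F s)" for s
      proof (rule integrable_fourier_kernel(1))
        have "integrable (distr lborel borel (\<lambda>x. x v* plane_rotation i j s)) \<psi>"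
          using schwartz_integrable[OF \<psi>] by (simp add: lborel_distr_orthogonal[OF plane_rotation_orthogonal])
        then show "integrable lborel (\<lambda>x. \<psi> (x v* plane_rotation i j s))"
          by (simp add: integrable_distr_eq)
      qed
      show "((\<lambda>s. ?F s x) has_vector_derivative rotation_deriv i j \<psi> x * exp (- (\<i> * of_real (\<xi> \<bullet> x)))) (at 0)" for x
        using has_vector_derivative_mult_left[OF has_vector_derivative_rotate[OF \<psi>, of x i j 0]] by simp
      show "norm (?F s x - ?F 0 x) \<le> \<bar>s\<bar> * (C * (1 / (1 + (norm x)\<^sup>2) ^ CARD('d)))" for s x
      proof -
        have "norm (\<psi> (x v* plane_rotation i j s) - \<psi> (x v* plane_rotation i j 0))
            \<le> \<bar>s\<bar> * (C * (1 / (1 + (norm x)\<^sup>2) ^ CARD('d)))"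
        proof (rule norm_increment_le[OF has_vector_derivative_rotate[OF \<psi>]])
          show "norm (rotation_deriv i j \<psi> (x v* plane_rotation i j r)) \<le> C * (1 / (1 + (norm x)\<^sup>2) ^ CARD('d))" for r
            using C[of "x v* plane_rotation i j r"] by simp
        qed
        moreover have "?F s x - ?F 0 x = (\<psi> (x v* plane_rotation i j s) - \<psi> (x v* plane_rotation i j 0)) * exp (- (\<i> * of_real (\<xi> \<bullet> x)))"
          by (simp add: left_diff_distrib)
        ultimately show ?thesis
          by (simp only: norm_fourier_kernel(1)[of "\<lambda>_. \<psi> (x v* plane_rotation i j s) - \<psi> (x v* plane_rotation i j 0)"])
      qed
      show "integrable lborel (\<lambda>x::real^'d. C * (1 / (1 + (norm x)\<^sup>2) ^ CARD('d)))"
        using integrable_mult_right[OF integrable_inverse_weight[where 'a="real^'d"], of C] by simp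
    qed measurable
    moreover have "(\<integral>x. ?F s x \<partial>lborel) = fourier \<psi> (\<xi> v* plane_rotation i j s)" for s
      using fourier_orthogonal[OF _ plane_rotation_orthogonal, of \<psi> i j s \<xi>] by (simp add: fourier_def)
    ultimately show ?thesis
      by (simp add: fourier_def[of "rotation_deriv i j \<psi>"])
  qed
  have "((\<lambda>h. fourier \<psi> ((\<xi> v* plane_rotation i j r) v* plane_rotation i j h)) \<circ> (\<lambda>s. s - r) has_vector_derivative
      1 *\<^sub>R fourier (rotation_deriv i j \<psi>) (\<xi> v* plane_rotation i j r)) (at r)"
    by (rule vector_diff_chain_at) (auto intro!: derivative_eq_intros 0)
  then show ?thesis
    by (simp add: comp_def plane_rotation_add)
qed

text \<open>On the frequency side \<open>t\<close> occurs only in the exponential and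
  \<open>A\<close> only in \<open>\<omega> v* A\<close>. Hence \<open>Trans\<close> adds one
  frequency factor, while \<open>Rot\<close> rotates that argument and its derivative falls on
  \<open>\<psi>\<close>.\<close>

lemma kplane_deriv_flow:
  fixes \<psi> :: "real^'d \<Rightarrow> complex" and p :: "(real^'d^'m) \<times> (real^'m)"
  assumes \<psi>: "\<psi> \<in> schwartz_space"
  shows "((\<lambda>s. kplane_deriv ls \<psi> (flow (Trans l) s p)) has_vector_derivative kplane_deriv (l # ls) \<psi> p) (at 0)"
    and "((\<lambda>s. kplane_deriv ls \<psi> (flow (Rot i j) s p)) has_vector_derivative
      kplane_deriv ls (rotation_deriv i j \<psi>) p) (at 0)"
proof -
  obtain A t where p: "p = (A, t)" by (cases p)
  show "((\<lambda>s. kplane_deriv ls \<psi> (flow (Trans l) s p)) has_vector_derivative kplane_deriv (l # ls) \<psi> p) (at 0)"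
  proof (cases "A \<in> stiefel")
    case True
    then show ?thesis
      using has_vector_derivative_fourier_inv_translate[where t=t and l=l, OF rapid_freq_mono[OF True \<psi>, of ls]]
      by (simp add: p kplane_deriv_def freq_mono_def mult.assoc)
  qed (simp add: p kplane_deriv_def)
  show "((\<lambda>s. kplane_deriv ls \<psi> (flow (Rot i j) s p)) has_vector_derivative
      kplane_deriv ls (rotation_deriv i j \<psi>) p) (at 0)"
  proof (cases "A \<in> stiefel")
    case True
    note Z = schwartz_opD[OF schwartz_op_rotation_deriv \<psi>, of i j]
    let ?F = "\<lambda>s \<omega>. freq_mono ls \<omega> * fourier \<psi> ((\<omega> v* A) v* plane_rotation i j s) * exp (\<i> * of_real (\<omega> \<bullet> t))"
    obtain D M where D: "\<And>\<omega>. norm (freq_mono ls \<omega>) \<le> D * (1 + (norm \<omega>)\<^sup>2) ^ M"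
      using poly_bounded_freq_mono[of ls] by (auto simp: poly_bounded_def)
    \<comment> \<open>\<open>M\<close> powers of the weight absorb the growth of
      \<open>freq_mono\<close>; the remaining \<open>CARD('m)\<close> give integrability.\<close>
    obtain K where K: "\<And>\<xi>. norm (fourier (rotation_deriv i j \<psi>) \<xi>) \<le> K * (1 / (1 + (norm \<xi>)\<^sup>2) ^ (M + CARD('m)))"
      using rapid_le_inverse_weight[OF fourier_rapid[OF Z]] by blast
    have rot: "(\<omega> v* A) v* plane_rotation i j s = \<omega> v* (A ** plane_rotation i j s)" for \<omega> s
      by (rule vector_matrix_mul_assoc)
    have "((\<lambda>s. \<integral>\<omega>. ?F s \<omega> \<partial>lborel) has_vector_derivative
      (\<integral>\<omega>. freq_mono ls \<omega> * fourier (rotation_deriv i j \<psi>) (\<omega> v* A) * exp (\<i> * of_real (\<omega> \<bullet> t)) \<partial>lborel)) (at 0)"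
    proof (rule has_vector_derivative_integral_param)
      show "integrable lborel (?F s)" for s
        unfolding rot using True \<psi>
        by (intro integrable_fourier_kernel(3) rapid_integrable rapid_freq_mono) simp_all
      show "(\<lambda>\<omega>. freq_mono ls \<omega> * fourier (rotation_deriv i j \<psi>) (\<omega> v* A) * exp (\<i> * of_real (\<omega> \<bullet> t))) \<in> borel_measurable lborel"
        using integrable_fourier_kernel(3)[OF rapid_integrable[OF rapid_freq_mono[OF True Z]], of ls t]
        by (rule borel_measurable_integrable)
      show "((\<lambda>s. ?F s \<omega>) has_vector_derivative
          freq_mono ls \<omega> * fourier (rotation_deriv i j \<psi>) (\<omega> v* A) * exp (\<i> * of_real (\<omega> \<bullet> t))) (at 0)" for \<omega>
        using has_vector_derivative_fourier_rotate[OF \<psi>, of "\<omega> v* A" i j 0]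
        by (intro has_vector_derivative_mult_left has_vector_derivative_mult_right) simp
      show "norm (?F s \<omega> - ?F 0 \<omega>) \<le> \<bar>s\<bar> * (D * K * (1 / (1 + (norm \<omega>)\<^sup>2) ^ CARD('m)))" for s \<omega>
      proof -
        let ?k = "K * (1 / (1 + (norm \<omega>)\<^sup>2) ^ (M + CARD('m)))"
        let ?G = "\<lambda>s. fourier \<psi> ((\<omega> v* A) v* plane_rotation i j s)"
        have "norm (?G s - ?G 0) \<le> \<bar>s\<bar> * ?k"
        proof (rule norm_increment_le[OF has_vector_derivative_fourier_rotate[OF \<psi>]])
          show "norm (fourier (rotation_deriv i j \<psi>) ((\<omega> v* A) v* plane_rotation i j r)) \<le> ?k" for r
            using K[of "(\<omega> v* A) v* plane_rotation i j r"] True by simp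
        qed
        from mult_mono[OF D[of \<omega>] this order_trans[OF norm_ge_zero D[of \<omega>]] norm_ge_zero]
        have "norm (freq_mono ls \<omega>) * norm (?G s - ?G 0)
            \<le> D * (1 + (norm \<omega>)\<^sup>2) ^ M * (\<bar>s\<bar> * ?k)" .
        also have "\<dots> = \<bar>s\<bar> * (D * K * (1 / (1 + (norm \<omega>)\<^sup>2) ^ CARD('m)))"
        proof -
          have "(1 + (norm \<omega>)\<^sup>2) ^ M \<noteq> 0"
            by (simp add: add_nonneg_eq_0_iff)
          then show ?thesis
            by (simp add: power_add)
        qed
        finally have "norm (freq_mono ls \<omega> * (?G s - ?G 0)) \<le> \<bar>s\<bar> * (D * K * (1 / (1 + (norm \<omega>)\<^sup>2) ^ CARD('m)))"
          by (simp only: norm_mult)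
        moreover have "?F s \<omega> - ?F 0 \<omega> = freq_mono ls \<omega> * (?G s - ?G 0) * exp (\<i> * of_real (\<omega> \<bullet> t))"
          by (simp add: algebra_simps)
        ultimately show ?thesis
          by (simp only: norm_fourier_kernel(2)[of "\<lambda>_. freq_mono ls \<omega> * (?G s - ?G 0)"])
      qed
      show "integrable lborel (\<lambda>\<omega>::real^'m. D * K * (1 / (1 + (norm \<omega>)\<^sup>2) ^ CARD('m)))"
        using integrable_mult_right[OF integrable_inverse_weight[where 'a="real^'m"], of "D * K"] by simp
    qed
    from has_vector_derivative_divide[OF this] show ?thesis
      using True by (simp add: p kplane_deriv_def fourier_inv_def rot)
  qed (simp add: p kplane_deriv_def)
qed

text \<open>Translations act on the frequency factor and rotations on \<open>\<psi>\<close>, so a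
  mixed list of fields splits into two independent lists.\<close>

fun trans_indices :: "('d, 'm) frame_field list \<Rightarrow> 'm list" where
  "trans_indices [] = []"
| "trans_indices (Rot i j # vs) = trans_indices vs"
| "trans_indices (Trans l # vs) = l # trans_indices vs"

fun rotation_derivs :: "('d, 'm) frame_field list \<Rightarrow> (real^'d \<Rightarrow> complex) \<Rightarrow> real^'d \<Rightarrow> complex" where
  "rotation_derivs [] \<psi> = \<psi>"
| "rotation_derivs (Rot i j # vs) \<psi> = rotation_deriv i j (rotation_derivs vs \<psi>)"
| "rotation_derivs (Trans l # vs) \<psi> = rotation_derivs vs \<psi>"

lemma schwartz_op_rotation_derivs:
  fixes vs :: "('d::finite, 'm) frame_field list"
  shows "schwartz_op (rotation_derivs vs)"
proof (induction vs)
  case Nil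
  have "rotation_derivs ([] :: ('d, 'm) frame_field list) = (\<lambda>\<psi>. \<psi>)" by (rule ext) simp
  then show ?case by (simp only: schwartz_op_id)
next
  case (Cons v vs)
  show ?case
  proof (cases v)
    case (Rot i j)
    have "rotation_derivs (v # vs) = (\<lambda>\<psi>. rotation_deriv i j (rotation_derivs vs \<psi>))"
      by (rule ext) (simp add: Rot)
    then show ?thesis
      using schwartz_op_comp[OF schwartz_op_rotation_deriv Cons.IH] by (simp only:)
  next
    case (Trans l)
    have "rotation_derivs (v # vs) = rotation_derivs vs"
      by (rule ext) (simp add: Trans)
    then show ?thesis
      using Cons.IH by (simp only:)
  qed
qed

lemma flow_derivs_Cons: "flow_derivs (v # vs) g = flow_deriv v (flow_derivs vs g)"
  by (simp add: flow_derivs_def)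

lemma flow_derivs_kplane:
  assumes "\<phi> \<in> schwartz_space"
  shows "flow_derivs vs (kplane \<phi>) = kplane_deriv (trans_indices vs) (rotation_derivs vs \<phi>)"
proof (induction vs)
  case Nil
  then show ?case
    by (simp add: flow_derivs_def kplane_deriv_Nil assms)
next
  case (Cons v vs)
  note S = schwartz_opD[OF schwartz_op_rotation_derivs assms, of vs]
  show ?case
    unfolding flow_derivs_Cons Cons.IH
    by (rule ext, cases v)
       (simp_all add: flow_deriv_def vector_derivative_at[OF kplane_deriv_flow(1)[OF S]]
          vector_derivative_at[OF kplane_deriv_flow(2)[OF S]])
qed

lemma flow_derivs_kplane_differentiable:
  assumes "\<phi> \<in> schwartz_space"
  shows "(\<lambda>s. flow_derivs vs (kplane \<phi>) (flow v s p)) differentiable (at 0)"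
proof -
  note S = schwartz_opD[OF schwartz_op_rotation_derivs assms, of vs]
  show ?thesis
    unfolding flow_derivs_kplane[OF assms]
    by (cases v) (simp_all add: differentiableI_vector[OF kplane_deriv_flow(1)[OF S]]
        differentiableI_vector[OF kplane_deriv_flow(2)[OF S]] del: flow.simps)
qed

lemma fourier_inv_sum:
  assumes "\<And>i. i \<in> I \<Longrightarrow> integrable lborel (f i)"
  shows "fourier_inv (\<lambda>\<omega>. \<Sum>i\<in>I. c i * f i \<omega>) x = (\<Sum>i\<in>I. c i * fourier_inv (f i) x)"
proof -
  have "fourier (\<lambda>\<omega>. \<Sum>i\<in>I. c i * f i \<omega>) \<xi> = (\<Sum>i\<in>I. c i * fourier (f i) \<xi>)" for \<xi>
    using assms by (subst fourier_sum) (simp_all add: fourier_cmult)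
  then show ?thesis
    by (simp add: fourier_inv_eq sum_divide_distrib)
qed

text \<open>As \<open>A\<close> maps \<open>\<omega> v* A\<close> back to \<open>\<omega>\<close>,
  the coordinate of \<open>\<omega>\<close> at \<open>l\<close> is a combination of coordinates of
  \<open>\<omega> v* A\<close>, with coefficients from row \<open>l\<close> of \<open>A\<close>.
  Those coordinates are symbols of partial derivatives, so derivatives in \<open>t\<close> are
  traded for derivatives of \<open>\<psi>\<close>.\<close>

lemma kplane_deriv_Cons:
  fixes A :: "real^'d^'m"
  assumes A: "A \<in> stiefel" and \<psi>: "\<psi> \<in> schwartz_space"
  shows "kplane_deriv (l # ls) \<psi> (A, t) =
    (\<Sum>a\<in>UNIV. of_real (A $ l $ a) * kplane_deriv ls (partial_deriv (axis a 1) \<psi>) (A, t))"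
proof -
  have ax: "axis a 1 \<in> (Basis :: (real^'d) set)" for a
    by (simp add: axis_in_Basis_iff Basis_real_def)
  note S = schwartz_partial_deriv[OF \<psi> ax]
  have "freq_mono (l # ls) \<omega> * fourier \<psi> (\<omega> v* A) =
      (\<Sum>a\<in>UNIV. of_real (A $ l $ a) * (freq_mono ls \<omega> * fourier (partial_deriv (axis a 1) \<psi>) (\<omega> v* A)))" for \<omega>
  proof -
    have "\<omega> \<bullet> axis l 1 = (A *v (\<omega> v* A)) $ l"
      using A by (simp add: stiefel_mult inner_axis)
    also have "\<dots> = (\<Sum>a\<in>UNIV. A $ l $ a * ((\<omega> v* A) \<bullet> axis a 1))"
      by (simp add: matrix_vector_mult_def inner_axis)
    finally have "freq_mono (l # ls) \<omega> * fourier \<psi> (\<omega> v* A) =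
        \<i> * of_real (\<Sum>a\<in>UNIV. A $ l $ a * ((\<omega> v* A) \<bullet> axis a 1)) * freq_mono ls \<omega> * fourier \<psi> (\<omega> v* A)"
      by (simp add: freq_mono_def)
    also have "\<dots> = (\<Sum>a\<in>UNIV. of_real (A $ l $ a) * (freq_mono ls \<omega> *
        (\<i> * of_real ((\<omega> v* A) \<bullet> axis a 1) * fourier \<psi> (\<omega> v* A))))"
      by (simp add: sum_distrib_left sum_distrib_right mult_ac)
    finally show ?thesis
      by (simp only: fourier_partial_deriv[OF \<psi> ax])
  qed
  then show ?thesis
    using A fourier_inv_sum[of UNIV "\<lambda>a \<omega>. freq_mono ls \<omega> * fourier (partial_deriv (axis a 1) \<psi>) (\<omega> v* A)"
        "\<lambda>a. of_real (A $ l $ a)" t] rapid_integrable[OF rapid_freq_mono[OF A S]]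
    by (simp add: kplane_deriv_def)
qed

lemma stiefel_entry_le:
  assumes "A \<in> stiefel"
  shows "\<bar>A $ l $ a\<bar> \<le> 1"
proof -
  have "A $ l $ a = (axis l 1 v* A) $ a"
    by (simp add: vector_matrix_mult_def axis_def if_distrib[of "\<lambda>c. c * _"] if_distrib[of "\<lambda>c. _ * c"] sum.delta cong: if_cong)
  then show ?thesis
    using component_le_norm_cart[of "axis l 1 v* A" a] assms by simp
qed

text \<open>Frequency factors are removed one at a time by \<open>kplane_deriv_Cons\<close>. The
  entries of \<open>A\<close> are at most 1 in absolute value, which keeps the estimate uniform on
  the Stiefel manifold; the base case is the decay estimate for \<open>kplane\<close>
  itself.\<close>

lemma kplane_deriv_bound:
  "\<exists>q. dominated q \<and> (\<forall>\<psi>\<in>schwartz_space. \<forall>A\<in>(stiefel :: (real^'d^'m) set). \<forall>t.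
     (1 + norm t) ^ N * cmod (kplane_deriv ls \<psi> (A, t)) \<le> q \<psi>)"
proof (induction ls)
  case Nil
  let ?q = "\<lambda>\<psi>. 2 ^ N * pi ^ (CARD('d) - CARD('m)) * seminorm (2 * (N + CARD('d))) [] (\<psi> :: real^'d \<Rightarrow> complex)"
  have "(1 + norm t) ^ N * cmod (kplane_deriv [] \<psi> (A, t)) \<le> ?q \<psi>"
    if \<psi>: "\<psi> \<in> schwartz_space" and A: "A \<in> stiefel" for \<psi> and A :: "real^'d^'m" and t
  proof -
    have "(1 + norm t) ^ N * cmod (kplane \<psi> (A, t)) \<le> 2 ^ N * (cmod (kplane \<psi> (A, t)) * (1 + (norm t)\<^sup>2) ^ N)"
      using mult_right_mono[OF one_plus_norm_power_le, of "cmod (kplane \<psi> (A, t))" t N]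
      by (simp add: mult_ac)
    also have "\<dots> \<le> 2 ^ N * (seminorm (2 * (N + CARD('d))) [] \<psi> * pi ^ (CARD('d) - CARD('m)))"
      using kplane_weighted_bound[OF A rapidD(2)[OF schwartz_rapid[OF \<psi>]] schwartz_norm_le[OF \<psi>]]
      by (intro mult_left_mono) auto
    finally show ?thesis
      by (simp add: kplane_deriv_Nil[OF \<psi>] mult_ac)
  qed
  moreover have "dominated ?q"
    by (intro dominated_scale dominated_seminorm) auto
  ultimately show ?case
    by blast
next
  case (Cons l ls)
  then obtain q where q: "dominated q" "\<And>\<psi> A t. \<psi> \<in> schwartz_space \<Longrightarrow> A \<in> (stiefel :: (real^'d^'m) set) \<Longrightarrow>
      (1 + norm t) ^ N * cmod (kplane_deriv ls \<psi> (A, t)) \<le> q \<psi>"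
    by blast
  have ax: "axis a 1 \<in> (Basis :: (real^'d) set)" for a
    by (simp add: axis_in_Basis_iff Basis_real_def)
  have "(1 + norm t) ^ N * cmod (kplane_deriv (l # ls) \<psi> (A, t)) \<le> (\<Sum>a\<in>UNIV. q (partial_deriv (axis a 1) \<psi>))"
    if \<psi>: "\<psi> \<in> schwartz_space" and A: "A \<in> stiefel" for \<psi> and A :: "real^'d^'m" and t
  proof -
    let ?g = "\<lambda>a. kplane_deriv ls (partial_deriv (axis a 1) \<psi>) (A, t)"
    have "cmod (kplane_deriv (l # ls) \<psi> (A, t)) \<le> (\<Sum>a\<in>UNIV. cmod (?g a))"
      unfolding kplane_deriv_Cons[OF A \<psi>]
    proof (rule sum_norm_le)
      show "cmod (of_real (A $ l $ a) * ?g a) \<le> cmod (?g a)" for a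
        using stiefel_entry_le[OF A, of l a] by (simp add: norm_mult mult_left_le_one_le)
    qed
    then have "(1 + norm t) ^ N * cmod (kplane_deriv (l # ls) \<psi> (A, t)) \<le> (1 + norm t) ^ N * (\<Sum>a\<in>UNIV. cmod (?g a))"
      by (intro mult_left_mono) auto
    also have "\<dots> \<le> (\<Sum>a\<in>UNIV. q (partial_deriv (axis a 1) \<psi>))"
      unfolding sum_distrib_left by (intro sum_mono q(2) schwartz_partial_deriv \<psi> ax A)
    finally show ?thesis .
  qed
  moreover have "dominated (\<lambda>\<psi>. \<Sum>a\<in>UNIV. q (partial_deriv (axis a 1) \<psi>))"
    by (intro dominated_sum dominated_comp[OF q(1)] schwartz_op_partial_deriv ax)
  ultimately show ?case
    by blast
qed

text \<open>Joint continuity is read off on the frequency side. The integral over the plane would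
  not show it, since the chosen \<open>kernel_basis A\<close> need not vary continuously with
  \<open>A\<close>.\<close>

lemma kplane_deriv_continuous:
  fixes \<psi> :: "real^'d \<Rightarrow> complex"
  assumes \<psi>: "\<psi> \<in> schwartz_space"
  shows "continuous_on (stiefel \<times> UNIV) (kplane_deriv ls \<psi> :: (real^'d^'m) \<times> (real^'m) \<Rightarrow> complex)"
proof -
  let ?F = "\<lambda>p \<omega>. freq_mono ls \<omega> * fourier \<psi> (\<omega> v* fst p) * exp (\<i> * of_real (\<omega> \<bullet> snd p))"
  obtain D M where D: "\<And>\<omega>::real^'m. norm (freq_mono ls \<omega>) \<le> D * (1 + (norm \<omega>)\<^sup>2) ^ M"
    using poly_bounded_freq_mono[of ls] by (auto simp: poly_bounded_def)
  obtain K where K: "\<And>\<xi>. norm (fourier \<psi> \<xi>) \<le> K * (1 / (1 + (norm \<xi>)\<^sup>2) ^ (M + CARD('m)))"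
    using rapid_le_inverse_weight[OF fourier_rapid[OF \<psi>]] by blast
  have "continuous_on (stiefel \<times> UNIV) (\<lambda>p. \<integral>\<omega>. ?F p \<omega> \<partial>lborel)"
  proof (rule continuous_on_integral_param)
    fix p :: "(real^'d^'m) \<times> (real^'m)" and \<omega> :: "real^'m" assume "p \<in> stiefel \<times> UNIV"
    then have A: "fst p \<in> stiefel" by auto
    show "?F p \<in> borel_measurable lborel"
      using integrable_fourier_kernel(3)[OF rapid_integrable[OF rapid_freq_mono[OF A \<psi>]], of ls "snd p"]
      by (rule borel_measurable_integrable)
    have "norm (freq_mono ls \<omega> * fourier \<psi> (\<omega> v* fst p))
        \<le> D * (1 + (norm \<omega>)\<^sup>2) ^ M * (K * (1 / (1 + (norm \<omega>)\<^sup>2) ^ (M + CARD('m))))"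
      using mult_mono[OF D[of \<omega>] K[of "\<omega> v* fst p"] order_trans[OF norm_ge_zero D[of \<omega>]] norm_ge_zero] A
      by (simp add: norm_mult)
    also have "\<dots> = D * K * (1 / (1 + (norm \<omega>)\<^sup>2) ^ CARD('m))"
    proof -
      have "(1 + (norm \<omega>)\<^sup>2) ^ M \<noteq> 0"
        by (simp add: add_nonneg_eq_0_iff)
      then show ?thesis
        by (simp add: power_add)
    qed
    finally show "norm (?F p \<omega>) \<le> D * K * (1 / (1 + (norm \<omega>)\<^sup>2) ^ CARD('m))"
      by (simp only: norm_fourier_kernel(2)[of "\<lambda>_. freq_mono ls \<omega> * fourier \<psi> (\<omega> v* fst p)"])
  next
    show "continuous_on (stiefel \<times> UNIV) (\<lambda>p. ?F p \<omega>)" for \<omega> :: "real^'m"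
      by (intro continuous_intros continuous_on_compose2[OF continuous_on_fourier[OF schwartz_integrable[OF \<psi>], of UNIV]]) auto
    show "integrable lborel (\<lambda>\<omega>::real^'m. D * K * (1 / (1 + (norm \<omega>)\<^sup>2) ^ CARD('m)))"
      using integrable_mult_right[OF integrable_inverse_weight[where 'a="real^'m"], of "D * K"] by simp
  qed
  then have "continuous_on (stiefel \<times> UNIV) (\<lambda>p. (\<integral>\<omega>. ?F p \<omega> \<partial>lborel) / of_real ((2 * pi) ^ CARD('m)))"
    by (intro continuous_intros) auto
  moreover have "(\<integral>\<omega>. ?F p \<omega> \<partial>lborel) / of_real ((2 * pi) ^ CARD('m)) = kplane_deriv ls \<psi> p" if "p \<in> stiefel \<times> UNIV" for p
    using that by (auto simp: kplane_deriv_def fourier_inv_def)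
  ultimately show ?thesis
    by (rule continuous_on_eq)
qed

lemma flow_derivs_kplane_bound:
  "\<exists>q. dominated q \<and> (\<forall>\<phi>\<in>schwartz_space. \<forall>A\<in>(stiefel :: (real^'d^'m) set). \<forall>t.
     (1 + norm t) ^ N * cmod (flow_derivs vs (kplane \<phi>) (A, t)) \<le> q \<phi>)"
proof -
  obtain q where q: "dominated q" "\<And>\<psi> A t. \<psi> \<in> schwartz_space \<Longrightarrow> A \<in> (stiefel :: (real^'d^'m) set) \<Longrightarrow>
     (1 + norm t) ^ N * cmod (kplane_deriv (trans_indices vs) \<psi> (A, t)) \<le> q \<psi>"
    using kplane_deriv_bound[of N "trans_indices vs"] by blast
  have "dominated (\<lambda>\<phi>. q (rotation_derivs vs \<phi>))"
    by (intro dominated_comp[OF q(1)] schwartz_op_rotation_derivs)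
  then show ?thesis
    using q(2) schwartz_opD[OF schwartz_op_rotation_derivs] by (metis flow_derivs_kplane)
qed

lemma kplane_schwartz_Xi:
  assumes \<phi>: "\<phi> \<in> schwartz_space"
  shows "(kplane \<phi> :: (real^'d^'m) \<times> (real^'m) \<Rightarrow> complex) \<in> schwartz_space_Xi"
proof -
  have "bounded ((\<lambda>(A, t). (1 + norm t) ^ N *\<^sub>R flow_derivs vs (kplane \<phi>) (A :: real^'d^'m, t)) ` (stiefel \<times> UNIV))" for vs N
  proof -
    obtain q where "\<And>A t. A \<in> (stiefel :: (real^'d^'m) set) \<Longrightarrow>
       (1 + norm t) ^ N * cmod (flow_derivs vs (kplane \<phi>) (A, t)) \<le> q \<phi>"
      using flow_derivs_kplane_bound[of N vs] \<phi> by blast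
    then show ?thesis
      unfolding bounded_iff by (intro exI[of _ "q \<phi>"]) (auto simp: abs_mult)
  qed
  moreover have "continuous_on (stiefel \<times> UNIV) (flow_derivs vs (kplane \<phi>) :: (real^'d^'m) \<times> (real^'m) \<Rightarrow> complex)" for vs
    unfolding flow_derivs_kplane[OF \<phi>]
    by (rule kplane_deriv_continuous[OF schwartz_opD[OF schwartz_op_rotation_derivs \<phi>]])
  ultimately show ?thesis
    unfolding schwartz_space_Xi_def
    using flow_derivs_kplane_differentiable[OF \<phi>] by (auto simp: kplane_def)
qed

lemma flow_stiefel: "p \<in> stiefel \<times> UNIV \<Longrightarrow> flow v s p \<in> stiefel \<times> UNIV"
  by (cases p; cases v) auto

lemma flow_derivs_diff:
  fixes f g :: "(real^'d^'m) \<times> (real^'m) \<Rightarrow> complex"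
  assumes f: "f \<in> schwartz_space_Xi" and g: "g \<in> schwartz_space_Xi" and "p \<in> stiefel \<times> UNIV"
  shows "flow_derivs vs (\<lambda>y. f y - g y) p = flow_derivs vs f p - flow_derivs vs g p"
  using \<open>p \<in> stiefel \<times> UNIV\<close>
proof (induction vs arbitrary: p)
  case Nil
  then show ?case by (simp add: flow_derivs_def)
next
  case (Cons v vs)
  have d: "(\<lambda>s. flow_derivs vs h (flow v s p)) differentiable (at 0)" if "h \<in> schwartz_space_Xi" for h
    using that Cons.prems by (auto simp: schwartz_space_Xi_def)
  have "(\<lambda>s. flow_derivs vs (\<lambda>y. f y - g y) (flow v s p))
      = (\<lambda>s. flow_derivs vs f (flow v s p) - flow_derivs vs g (flow v s p))"
    by (rule ext) (rule Cons.IH[OF flow_stiefel[OF Cons.prems]])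
  then show ?case
    using d[OF f] d[OF g] by (simp add: flow_derivs_Cons flow_deriv_def vector_derivative_diff_at)
qed

text \<open>The suprema over \<open>stiefel \<times> UNIV\<close> are estimated by
  \<open>cSUP_least\<close>, which asks for a nonempty index set.\<close>

lemma stiefel_nonempty:
  assumes "CARD('m) \<le> CARD('d)"
  shows "(stiefel :: (real^'d^'m) set) \<noteq> {}"
proof -
  obtain f :: "'m \<Rightarrow> 'd" where f: "inj f"
    using card_le_inj[of "UNIV :: 'm set" "UNIV :: 'd set"] assms by auto
  let ?A = "(\<chi> l. axis (f l) 1) :: real^'d^'m"
  have "?A ** transpose ?A = mat 1"
    using f by (auto simp: vec_eq_iff matrix_matrix_mult_def transpose_def mat_def axis_def inj_eq
        if_distrib[of "\<lambda>c. c * _"] sum.delta cong: if_cong)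
  then show ?thesis
    by (auto simp: stiefel_def)
qed

lemma continuous_kplane:
  assumes dim: "CARD('m) \<le> CARD('d)"
  shows "continuous_map schwartz (schwartz_Xi :: ((real^'d^'m) \<times> (real^'m) \<Rightarrow> complex) topology) kplane"
  unfolding schwartz_Xi_def
proof (rule continuous_operator_schwartz)
  let ?S = "stiefel \<times> UNIV :: ((real^'d^'m) \<times> (real^'m)) set"
  let ?q = "\<lambda>(N, vs) g. SUP (A, t)\<in>?S. (1 + norm t) ^ N * cmod (flow_derivs vs g (A, t))"
  have ne: "?S \<noteq> {}"
    using stiefel_nonempty[OF dim] by auto
  show "kplane (\<lambda>x. f x - g x) = (\<lambda>y. kplane f y - kplane g y)"
    if "f \<in> schwartz_space" "g \<in> schwartz_space" for f g
  proof
    fix p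
    have "kplane (\<lambda>x. f x + (- 1) * g x) p = kplane f p + (- 1) * kplane g p"
      using that kplane_add[of f "\<lambda>x. (- 1) * g x" p] kplane_cmult[of "- 1" g p]
      by (simp only: schwartz_rapid schwartz_cmult)
    then show "kplane (\<lambda>x. f x - g x) p = kplane f p - kplane g p"
      by simp
  qed
  show "dominated (\<lambda>f. ?q j (kplane f))" for j
  proof -
    obtain N vs where j: "j = (N, vs)" by (cases j)
    obtain q where q: "dominated q" "\<And>\<phi> A t. \<phi> \<in> schwartz_space \<Longrightarrow> A \<in> (stiefel :: (real^'d^'m) set) \<Longrightarrow>
       (1 + norm t) ^ N * cmod (flow_derivs vs (kplane \<phi>) (A, t)) \<le> q \<phi>"
      using flow_derivs_kplane_bound[of N vs] by blast
    show ?thesis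
      unfolding j prod.case
      by (rule dominated_mono[OF q(1)], rule cSUP_least[OF ne]) (use q(2) in auto)
  qed
  fix j :: "nat \<times> ('d, 'm) frame_field list"
  obtain N vs where j: "j = (N, vs)" by (cases j)
  show "?q j (\<lambda>y. 0) \<le> 0"
  proof -
    have "flow_derivs vs (\<lambda>y. 0) = (\<lambda>y::(real^'d^'m) \<times> (real^'m). 0)" for vs
      by (induction vs) (auto simp: flow_derivs_def flow_deriv_def)
    then show ?thesis
      unfolding j prod.case by (intro cSUP_least[OF ne]) auto
  qed
  fix a b c :: "(real^'d^'m) \<times> (real^'m) \<Rightarrow> complex"
  assume a: "a \<in> schwartz_space_Xi" and b: "b \<in> schwartz_space_Xi" and c: "c \<in> schwartz_space_Xi"
  \<comment> \<open>The triangle inequality for suprema rests on upper bounds for both terms on its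
    right; membership in \<open>schwartz_space_Xi\<close> provides them.\<close>
  have bdd: "bdd_above ((\<lambda>(A, t). (1 + norm t) ^ N * cmod (flow_derivs vs (\<lambda>y. f y - g y) (A, t))) ` ?S)"
    if f: "f \<in> schwartz_space_Xi" and g: "g \<in> schwartz_space_Xi" for f g
  proof -
    obtain B C where B: "\<And>A t. A \<in> stiefel \<Longrightarrow> (1 + norm t) ^ N * cmod (flow_derivs vs f (A, t)) \<le> B"
      and C: "\<And>A t. A \<in> stiefel \<Longrightarrow> (1 + norm t) ^ N * cmod (flow_derivs vs g (A, t)) \<le> C"
    proof -
      have "\<exists>B. \<forall>A\<in>stiefel. \<forall>t. (1 + norm t) ^ N * cmod (flow_derivs vs h (A, t)) \<le> B"
        if "h \<in> schwartz_space_Xi" for h :: "(real^'d^'m) \<times> (real^'m) \<Rightarrow> complex"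
      proof -
        have "bounded ((\<lambda>(A, t). (1 + norm t) ^ N *\<^sub>R flow_derivs vs h (A, t)) ` ?S)"
          using that by (simp add: schwartz_space_Xi_def)
        then show ?thesis
          by (force simp: bounded_iff abs_mult)
      qed
      then show thesis
        using that f g by metis
    qed
    show ?thesis
    proof (rule bdd_aboveI2, clarify)
      fix A :: "real^'d^'m" and t :: "real^'m" assume A: "A \<in> stiefel"
      have "(1 + norm t) ^ N * cmod (flow_derivs vs (\<lambda>y. f y - g y) (A, t))
          \<le> (1 + norm t) ^ N * (cmod (flow_derivs vs f (A, t)) + cmod (flow_derivs vs g (A, t)))"
        using A by (intro mult_left_mono) (auto simp: flow_derivs_diff[OF f g] norm_triangle_ineq4)
      then show "(1 + norm t) ^ N * cmod (flow_derivs vs (\<lambda>y. f y - g y) (A, t)) \<le> B + C"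
        using B[OF A, of t] C[OF A, of t] by (simp add: distrib_left)
    qed
  qed
  show "?q j (\<lambda>y. a y - c y) \<le> ?q j (\<lambda>y. a y - b y) + ?q j (\<lambda>y. b y - c y)"
    unfolding j prod.case
  proof (rule cSUP_least[OF ne], clarify)
    fix A :: "real^'d^'m" and t :: "real^'m" assume A: "A \<in> stiefel"
    let ?w = "(1 + norm t) ^ N"
    have "?w * cmod (flow_derivs vs (\<lambda>y. a y - c y) (A, t))
        \<le> ?w * (cmod (flow_derivs vs (\<lambda>y. a y - b y) (A, t)) + cmod (flow_derivs vs (\<lambda>y. b y - c y) (A, t)))"
      using A norm_triangle_ineq[of "flow_derivs vs a (A, t) - flow_derivs vs b (A, t)" "flow_derivs vs b (A, t) - flow_derivs vs c (A, t)"]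
      by (intro mult_left_mono) (auto simp: flow_derivs_diff a b c)
    also have "\<dots> \<le> (SUP (A, t)\<in>?S. (1 + norm t) ^ N * cmod (flow_derivs vs (\<lambda>y. a y - b y) (A, t)))
        + (SUP (A, t)\<in>?S. (1 + norm t) ^ N * cmod (flow_derivs vs (\<lambda>y. b y - c y) (A, t)))"
      unfolding distrib_left
      using cSUP_upper[OF _ bdd[OF a b], of "(A, t)"] cSUP_upper[OF _ bdd[OF b c], of "(A, t)"] A
      by (intro add_mono) auto
    finally show "?w * cmod (flow_derivs vs (\<lambda>y. a y - c y) (A, t)) \<le> \<dots>" .
  qed
qed (auto intro: kplane_schwartz_Xi)

text \<open>The derivative of order 0, given by the empty list, yields the growth. Continuity and
  growth survive composition with the norm, smoothness at 0 may not.\<close>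

lemma poly_bounded_radial:
  fixes L_rad :: "real \<Rightarrow> complex"
  assumes "slow_growth L_rad"
  shows "poly_bounded (\<lambda>x::'a::euclidean_space. L_rad (norm x))"
proof -
  have "partials [] L_rad differentiable (at x)" for x
    using assms unfolding slow_growth_def smooth_def by blast
  then have "continuous_on UNIV L_rad"
    by (auto intro!: differentiable_imp_continuous_on simp: differentiable_on_def)
  then have "continuous_on UNIV (\<lambda>x::'a. L_rad (norm x))"
    by (rule continuous_on_compose2) (auto intro!: continuous_intros)
  moreover have "\<exists>C N. \<forall>x. cmod (partials [] L_rad x) \<le> C * (1 + norm x) ^ N"
    using assms unfolding slow_growth_def by blast
  then obtain C N where C: "\<And>x. cmod (L_rad x) \<le> C * (1 + norm x) ^ N"
    by auto
  have "cmod (L_rad (norm x)) \<le> C * 2 ^ N * (1 + (norm x)\<^sup>2) ^ N" for x :: 'a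
  proof -
    have "0 \<le> C"
      using C[of 0] by (simp add: order_trans[OF norm_ge_zero])
    from mult_left_mono[OF one_plus_norm_power_le this, of x N] show ?thesis
      using C[of "norm x"] by (simp add: mult.assoc)
  qed
  ultimately show ?thesis
    unfolding poly_bounded_def by blast
qed

section \<open>The intertwining relations\<close>

theorem corollary7p8:
  fixes k :: nat
    and \<sigma> :: "(real^'d^'m) measure"
    and Lm :: "((real^'m \<Rightarrow> complex) \<Rightarrow> complex) \<Rightarrow> (real^'m \<Rightarrow> complex) \<Rightarrow> complex"
    and Ld :: "((real^'d \<Rightarrow> complex) \<Rightarrow> complex) \<Rightarrow> (real^'d \<Rightarrow> complex) \<Rightarrow> complex"
    and Lm_hat :: "real^'m \<Rightarrow> complex"
    and Ld_hat :: "real^'d \<Rightarrow> complex"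
    and L_rad :: "real \<Rightarrow> complex"
  assumes "1 \<le> k" and "CARD('m) + k = CARD('d)"
    and "stiefel_haar k \<sigma>"
    and "continuous_lsi Lm" and "has_frequency_response Lm Lm_hat"
    and "continuous_lsi Ld" and "has_frequency_response Ld Ld_hat"
    and "\<And>\<omega>. Lm_hat \<omega> = L_rad (norm \<omega>)"
    and "\<And>\<xi>. Ld_hat \<xi> = L_rad (norm \<xi>)"
    and "slow_growth L_rad"
  shows "(\<forall>f\<in>dual schwartz.
           kplane_distr k \<sigma> (Ld f) \<in> dual (filtered_range k \<sigma>) \<and>
           dual_map (filtered_range k \<sigma>) (on_t (multiplier_adj Lm_hat)) (kplane_distr k \<sigma> f)
             = kplane_distr k \<sigma> (Ld f)) \<and>
         (\<forall>u\<in>dual (kplane_range :: ((real^'d^'m) \<times> (real^'m) \<Rightarrow> complex) topology).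
           dual_map schwartz (multiplier Ld_hat) (kplane_dual_distr u) \<in> dual schwartz \<and>
           kplane_dual_distr (dual_map kplane_range (on_t (multiplier Lm_hat)) u)
             = dual_map schwartz (multiplier Ld_hat) (kplane_dual_distr u))"
proof -
  note dim = assms(2) and \<sigma> = assms(3)
  have "Ld_hat = (\<lambda>\<xi>. L_rad (norm \<xi>))"
    by (rule ext) (rule assms(9))
  then have Ld_pb: "poly_bounded Ld_hat"
    using poly_bounded_radial[OF assms(10)] by (simp only:)
  \<comment> \<open>Radial symbols are even, so the bilinear adjoint has the same symbol.\<close>
  have adj: "multiplier_adj Ld_hat = multiplier Ld_hat" "multiplier_adj Lm_hat = multiplier Lm_hat"
  proof -
    have "(\<lambda>\<xi>. Ld_hat (- \<xi>)) = Ld_hat" "(\<lambda>\<omega>. Lm_hat (- \<omega>)) = Lm_hat"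
      by (auto simp: fun_eq_iff assms(8,9))
    then show "multiplier_adj Ld_hat = multiplier Ld_hat" "multiplier_adj Lm_hat = multiplier Lm_hat"
      by (simp_all only: multiplier_adj_def)
  qed
  \<comment> \<open>Continuity of \<open>Ld\<close> enters here: it makes the Schwartz space
    invariant under a multiplier whose symbol may be singular at 0.\<close>
  have Ld_S: "multiplier Ld_hat \<phi> \<in> schwartz_space"
    and Ld_eq: "f \<in> dual schwartz \<Longrightarrow> Ld f \<phi> = f (multiplier Ld_hat \<phi>)"
    if "\<phi> \<in> schwartz_space" for f \<phi>
    using lsi_multiplier[OF assms(6,7) Ld_pb that] by (simp_all add: adj)
  have Ld_dual: "Ld f \<in> dual schwartz" if "f \<in> dual schwartz" for f
    using assms(6) that by (auto simp: continuous_lsi_def continuous_map_def topspace_weak_star)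
  have intertwine: "fourier (multiplier Ld_hat \<phi>) (\<omega> v* A) = Lm_hat \<omega> * fourier \<phi> (\<omega> v* A)"
    if "\<phi> \<in> schwartz_space" "A \<in> stiefel" for \<phi> and A :: "real^'d^'m" and \<omega>
    using fourier_multiplier[OF Ld_pb that(1) Ld_S[OF that(1)]] that(2) by (simp add: assms(8,9))
  obtain C where C: "\<And>\<phi>. \<phi> \<in> schwartz_space \<Longrightarrow> kplane_dual \<sigma> (filter_K k (kplane \<phi>)) = (\<lambda>x. C * \<phi> x)"
    using kplane_dual_filter_K[OF dim \<sigma>] by blast
  let ?K = "\<lambda>\<phi>. filter_K k (kplane \<phi>) :: (real^'d^'m) \<times> (real^'m) \<Rightarrow> complex"
  \<comment> \<open>The carrier of a pullback topology keeps only points that are mapped into the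
    target's carrier; the back-projection of \<open>?K \<phi>\<close> is a multiple of
    \<open>\<phi>\<close>, hence a Schwartz function.\<close>
  have top: "topspace (filtered_range k \<sigma>) = ?K ` schwartz_space"
    using C schwartz_cmult by (auto simp: filtered_range_def topspace_pullback_topology)
  have Kin: "?K \<phi> \<in> topspace (filtered_range k \<sigma>)" if "\<phi> \<in> schwartz_space" for \<phi>
    using that by (simp add: top)
  have K_add: "(\<lambda>p. ?K \<phi> p + ?K \<psi> p) = ?K (\<lambda>x. \<phi> x + \<psi> x)"
    and K_cmult: "(\<lambda>p. c * ?K \<phi> p) = ?K (\<lambda>x. c * \<phi> x)"
    if "\<phi> \<in> schwartz_space" "\<psi> \<in> schwartz_space" for \<phi> \<psi> c
    using filter_K_lincomb[where 'm='m, OF that, of k 1 1] filter_K_lincomb[where 'm='m, OF that(1,1), of k c 0]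
    by (auto simp: fun_eq_iff)
  \<comment> \<open>Writing test functions as \<open>?K \<phi>\<close> reduces what follows to
    values of \<open>f\<close> on Schwartz functions; the factor \<open>C\<close> enters both sides
    of the first identity alike.\<close>
  have kd: "kplane_distr k \<sigma> f (?K \<phi>) = f (\<lambda>x. C * \<phi> x)" if "\<phi> \<in> schwartz_space" for f \<phi>
    using that by (simp add: kplane_distr_def dual_map_def Kin C)
  have part1: "kplane_distr k \<sigma> (Ld f) \<in> dual (filtered_range k \<sigma>)"
    "dual_map (filtered_range k \<sigma>) (on_t (multiplier_adj Lm_hat)) (kplane_distr k \<sigma> f) = kplane_distr k \<sigma> (Ld f)"
    if f: "f \<in> dual schwartz" for f
  proof -
    note g = Ld_dual[OF f]
    show "kplane_distr k \<sigma> (Ld f) \<in> dual (filtered_range k \<sigma>)"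
    proof (rule dualI)
      show "kplane_distr k \<sigma> (Ld f) \<in> extensional (topspace (filtered_range k \<sigma>))"
        by (simp add: kplane_distr_def dual_map_def)
      have "continuous_map (filtered_range k \<sigma>) euclidean (Ld f \<circ> kplane_dual \<sigma>)"
        unfolding filtered_range_def by (rule continuous_map_pullback[OF dualD(2)[OF g]])
      then show "continuous_map (filtered_range k \<sigma>) euclidean (kplane_distr k \<sigma> (Ld f))"
        unfolding kplane_distr_def dual_map_def by (intro continuous_map_restrict_cong) (simp add: comp_def)
    next
      fix a b assume "a \<in> topspace (filtered_range k \<sigma>)" "b \<in> topspace (filtered_range k \<sigma>)"
      then obtain \<phi> \<psi> where *: "\<phi> \<in> schwartz_space" "\<psi> \<in> schwartz_space" "a = ?K \<phi>" "b = ?K \<psi>"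
        unfolding top by blast
      have "Ld f (\<lambda>x. C * (\<phi> x + \<psi> x)) = Ld f (\<lambda>x. C * \<phi> x) + Ld f (\<lambda>x. C * \<psi> x)"
        using dualD(3)[OF g, of "\<lambda>x. C * \<phi> x" "\<lambda>x. C * \<psi> x"] * by (simp add: schwartz_cmult distrib_left)
      with * show "kplane_distr k \<sigma> (Ld f) (\<lambda>x. a x + b x) = kplane_distr k \<sigma> (Ld f) a + kplane_distr k \<sigma> (Ld f) b"
        by (simp only: K_add kd schwartz_add)
    next
      fix c a assume "a \<in> topspace (filtered_range k \<sigma>)"
      then obtain \<phi> where *: "\<phi> \<in> schwartz_space" "a = ?K \<phi>"
        unfolding top by blast
      have "Ld f (\<lambda>x. C * (c * \<phi> x)) = c * Ld f (\<lambda>x. C * \<phi> x)"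
        using dualD(4)[OF g, of "\<lambda>x. C * \<phi> x" c] * by (simp add: schwartz_cmult mult.left_commute)
      with * show "kplane_distr k \<sigma> (Ld f) (\<lambda>x. c * a x) = c * kplane_distr k \<sigma> (Ld f) a"
        by (simp only: K_cmult[OF *(1,1)] kd schwartz_cmult)
    qed
    show "dual_map (filtered_range k \<sigma>) (on_t (multiplier_adj Lm_hat)) (kplane_distr k \<sigma> f) = kplane_distr k \<sigma> (Ld f)"
    proof (rule extensionalityI)
      show "dual_map (filtered_range k \<sigma>) (on_t (multiplier_adj Lm_hat)) (kplane_distr k \<sigma> f) \<in> extensional (topspace (filtered_range k \<sigma>))"
        "kplane_distr k \<sigma> (Ld f) \<in> extensional (topspace (filtered_range k \<sigma>))"
        by (simp_all add: kplane_distr_def dual_map_def)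
      fix a assume a: "a \<in> topspace (filtered_range k \<sigma>)"
      then obtain \<phi> where \<phi>: "\<phi> \<in> schwartz_space" "a = ?K \<phi>"
        unfolding top by blast
      have "on_t (multiplier_adj Lm_hat) a = ?K (multiplier Ld_hat \<phi>)"
        unfolding \<phi>(2) adj by (rule on_t_multiplier_filter_K[OF \<phi>(1) Ld_S[OF \<phi>(1)] intertwine[OF \<phi>(1)]])
      then have "dual_map (filtered_range k \<sigma>) (on_t (multiplier_adj Lm_hat)) (kplane_distr k \<sigma> f) a
          = f (\<lambda>x. C * multiplier Ld_hat \<phi> x)"
        using a by (simp add: dual_map_def kd Ld_S \<phi>(1))
      also have "\<dots> = C * Ld f \<phi>"
        using dualD(4)[OF f, of "multiplier Ld_hat \<phi>" C] by (simp add: Ld_S \<phi>(1) Ld_eq[OF \<phi>(1) f])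
      also have "\<dots> = kplane_distr k \<sigma> (Ld f) a"
        using dualD(4)[OF g, of \<phi> C] by (simp add: \<phi> kd)
      finally show "dual_map (filtered_range k \<sigma>) (on_t (multiplier_adj Lm_hat)) (kplane_distr k \<sigma> f) a
          = kplane_distr k \<sigma> (Ld f) a" .
    qed
  qed
  let ?R = "kplane_range :: ((real^'d^'m) \<times> (real^'m) \<Rightarrow> complex) topology"
  \<comment> \<open>Continuity of \<open>kplane\<close> makes \<open>u \<circ> kplane\<close> a
    tempered distribution, to which \<open>Ld\<close> can then be applied.\<close>
  have cont: "continuous_map schwartz ?R kplane"
    unfolding kplane_range_def using continuous_kplane[where 'd='d and 'm='m] dim
    by (auto simp: continuous_map_in_subtopology)
  have Rin: "kplane \<phi> \<in> topspace ?R" if "\<phi> \<in> schwartz_space" for \<phi>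
    using continuous_map_image_subset_topspace[OF cont] that by auto
  have part2: "dual_map schwartz (multiplier Ld_hat) (kplane_dual_distr u) \<in> dual schwartz"
    "kplane_dual_distr (dual_map kplane_range (on_t (multiplier Lm_hat)) u)
       = dual_map schwartz (multiplier Ld_hat) (kplane_dual_distr u)"
    if u: "u \<in> dual ?R" for u
  proof -
    define v where "v = kplane_dual_distr u"
    have v: "v \<phi> = u (kplane \<phi>)" if "\<phi> \<in> schwartz_space" for \<phi>
      using that by (simp add: v_def kplane_dual_distr_def dual_map_def)
    have "v \<in> dual schwartz"
    proof (rule dualI)
      show "v \<in> extensional (topspace schwartz)"
        by (simp add: v_def kplane_dual_distr_def dual_map_def)
      have "continuous_map schwartz euclidean (u \<circ> kplane)"
        by (rule continuous_map_compose[OF cont dualD(2)[OF u]])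
      then show "continuous_map schwartz euclidean v"
        unfolding v_def kplane_dual_distr_def dual_map_def
        by (intro continuous_map_restrict_cong) (simp add: comp_def)
    next
      fix \<phi> \<psi> :: "real^'d \<Rightarrow> complex" assume *: "\<phi> \<in> topspace schwartz" "\<psi> \<in> topspace schwartz"
      then have "kplane (\<lambda>x. \<phi> x + \<psi> x) = (\<lambda>p::(real^'d^'m) \<times> (real^'m). kplane \<phi> p + kplane \<psi> p)"
        by (intro ext kplane_add schwartz_rapid) simp_all
      then show "v (\<lambda>x. \<phi> x + \<psi> x) = v \<phi> + v \<psi>"
        using * dualD(3)[OF u, of "kplane \<phi>" "kplane \<psi>"] by (simp add: v schwartz_add Rin)
    next
      fix c and \<phi> :: "real^'d \<Rightarrow> complex" assume *: "\<phi> \<in> topspace schwartz"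
      have "kplane (\<lambda>x. c * \<phi> x) = (\<lambda>p::(real^'d^'m) \<times> (real^'m). c * kplane \<phi> p)"
        by (intro ext kplane_cmult)
      then show "v (\<lambda>x. c * \<phi> x) = c * v \<phi>"
        using * dualD(4)[OF u, of "kplane \<phi>" c] by (simp add: v schwartz_cmult Rin)
    qed
    \<comment> \<open>The transposed multiplier inherits continuity from \<open>Ld\<close>, which
      maps the dual into itself, so no further seminorm estimate is made.\<close>
    have "dual_map schwartz (multiplier Ld_hat) v = Ld v"
    proof (rule extensionalityI)
      show "dual_map schwartz (multiplier Ld_hat) v \<in> extensional schwartz_space"
        by (simp add: dual_map_def)
      show "Ld v \<in> extensional schwartz_space"
        using dualD(1)[OF Ld_dual[OF \<open>v \<in> dual schwartz\<close>]] by simp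
    qed (simp add: dual_map_def Ld_eq[OF _ \<open>v \<in> dual schwartz\<close>])
    then show "dual_map schwartz (multiplier Ld_hat) (kplane_dual_distr u) \<in> dual schwartz"
      using Ld_dual[OF \<open>v \<in> dual schwartz\<close>] by (simp add: v_def)
    show "kplane_dual_distr (dual_map kplane_range (on_t (multiplier Lm_hat)) u)
       = dual_map schwartz (multiplier Ld_hat) (kplane_dual_distr u)"
      unfolding v_def[symmetric]
    proof (rule extensionalityI)
      show "kplane_dual_distr (dual_map kplane_range (on_t (multiplier Lm_hat)) u) \<in> extensional schwartz_space"
        "dual_map schwartz (multiplier Ld_hat) v \<in> extensional schwartz_space"
        by (simp_all add: kplane_dual_distr_def dual_map_def)
      fix \<phi> :: "real^'d \<Rightarrow> complex" assume \<phi>: "\<phi> \<in> schwartz_space"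
      have "on_t (multiplier Lm_hat) (kplane \<phi>) = (kplane (multiplier Ld_hat \<phi>) :: (real^'d^'m) \<times> (real^'m) \<Rightarrow> complex)"
        by (rule on_t_multiplier_kplane[OF \<phi> Ld_S[OF \<phi>] intertwine[OF \<phi>]])
      then show "kplane_dual_distr (dual_map kplane_range (on_t (multiplier Lm_hat)) u) \<phi>
          = dual_map schwartz (multiplier Ld_hat) v \<phi>"
        using \<phi> by (simp add: kplane_dual_distr_def dual_map_def Rin v Ld_S)
    qed
  qed
  show ?thesis
    using part1 part2 by blast
qed

end
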